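(* Let $(M,\omega)$ be a compact connected quantizable Kähler manifold with very ample quantum line bundle $(L,h)$, and let $x\in M$. The polar divisor $\Sigma_x$ associated to $x$, considered with the multiplicities of its components, is the divisor $(e_x)$, in the sense of algebraic geometry, of the coherent state $e_x$ associated to $x$.
   Context: Quantum line bundle: a holomorphic line bundle $\pi:L\to M$ over the Kähler manifold $(M,\omega)$ with hermitian metric $h$ (conjugate linear in the first argument) whose Chern connection has curvature $F=-\mathrm{i}\,\omega$; locally $\omega=-\mathrm{i}\,\partial\bar\partial\log\hat h$. $M$ is quantizable if such a bundle exists. $L$ very ample means that a basis of global holomorphic sections of $L$ defines a holomorphic embedding of $M$ into projective space. Scalar product on the space $\Gamma_{hol}(M,L)$ of global holomorphic sections: $\langle\varphi,\psi\rangle=\int_M h(\varphi,\psi)\,\Omega$, where $\Omega=\frac{1}{n!}\omega^n$, $n=\dim_{\mathbb{C}}M$, is the (positive) Liouville volume form. Coherent vectors and states: let $L_0$ be the total space of $L$ minus the zero section. For $q\in L_0$ define a linear form $\hat q$ on $\Gamma_{hol}(M,L)$ by $s(\pi(q))=\hat q(s)\,q$. The coherent vector $e_q\in\Gamma_{hol}(M,L)$ is the unique section with $\langle e_q,s\rangle=\hat q(s)$ for all $s$. One has $e_{cq}=\bar c^{-1}e_q$ for $c\in\mathbb{C}^*$, so for $x=\pi(q)$ the class $e_x:=[e_q]\in\mathbb{P}(\Gamma_{hol}(M,L))$ (the coherent state of $x$) is well defined. Divisor of a holomorphic section $s\not\equiv0$: $(s)=\sum_Y n_Y Y$, the sum over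 irreducible codimension-one subvarieties $Y$ of $M$, with $n_Y$ the vanishing order of $s$ along $Y$. The divisor of the coherent state is $(e_x):=(e_q)$ for any $0\ne q\in\pi^{-1}(x)$, independent of $q$. Polar divisor: as a set, $\Sigma_x=\{x'\in M\mid\langle e_q,e_{q'}\rangle=0 \text{ for } 0\ne q'\in\pi^{-1}(x')\}$, where $0\neq q\in\pi^{-1}(x)$. It is considered as a divisor by giving each irreducible component the multiplicity with which the equation $\langle e_{q'},e_q\rangle=0$ vanishes along it, i.e. the vanishing order of the local function $x'\mapsto\langle e_{\sigma(x')},e_q\rangle$, where $\sigma$ is a local non-vanishing holomorphic section of $L$. *)

theory Defs
  imports "HOL-Analysis.Analysis" "HOL-Combinatorics.Permutations"
begin

section \<open>Functions on open subsets of complex n-space\<close>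

definition holomorphic_cn :: "(complex^'n::finite \<Rightarrow> complex) \<Rightarrow> (complex^'n) set \<Rightarrow> bool" where
  "holomorphic_cn f S \<longleftrightarrow>
     (\<forall>z\<in>S. \<exists>D. (f has_derivative D) (at z) \<and> (\<forall>c v. D (c *s v) = c * D v))"

text \<open>\<open>k\<close> times continuously differentiable on an open set, in the real sense.\<close>

primrec Ck_on :: "nat \<Rightarrow> 'a::real_normed_vector set \<Rightarrow> ('a \<Rightarrow> 'b::real_normed_vector) \<Rightarrow> bool" where
  "Ck_on 0 S f \<longleftrightarrow> continuous_on S f"
| "Ck_on (Suc k) S f \<longleftrightarrow> (\<forall>z\<in>S. f differentiable (at z)) \<and>
     (\<forall>v. Ck_on k S (\<lambda>z. frechet_derivative f (at z) v))"

definition smooth_on :: "'a::real_normed_vector set \<Rightarrow> ('a \<Rightarrow> 'b::real_normed_vector) \<Rightarrow> bool" where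
  "smooth_on S f \<longleftrightarrow> (\<forall>k. Ck_on k S f)"


section \<open>Complex manifolds\<close>

text \<open>
  The underlying set of a manifold is the whole type \<open>'m\<close>, its complex dimension is
  \<open>CARD('n)\<close>. A chart is a domain together with a coordinate map, of which only the
  values on the domain matter.
\<close>

type_synonym ('m, 'n) chart = "'m set \<times> ('m \<Rightarrow> complex^'n)"

definition unchart :: "('m, 'n) chart \<Rightarrow> complex^'n \<Rightarrow> 'm" where
  "unchart c = inv_into (fst c) (snd c)"

definition complex_manifold :: "('m::t2_space, 'n::finite) chart set \<Rightarrow> bool" where
  "complex_manifold A \<longleftrightarrow>
     (\<Union>c\<in>A. fst c) = UNIV \<and>
     (\<forall>c\<in>A. open (fst c) \<and> open (snd c ` fst c) \<and>
        (\<exists>g. homeomorphism (fst c) (snd c ` fst c) (snd c) g)) \<and>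
     (\<forall>c\<in>A. \<forall>d\<in>A. \<forall>i.
        holomorphic_cn (\<lambda>z. snd d (unchart c z) $ i) (snd c ` (fst c \<inter> fst d)))"

definition holo_on :: "('m::t2_space, 'n::finite) chart set \<Rightarrow> 'm set \<Rightarrow> ('m \<Rightarrow> complex) \<Rightarrow> bool" where
  "holo_on A W f \<longleftrightarrow> (\<forall>c\<in>A. holomorphic_cn (\<lambda>z. f (unchart c z)) (snd c ` (fst c \<inter> W)))"


section \<open>Kaehler forms and the Liouville volume\<close>

text \<open>
  A real two-form is given by its values in every chart: \<open>\<omega> c x u v\<close> is the value at \<open>x\<close> on
  the tangent vectors with coordinates \<open>u\<close>, \<open>v\<close> with respect to \<open>c\<close>. The complex
  structure of the tangent space is multiplication by \<open>\<i>\<close> on coordinates.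
\<close>

type_synonym ('m, 'n) two_form =
  "('m, 'n) chart \<Rightarrow> 'm \<Rightarrow> complex^'n \<Rightarrow> complex^'n \<Rightarrow> real"

definition two_form_on :: "('m::t2_space, 'n::finite) chart set \<Rightarrow> ('m, 'n) two_form \<Rightarrow> bool" where
  "two_form_on A \<omega> \<longleftrightarrow>
     (\<forall>c\<in>A. \<forall>x\<in>fst c. bilinear (\<omega> c x) \<and> (\<forall>u v. \<omega> c x u v = - \<omega> c x v u)) \<and>
     (\<forall>c\<in>A. \<forall>u v. smooth_on (snd c ` fst c) (\<lambda>z. \<omega> c (unchart c z) u v)) \<and>
     (\<forall>c\<in>A. \<forall>d\<in>A. \<forall>x\<in>fst c \<inter> fst d. \<forall>u v.
        (let D = frechet_derivative (\<lambda>z. snd d (unchart c z)) (at (snd c x))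
         in \<omega> c x u v = \<omega> d x (D u) (D v)))"

text \<open>The exterior derivative is evaluated on constant vector fields, whose brackets vanish.\<close>

definition closed_two_form :: "('m::t2_space, 'n::finite) chart set \<Rightarrow> ('m, 'n) two_form \<Rightarrow> bool" where
  "closed_two_form A \<omega> \<longleftrightarrow>
     (\<forall>c\<in>A. \<forall>x\<in>fst c. \<forall>u v w.
        (let d = (\<lambda>a b. frechet_derivative (\<lambda>z. \<omega> c (unchart c z) a b) (at (snd c x)))
         in d v w u + d w u v + d u v w = 0))"

definition kaehler_manifold :: "('m::t2_space, 'n::finite) chart set \<Rightarrow> ('m, 'n) two_form \<Rightarrow> bool" where
  "kaehler_manifold A \<omega> \<longleftrightarrow>
     complex_manifold A \<and> two_form_on A \<omega> \<and> closed_two_form A \<omega> \<and>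
     (\<forall>c\<in>A. \<forall>x\<in>fst c.
        (\<forall>u v. \<omega> c x (\<i> *s u) (\<i> *s v) = \<omega> c x u v) \<and>
        (\<forall>u. u \<noteq> 0 \<longrightarrow> \<omega> c x u (\<i> *s u) > 0))"

definition real_basis :: "'n::finite \<times> bool \<Rightarrow> complex^'n" where
  "real_basis = (\<lambda>(j, b). axis j (if b then \<i> else 1))"

text \<open>
  The value of \<open>\<omega>\<^sup>n / n!\<close> on the positively oriented basis consisting of the pairs
  \<open>\<partial>/\<partial>x\<^sub>j\<close>, \<open>\<partial>/\<partial>y\<^sub>j\<close>. Here \<open>\<omega>\<^sup>n\<close> is the wedge power,
  \<open>(\<alpha> \<and> \<beta>)(v) = (1 / (p! q!)) \<Sum>\<^sub>\<sigma> sign \<sigma> \<alpha>(v\<^sub>\<sigma>) \<beta>(v\<^sub>\<sigma>)\<close> for forms of degree \<open>p\<close> and \<open>q\<close>,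
  whence the factor \<open>2\<^sup>-\<^sup>n\<close>.
\<close>

definition liouville_density :: "('m, 'n::finite) two_form \<Rightarrow> ('m, 'n) chart \<Rightarrow> 'm \<Rightarrow> real" where
  "liouville_density \<omega> c x =
     (\<Sum>p | p permutes (UNIV :: ('n \<times> bool) set).
        of_int (sign p) *
        (\<Prod>j\<in>UNIV. \<omega> c x (real_basis (p (j, False))) (real_basis (p (j, True)))))
     / (2 ^ CARD('n) * fact (CARD('n)))"

text \<open>
  The integral of a function against \<open>\<Omega> = \<omega>\<^sup>n / n!\<close> over a compact manifold is computed
  by cutting the manifold into finitely many Borel pieces, each relatively compact in a
  chart. By the change of variables formula the result does not depend on how this is done.
\<close>

definition compact_chart_cover ::
  "('m::t2_space, 'n::finite) chart set \<Rightarrow> (('m, 'n) chart \<times> 'm set) list \<Rightarrow> bool" where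
  "compact_chart_cover A cs \<longleftrightarrow>
     (\<forall>(c, K)\<in>set cs. c \<in> A \<and> compact K \<and> K \<subseteq> fst c) \<and> (\<Union>(c, K)\<in>set cs. K) = UNIV"

definition liouville_integral ::
  "('m::t2_space, 'n::finite) chart set \<Rightarrow> ('m, 'n) two_form \<Rightarrow> ('m \<Rightarrow> complex) \<Rightarrow> complex" where
  "liouville_integral A \<omega> f =
     (let cs = (SOME cs. compact_chart_cover A cs)
      in \<Sum>i<length cs. (let c = fst (cs ! i); K = snd (cs ! i) - (\<Union>j<i. snd (cs ! j))
         in LINT z : snd c ` K | lborel.
              liouville_density \<omega> c (unchart c z) *\<^sub>R f (unchart c z)))"


section \<open>Holomorphic line bundles\<close>

text \<open>
  The total space is the whole type \<open>'l\<close>. Its complex structure is the one determined by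
  the local trivializations, so only these are recorded: a trivialization over \<open>U\<close> is the
  fibre coordinate on the part of the total space lying over \<open>U\<close>.
\<close>

record ('m, 'l) line_bundle =
  proj :: "'l \<Rightarrow> 'm"
  fadd :: "'l \<Rightarrow> 'l \<Rightarrow> 'l"
  fscale :: "complex \<Rightarrow> 'l \<Rightarrow> 'l"
  trivs :: "('m set \<times> ('l \<Rightarrow> complex)) set"

definition holomorphic_line_bundle ::
  "('m::t2_space, 'n::finite) chart set \<Rightarrow> ('m, 'l) line_bundle \<Rightarrow> bool" where
  "holomorphic_line_bundle A L \<longleftrightarrow>
     (\<Union>t\<in>trivs L. fst t) = UNIV \<and>
     (\<forall>q q'. proj L q = proj L q' \<longrightarrow> proj L (fadd L q q') = proj L q) \<and>
     (\<forall>a q. proj L (fscale L a q) = proj L q) \<and>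
     (\<forall>(U, \<tau>)\<in>trivs L. open U \<and>
        (\<forall>x\<in>U. bij_betw \<tau> {q. proj L q = x} UNIV) \<and>
        (\<forall>q q'. proj L q \<in> U \<longrightarrow> proj L q' = proj L q \<longrightarrow> \<tau> (fadd L q q') = \<tau> q + \<tau> q') \<and>
        (\<forall>a q. proj L q \<in> U \<longrightarrow> \<tau> (fscale L a q) = a * \<tau> q)) \<and>
     (\<forall>(U, \<tau>)\<in>trivs L. \<forall>(U', \<tau>')\<in>trivs L. \<exists>g. holo_on A (U \<inter> U') g \<and>
        (\<forall>q. proj L q \<in> U \<inter> U' \<longrightarrow> g (proj L q) \<noteq> 0 \<and> \<tau>' q = g (proj L q) * \<tau> q))"

definition nonzero_vectors :: "('m, 'l) line_bundle \<Rightarrow> 'l set" where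
  "nonzero_vectors L = {q. q \<noteq> fscale L 0 q}"

definition holo_section_on ::
  "('m::t2_space, 'n::finite) chart set \<Rightarrow> ('m, 'l) line_bundle \<Rightarrow> 'm set \<Rightarrow> ('m \<Rightarrow> 'l) \<Rightarrow> bool" where
  "holo_section_on A L W s \<longleftrightarrow>
     (\<forall>x\<in>W. proj L (s x) = x) \<and> (\<forall>(U, \<tau>)\<in>trivs L. holo_on A (U \<inter> W) (\<lambda>x. \<tau> (s x)))"

definition global_sections ::
  "('m::t2_space, 'n::finite) chart set \<Rightarrow> ('m, 'l) line_bundle \<Rightarrow> ('m \<Rightarrow> 'l) set" where
  "global_sections A L = {s. holo_section_on A L UNIV s}"

definition local_frame ::
  "('m::t2_space, 'n::finite) chart set \<Rightarrow> ('m, 'l) line_bundle \<Rightarrow> 'm set \<Rightarrow> ('m \<Rightarrow> 'l) \<Rightarrow> bool" where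
  "local_frame A L W \<sigma> \<longleftrightarrow> holo_section_on A L W \<sigma> \<and> (\<forall>x\<in>W. \<sigma> x \<in> nonzero_vectors L)"

definition triv_frame :: "('m, 'l) line_bundle \<Rightarrow> ('l \<Rightarrow> complex) \<Rightarrow> 'm \<Rightarrow> 'l" where
  "triv_frame L \<tau> x = (THE q. proj L q = x \<and> \<tau> q = 1)"


section \<open>Hermitian metrics, curvature, quantum line bundles\<close>

text \<open>The local function \<open>h(\<sigma>, \<sigma>)\<close> for the frame \<open>\<sigma>\<close> of a trivialization, in coordinates.\<close>

definition local_metric ::
  "('m, 'l) line_bundle \<Rightarrow> ('l \<Rightarrow> 'l \<Rightarrow> complex) \<Rightarrow> ('m, 'n::finite) chart \<Rightarrow> ('l \<Rightarrow> complex)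
     \<Rightarrow> complex^'n \<Rightarrow> real" where
  "local_metric L h c \<tau> z =
     Re (h (triv_frame L \<tau> (unchart c z)) (triv_frame L \<tau> (unchart c z)))"

text \<open>Only values on pairs of vectors in the same fibre matter.\<close>

definition hermitian_metric ::
  "('m::t2_space, 'n::finite) chart set \<Rightarrow> ('m, 'l) line_bundle \<Rightarrow> ('l \<Rightarrow> 'l \<Rightarrow> complex) \<Rightarrow> bool" where
  "hermitian_metric A L h \<longleftrightarrow>
     (\<forall>p q r. proj L p = proj L q \<longrightarrow> proj L q = proj L r \<longrightarrow>
        h p (fadd L q r) = h p q + h p r \<and>
        (\<forall>a. h p (fscale L a q) = a * h p q) \<and>
        h q p = cnj (h p q)) \<and>
     (\<forall>q\<in>nonzero_vectors L. Re (h q q) > 0) \<and>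
     (\<forall>c\<in>A. \<forall>(U, \<tau>)\<in>trivs L. smooth_on (snd c ` (fst c \<inter> U)) (local_metric L h c \<tau>))"

text \<open>The component of type \<open>(1,0)\<close> of the differential of a function, as a one-form.\<close>

definition del :: "(complex^'n::finite \<Rightarrow> complex) \<Rightarrow> complex^'n \<Rightarrow> complex^'n \<Rightarrow> complex" where
  "del f z v = (frechet_derivative f (at z) v - \<i> * frechet_derivative f (at z) (\<i> *s v)) / 2"

definition chern_form ::
  "('m, 'l) line_bundle \<Rightarrow> ('l \<Rightarrow> 'l \<Rightarrow> complex) \<Rightarrow> ('m, 'n::finite) chart \<Rightarrow> ('l \<Rightarrow> complex)
     \<Rightarrow> complex^'n \<Rightarrow> complex^'n \<Rightarrow> complex" where
  "chern_form L h c \<tau> = del (\<lambda>z. of_real (ln (local_metric L h c \<tau> z)))"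

text \<open>
  The connection form of the Chern connection in a holomorphic frame is \<open>\<theta> = \<partial> log h(\<sigma>, \<sigma>)\<close>;
  the curvature is \<open>d\<theta>\<close>, evaluated on constant vector fields.
\<close>

definition chern_curvature ::
  "('m, 'l) line_bundle \<Rightarrow> ('l \<Rightarrow> 'l \<Rightarrow> complex) \<Rightarrow> ('m, 'n::finite) chart \<Rightarrow> ('l \<Rightarrow> complex)
     \<Rightarrow> complex^'n \<Rightarrow> complex^'n \<Rightarrow> complex^'n \<Rightarrow> complex" where
  "chern_curvature L h c \<tau> z u v =
     frechet_derivative (\<lambda>w. chern_form L h c \<tau> w v) (at z) u
     - frechet_derivative (\<lambda>w. chern_form L h c \<tau> w u) (at z) v"

definition quantum_line_bundle ::
  "('m::t2_space, 'n::finite) chart set \<Rightarrow> ('m, 'n) two_form \<Rightarrow> ('m, 'l) line_bundle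
     \<Rightarrow> ('l \<Rightarrow> 'l \<Rightarrow> complex) \<Rightarrow> bool" where
  "quantum_line_bundle A \<omega> L h \<longleftrightarrow>
     holomorphic_line_bundle A L \<and> hermitian_metric A L h \<and>
     (\<forall>c\<in>A. \<forall>(U, \<tau>)\<in>trivs L. \<forall>x\<in>fst c \<inter> U. \<forall>u v.
        chern_curvature L h c \<tau> (snd c x) u v = - \<i> * of_real (\<omega> c x u v))"


section \<open>Very ample line bundles\<close>

primrec lincomb ::
  "('m, 'l) line_bundle \<Rightarrow> (nat \<Rightarrow> complex) \<Rightarrow> (nat \<Rightarrow> 'm \<Rightarrow> 'l) \<Rightarrow> nat \<Rightarrow> 'm \<Rightarrow> 'l" where
  "lincomb L a s 0 = (\<lambda>x. fscale L (a 0) (s 0 x))"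
| "lincomb L a s (Suc k) = (\<lambda>x. fadd L (lincomb L a s k x) (fscale L (a (Suc k)) (s (Suc k) x)))"

definition section_basis ::
  "('m::t2_space, 'n::finite) chart set \<Rightarrow> ('m, 'l) line_bundle \<Rightarrow> nat \<Rightarrow> (nat \<Rightarrow> 'm \<Rightarrow> 'l) \<Rightarrow> bool" where
  "section_basis A L N s \<longleftrightarrow>
     (\<forall>i\<le>N. s i \<in> global_sections A L) \<and>
     (\<forall>t\<in>global_sections A L. \<exists>a. t = lincomb L a s N) \<and>
     (\<forall>a b. lincomb L a s N = lincomb L b s N \<longrightarrow> (\<forall>i\<le>N. a i = b i))"

text \<open>
  The point \<open>[s\<^sub>0(x) : \<dots> : s\<^sub>N(x)]\<close> of projective \<open>N\<close>-space, as the set of all its vectors of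
  homogeneous coordinates.
\<close>

definition projective_point ::
  "('m, 'l) line_bundle \<Rightarrow> nat \<Rightarrow> (nat \<Rightarrow> 'm \<Rightarrow> 'l) \<Rightarrow> 'm \<Rightarrow> (nat \<Rightarrow> complex) set" where
  "projective_point L N s x =
     {(\<lambda>i. if i \<le> N then a * \<tau> (s i x) else 0) | a U \<tau>. a \<noteq> 0 \<and> (U, \<tau>) \<in> trivs L \<and> x \<in> U}"

text \<open>
  Well defined, injective and immersive. The functions \<open>s\<^sub>i / s\<^sub>k\<close> are the affine coordinates
  of the image on the standard chart of projective space where the \<open>k\<close>-th homogeneous
  coordinate does not vanish. An injective immersion of a compact manifold is an embedding.
\<close>

definition embeds_by_sections ::
  "('m::t2_space, 'n::finite) chart set \<Rightarrow> ('m, 'l) line_bundle \<Rightarrow> nat \<Rightarrow> (nat \<Rightarrow> 'm \<Rightarrow> 'l) \<Rightarrow> bool" where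
  "embeds_by_sections A L N s \<longleftrightarrow>
     (\<forall>x. \<exists>i\<le>N. s i x \<in> nonzero_vectors L) \<and>
     inj (projective_point L N s) \<and>
     (\<forall>c\<in>A. \<forall>(U, \<tau>)\<in>trivs L. \<forall>x\<in>fst c \<inter> U. \<forall>k\<le>N. s k x \<in> nonzero_vectors L \<longrightarrow>
        (\<forall>v. v \<noteq> 0 \<longrightarrow> (\<exists>i\<le>N.
           frechet_derivative (\<lambda>z. \<tau> (s i (unchart c z)) / \<tau> (s k (unchart c z)))
             (at (snd c x)) v \<noteq> 0)))"

definition very_ample ::
  "('m::t2_space, 'n::finite) chart set \<Rightarrow> ('m, 'l) line_bundle \<Rightarrow> bool" where
  "very_ample A L \<longleftrightarrow> (\<exists>N s. section_basis A L N s \<and> embeds_by_sections A L N s)"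


section \<open>Coherent vectors and coherent states\<close>

definition section_inner ::
  "('m::t2_space, 'n::finite) chart set \<Rightarrow> ('m, 'n) two_form \<Rightarrow> ('l \<Rightarrow> 'l \<Rightarrow> complex)
     \<Rightarrow> ('m \<Rightarrow> 'l) \<Rightarrow> ('m \<Rightarrow> 'l) \<Rightarrow> complex" where
  "section_inner A \<omega> h s t = liouville_integral A \<omega> (\<lambda>x. h (s x) (t x))"

definition qhat :: "('m, 'l) line_bundle \<Rightarrow> 'l \<Rightarrow> ('m \<Rightarrow> 'l) \<Rightarrow> complex" where
  "qhat L q s = (THE a. s (proj L q) = fscale L a q)"

definition coherent_vector ::
  "('m::t2_space, 'n::finite) chart set \<Rightarrow> ('m, 'n) two_form \<Rightarrow> ('m, 'l) line_bundle
     \<Rightarrow> ('l \<Rightarrow> 'l \<Rightarrow> complex) \<Rightarrow> 'l \<Rightarrow> 'm \<Rightarrow> 'l" where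
  "coherent_vector A \<omega> L h q =
     (THE e. e \<in> global_sections A L \<and>
        (\<forall>s\<in>global_sections A L. section_inner A \<omega> h e s = qhat L q s))"

text \<open>A point of the projective space of sections is the set of its representatives.\<close>

definition coherent_state ::
  "('m::t2_space, 'n::finite) chart set \<Rightarrow> ('m, 'n) two_form \<Rightarrow> ('m, 'l) line_bundle
     \<Rightarrow> ('l \<Rightarrow> 'l \<Rightarrow> complex) \<Rightarrow> 'm \<Rightarrow> ('m \<Rightarrow> 'l) set" where
  "coherent_state A \<omega> L h x =
     {(\<lambda>y. fscale L a (coherent_vector A \<omega> L h q y)) | a q.
        a \<noteq> 0 \<and> q \<in> nonzero_vectors L \<and> proj L q = x}"


section \<open>Analytic subsets\<close>

definition analytic_subset :: "('m::t2_space, 'n::finite) chart set \<Rightarrow> 'm set \<Rightarrow> bool" where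
  "analytic_subset A V \<longleftrightarrow>
     (\<forall>p. \<exists>U F. open U \<and> p \<in> U \<and> finite F \<and> (\<forall>f\<in>F. holo_on A U f) \<and>
        V \<inter> U = {x\<in>U. \<forall>f\<in>F. f x = 0})"

definition irreducible_subvariety :: "('m::t2_space, 'n::finite) chart set \<Rightarrow> 'm set \<Rightarrow> bool" where
  "irreducible_subvariety A V \<longleftrightarrow>
     analytic_subset A V \<and> V \<noteq> {} \<and>
     (\<forall>V1 V2. analytic_subset A V1 \<longrightarrow> analytic_subset A V2 \<longrightarrow> V = V1 \<union> V2 \<longrightarrow> V = V1 \<or> V = V2)"

definition irreducible_component ::
  "('m::t2_space, 'n::finite) chart set \<Rightarrow> 'm set \<Rightarrow> 'm set \<Rightarrow> bool" where
  "irreducible_component A V Y \<longleftrightarrow>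
     irreducible_subvariety A Y \<and> Y \<subseteq> V \<and>
     (\<forall>Z. irreducible_subvariety A Z \<longrightarrow> Y \<subseteq> Z \<longrightarrow> Z \<subseteq> V \<longrightarrow> Z = Y)"

text \<open>Near \<open>p\<close> the set is a complex submanifold of codimension one.\<close>

definition smooth_hypersurface_at ::
  "('m::t2_space, 'n::finite) chart set \<Rightarrow> 'm set \<Rightarrow> 'm \<Rightarrow> bool" where
  "smooth_hypersurface_at A V p \<longleftrightarrow>
     p \<in> V \<and> (\<exists>U f. open U \<and> p \<in> U \<and> holo_on A U f \<and> V \<inter> U = {x\<in>U. f x = 0} \<and>
       (\<forall>c\<in>A. p \<in> fst c \<longrightarrow>
          (\<exists>v. frechet_derivative (\<lambda>z. f (unchart c z)) (at (snd c p)) v \<noteq> 0)))"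

text \<open>
  The regular points of an irreducible subvariety form a connected manifold, so its
  codimension can be read off at any single one of them.
\<close>

definition irreducible_hypersurface :: "('m::t2_space, 'n::finite) chart set \<Rightarrow> 'm set \<Rightarrow> bool" where
  "irreducible_hypersurface A Y \<longleftrightarrow>
     irreducible_subvariety A Y \<and> (\<exists>p. smooth_hypersurface_at A Y p)"


section \<open>Vanishing orders and divisors\<close>

definition germ_dvd ::
  "('m::t2_space, 'n::finite) chart set \<Rightarrow> 'm \<Rightarrow> ('m \<Rightarrow> complex) \<Rightarrow> ('m \<Rightarrow> complex) \<Rightarrow> bool" where
  "germ_dvd A p f g \<longleftrightarrow>
     (\<exists>W k. open W \<and> p \<in> W \<and> holo_on A W k \<and> (\<forall>x\<in>W. g x = f x * k x))"

text \<open>A local defining function: a generator of the ideal of germs at \<open>p\<close> vanishing on \<open>Y\<close>.\<close>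

definition local_defining_function ::
  "('m::t2_space, 'n::finite) chart set \<Rightarrow> 'm set \<Rightarrow> 'm \<Rightarrow> ('m \<Rightarrow> complex) \<Rightarrow> bool" where
  "local_defining_function A Y p f \<longleftrightarrow>
     (\<exists>U. open U \<and> p \<in> U \<and> holo_on A U f \<and> (\<forall>x\<in>Y \<inter> U. f x = 0)) \<and>
     (\<forall>V g. open V \<longrightarrow> p \<in> V \<longrightarrow> holo_on A V g \<longrightarrow> (\<forall>x\<in>Y \<inter> V. g x = 0) \<longrightarrow> germ_dvd A p f g)"

text \<open>
  An equation on the manifold is given by a family \<open>E\<close> of functions on open sets, two of
  which differ by a nowhere vanishing holomorphic factor where both are defined. Its
  vanishing order along \<open>Y\<close> at \<open>p\<close> is the largest power of a local defining function
  of \<open>Y\<close> at \<open>p\<close> that divides it in the local ring. Along an irreducible hypersurface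
  \<open>Y\<close> it does not depend on \<open>p\<close>, so that the infimum is the common value.
\<close>

type_synonym 'm local_functions = "('m set \<times> ('m \<Rightarrow> complex)) set"

definition vanishing_order_at ::
  "('m::t2_space, 'n::finite) chart set \<Rightarrow> 'm local_functions \<Rightarrow> 'm set \<Rightarrow> 'm \<Rightarrow> nat" where
  "vanishing_order_at A E Y p =
     Sup {a. \<exists>(U, g)\<in>E. \<exists>f. p \<in> U \<and> local_defining_function A Y p f \<and> germ_dvd A p (\<lambda>x. f x ^ a) g}"

definition vanishing_order ::
  "('m::t2_space, 'n::finite) chart set \<Rightarrow> 'm local_functions \<Rightarrow> 'm set \<Rightarrow> nat" where
  "vanishing_order A E Y = (INF p\<in>Y. vanishing_order_at A E Y p)"

text \<open>A divisor is given by the function assigning to each set \<open>Y\<close> its coefficient.\<close>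

definition section_divisor ::
  "('m::t2_space, 'n::finite) chart set \<Rightarrow> ('m, 'l) line_bundle \<Rightarrow> ('m \<Rightarrow> 'l) \<Rightarrow> 'm set \<Rightarrow> int" where
  "section_divisor A L s Y =
     (if irreducible_hypersurface A Y
      then int (vanishing_order A {(U, \<lambda>x. \<tau> (s x)) | U \<tau>. (U, \<tau>) \<in> trivs L} Y)
      else 0)"

definition polar_set ::
  "('m::t2_space, 'n::finite) chart set \<Rightarrow> ('m, 'n) two_form \<Rightarrow> ('m, 'l) line_bundle
     \<Rightarrow> ('l \<Rightarrow> 'l \<Rightarrow> complex) \<Rightarrow> 'm \<Rightarrow> 'm set" where
  "polar_set A \<omega> L h x =
     {x'. \<forall>q q'. q \<in> nonzero_vectors L \<longrightarrow> proj L q = x \<longrightarrow>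
        q' \<in> nonzero_vectors L \<longrightarrow> proj L q' = x' \<longrightarrow>
        section_inner A \<omega> h (coherent_vector A \<omega> L h q) (coherent_vector A \<omega> L h q') = 0}"

definition polar_functions ::
  "('m::t2_space, 'n::finite) chart set \<Rightarrow> ('m, 'n) two_form \<Rightarrow> ('m, 'l) line_bundle
     \<Rightarrow> ('l \<Rightarrow> 'l \<Rightarrow> complex) \<Rightarrow> 'm \<Rightarrow> 'm local_functions" where
  "polar_functions A \<omega> L h x =
     {(U, \<lambda>x'. section_inner A \<omega> h (coherent_vector A \<omega> L h (\<sigma> x')) (coherent_vector A \<omega> L h q))
        | U \<sigma> q. open U \<and> local_frame A L U \<sigma> \<and> q \<in> nonzero_vectors L \<and> proj L q = x}"

definition polar_divisor ::
  "('m::t2_space, 'n::finite) chart set \<Rightarrow> ('m, 'n) two_form \<Rightarrow> ('m, 'l) line_bundle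
     \<Rightarrow> ('l \<Rightarrow> 'l \<Rightarrow> complex) \<Rightarrow> 'm \<Rightarrow> 'm set \<Rightarrow> int" where
  "polar_divisor A \<omega> L h x Y =
     (if irreducible_component A (polar_set A \<omega> L h x) Y
      then int (vanishing_order A (polar_functions A \<omega> L h x) Y)
      else 0)"

end

theory Submission
  imports Defs "HOL-Complex_Analysis.Complex_Analysis"
begin

text \<open>
  By the reproducing property, \<open>\<langle>e\<^sub>q\<^sub>', e\<^sub>q\<rangle>\<close> with \<open>q' = \<sigma>(x')\<close> is the coefficient of \<open>e\<^sub>q(x')\<close> with
  respect to the frame \<open>\<sigma>\<close>. So the polar equation is the local equation of the section \<open>e\<^sub>q\<close> up to
  a unit, and both divisors assign the same vanishing order to every set \<open>Y\<close>. It remains to see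
  that an irreducible \<open>Y\<close> along which the order is positive is at the same time a hypersurface and
  a component of the zero set of \<open>e\<^sub>q\<close>. A positive order provides a generator \<open>f\<close> of the ideal of
  \<open>Y\<close> at each of its points. If all partial derivatives of \<open>f\<close> vanished on \<open>Y\<close>, then \<open>f\<close> would
  divide them and hence be \<open>0\<close>; so \<open>Y\<close> has a smooth point of codimension one. For maximality one
  divides the section by the largest power of the generators that occurs along all of \<open>Y\<close>. As a
  generator at a point remains one at nearby points, the zero sets of the quotients form an
  analytic set, which together with \<open>Y\<close> covers the zero set but does not contain \<open>Y\<close>.

  Coherent vectors exist because the scalar product is definite, and this needs the positivity of
  the density of \<open>\<omega>\<^sup>n / n!\<close>, a Pfaffian.
\<close>

section \<open>Holomorphic functions of several complex variables\<close>

text \<open>The two divisors differ only in their side conditions on \<open>Y\<close>, so nothing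
  has to be compared where the common order is 0. The delicate point is that a generator
  \<open>f\<close> of the ideal of \<open>Y\<close> at \<open>p\<close> generates it at nearby
  points \<open>y\<close> as well: a generator \<open>f'\<close> at \<open>y\<close> gives
  \<open>f = f' * w\<close>, and \<open>w y = 0\<close> has to be excluded. For this,
  \<open>f\<close> is restricted to parallel lines, in a direction along which it is not identically
  0 at \<open>p\<close>. The single roots on such a line do not depend holomorphically on the line,
  but their power sums do, by the argument principle, and so do the discriminants formed from them.
  Since \<open>holomorphic_cn\<close> only asks for a complex linear derivative at each point, the
  holomorphy of such integrals is obtained from Osgood's lemma. That \<open>Y\<close> has a
  generator at each of its points is contained in positivity of the order, because the supremum of
  the empty set of exponents is 0.\<close>

lemma norm_vector_smult: "norm (c *s v) = cmod c * norm (v :: complex^'n::finite)"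
  by (simp add: norm_vec_def norm_mult L2_set_right_distrib)

lemma of_real_smult: "(of_real r :: complex) *s v = r *\<^sub>R (v :: complex^'n::finite)"
  by (vector scaleR_conv_of_real)

lemma bounded_linear_smult_left: "bounded_linear (\<lambda>t::complex. t *s (v :: complex^'n::finite))"
  by (rule bounded_linear_intro[where K = "norm v"])
    (simp_all add: vector_sadd_rdistrib norm_vector_smult scaleR_conv_of_real[where 'a = complex] vector_smult_assoc flip: of_real_smult)

lemma continuous_on_line [continuous_intros]:
  assumes "continuous_on S f" "continuous_on S g"
  shows "continuous_on S (\<lambda>x. f x *s (g x :: complex^'n::finite))"
  unfolding vector_scalar_mult_def using assms
  by (intro continuous_intros) auto

lemma open_line_preimage:
  fixes z w :: "complex^'n::finite"
  assumes "open S" shows "open {t. z + t *s w \<in> S}"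
proof -
  have "continuous_on UNIV (\<lambda>t. z + t *s w)" by (intro continuous_intros)
  from open_vimage[OF assms this] show ?thesis by (simp add: vimage_def)
qed

lemma convex_line_preimage:
  fixes z w :: "complex^'n::finite"
  assumes "convex S" shows "convex {t. z + t *s w \<in> S}"
proof (rule convexI)
  fix x y :: complex and u v :: real
  assume xy: "x \<in> {t. z + t *s w \<in> S}" "y \<in> {t. z + t *s w \<in> S}" "0 \<le> u" "0 \<le> v" "u + v = 1"
  have "u *\<^sub>R (z + x *s w) + v *\<^sub>R (z + y *s w) \<in> S" using xy convexD[OF assms] by auto
  moreover have "u *\<^sub>R (z + x *s w) + v *\<^sub>R (z + y *s w) = (u + v) *\<^sub>R z + (u *\<^sub>R x + v *\<^sub>R y) *s w"
    by (simp add: vec_eq_iff scaleR_conv_of_real[where 'a = complex] algebra_simps)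
  ultimately show "u *\<^sub>R x + v *\<^sub>R y \<in> {t. z + t *s w \<in> S}" using xy by simp
qed

lemma line_shift_derivative:
  fixes z w :: "complex^'n::finite"
  assumes "((\<lambda>t. f ((z + s *s w) + t *s w)) has_field_derivative d) (at 0)"
  shows "((\<lambda>t. f (z + t *s w)) has_field_derivative d) (at s)"
proof -
  have "((\<lambda>t. f (z + (s + t) *s w)) has_field_derivative d) (at 0)"
    using assms by (simp add: vector_sadd_rdistrib add.assoc)
  then show ?thesis using DERIV_at_within_shift[of "\<lambda>t. f (z + t *s w)" d s 0 UNIV] by simp
qed

section \<open>Osgood's lemma\<close>

context
  fixes f :: "complex^'n::finite \<Rightarrow> complex" and S :: "(complex^'n) set"
  assumes S: "open S" and cont: "continuous_on S f"
    and lines: "\<And>z w. z \<in> S \<Longrightarrow> (\<lambda>t. f (z + t *s w)) field_differentiable (at 0)"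
begin

private abbreviation "D z w \<equiv> deriv (\<lambda>t. f (z + t *s w)) 0"

private lemma line_deriv: "z \<in> S \<Longrightarrow> ((\<lambda>t. f (z + t *s w)) has_field_derivative D z w) (at 0)"
  by (rule lines[THEN field_differentiable_derivI])

private lemma line_holo: "(\<lambda>t. f (z + t *s w)) holomorphic_on {t. z + t *s w \<in> S}"
  unfolding holomorphic_on_def
proof
  fix s assume "s \<in> {t. z + t *s w \<in> S}"
  then have "z + s *s w \<in> S" by simp
  from line_shift_derivative[OF line_deriv[OF this]]
  show "(\<lambda>t. f (z + t *s w)) field_differentiable at s within {t. z + t *s w \<in> S}"
    using field_differentiable_def has_field_derivative_at_within by blast
qed

private lemma D_scale: assumes "z \<in> S" shows "D z (c *s w) = c * D z w"
proof -
  have "((\<lambda>t. f (z + t *s w)) has_field_derivative D z w) (at (0 * c))"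
    using line_deriv[OF assms] by simp
  moreover have "((\<lambda>t. t * c) has_field_derivative c) (at 0)"
    by (auto intro!: derivative_eq_intros)
  ultimately have "((\<lambda>t. f (z + (t * c) *s w)) has_field_derivative D z w * c) (at 0)"
    by (rule DERIV_chain2[where f = "\<lambda>t. f (z + t *s w)" and g = "\<lambda>t. t * c"])
  then have "((\<lambda>t. f (z + t *s (c *s w))) has_field_derivative c * D z w) (at 0)"
    by (simp only: vector_smult_assoc mult.commute)
  then show ?thesis by (rule DERIV_imp_deriv)
qed

text \<open>Cauchy's estimate bounds the second derivative of
  \<open>t \<mapsto> f (z + t *s w)\<close> on the disc of radius \<open>R/2\<close> by
  \<open>8 * M / R^2\<close>, where \<open>M\<close> bounds \<open>f\<close> on a fixed compact
  ball. As \<open>R = \<rho> / norm w\<close>, the remainder of the Taylor expansion at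
  \<open>t = 1\<close> is quadratic in \<open>norm w\<close>, uniformly in the base point and the
  direction.\<close>

private lemma taylor:
  assumes "z0 \<in> S"
  obtains \<rho> C where "\<rho> > 0" "ball z0 (2*\<rho>) \<subseteq> S" "C \<ge> 0"
    "\<And>z w. z \<in> ball z0 \<rho> \<Longrightarrow> norm w \<le> \<rho> / 2 \<Longrightarrow> norm (f (z + w) - f z - D z w) \<le> C * (norm w)^2"
proof -
  obtain e where e: "e > 0" "cball z0 e \<subseteq> S" using S assms open_contains_cball by blast
  define \<rho> where "\<rho> = e / 2"
  have "compact (f ` cball z0 e)" using cont e by (intro compact_continuous_image) (auto intro: continuous_on_subset)
  then obtain M0 where M0: "\<forall>y\<in>f ` cball z0 e. norm y \<le> M0" using compact_imp_bounded bounded_iff by blast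
  define M where "M = max M0 0"
  have M: "norm (f y) \<le> M" if "y \<in> cball z0 e" for y using M0 that by (force simp: M_def)
  have M_pos: "M \<ge> 0" by (simp add: M_def)
  have \<rho>: "\<rho> > 0" "2 * \<rho> = e" using e by (auto simp: \<rho>_def)
  have est: "norm (f (z + w) - f z - D z w) \<le> (8 * M / \<rho>^2) * (norm w)^2"
    if z: "z \<in> ball z0 \<rho>" and w: "norm w \<le> \<rho> / 2" for z w
  proof (cases "w = 0")
    case True then show ?thesis by simp
  next
    case False
    \<comment> \<open>For \<open>cmod t \<le> R\<close> the displacement \<open>t *s w\<close> has
      norm at most \<open>\<rho>\<close>. The condition \<open>norm w \<le> \<rho> / 2\<close> gives
      \<open>R / 2 \<ge> 1\<close>, so that \<open>t = 1\<close> lies in the disc where the second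
      derivative is controlled.\<close>
    define R where "R = \<rho> / norm w"
    have R: "R > 0" "R / 2 \<ge> 1" "R * norm w = \<rho>" using False \<rho> w by (auto simp: R_def field_simps)
    have inb: "z + t *s w \<in> cball z0 e" if "cmod t \<le> R" for t
    proof -
      have "norm (t *s w) \<le> \<rho>" using that R by (metis norm_vector_smult mult_right_mono norm_ge_zero)
      then show ?thesis using z \<rho> norm_triangle_ineq4[of "z0 - z" "t *s w"] by (auto simp: dist_norm algebra_simps)
    qed
    define \<phi> where "\<phi> = (\<lambda>t. f (z + t *s w))"
    let ?T = "{t. z + t *s w \<in> S}"
    have T: "open ?T" "cball 0 R \<subseteq> ?T" using open_line_preimage[OF S] inb e by auto
    have holo: "\<phi> holomorphic_on ?T" unfolding \<phi>_def by (rule line_holo)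
    have d0: "(\<phi> has_field_derivative deriv \<phi> s) (at s)" if "s \<in> ?T" for s
      using holo T that by (metis holomorphic_derivI)
    have holo1: "deriv \<phi> holomorphic_on ?T" using holo T by (metis holomorphic_deriv)
    have d1: "(deriv \<phi> has_field_derivative deriv (deriv \<phi>) s) (at s)" if "s \<in> ?T" for s
      using holo1 T that by (metis holomorphic_derivI)
    have bound: "cmod ((deriv ^^ 2) \<phi> s) \<le> fact 2 * M / (R/2)^2" if "s \<in> cball 0 (R/2)" for s
    proof (rule Cauchy_inequality)
      have sub: "cball s (R/2) \<subseteq> cball 0 R" using that by (subst cball_subset_cball_iff) auto
      show "\<phi> holomorphic_on ball s (R/2)" using holomorphic_on_subset[OF holo] sub T ball_subset_cball by blast
      show "continuous_on (cball s (R/2)) \<phi>"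
        using holomorphic_on_imp_continuous_on[OF holo] sub T by (meson continuous_on_subset order_trans)
      show "0 < R/2" using R by simp
      show "norm (\<phi> x) \<le> M" if "norm (s - x) = R/2" for x
      proof -
        have "x \<in> cball 0 R" using sub that by (auto simp: dist_norm)
        then show ?thesis unfolding \<phi>_def by (intro M inb) simp
      qed
    qed
    define F where "F = (\<lambda>i::nat. (deriv ^^ i) \<phi>)"
    have "cmod (F 0 1 - (\<Sum>i\<le>1. F i 0 * (1 - 0)^i / fact i)) \<le> (8 * M / R^2) * cmod (1 - 0) ^ Suc 1 / fact 1"
    proof (rule complex_Taylor[where S = "cball 0 (R/2)"])
      show "(F i has_field_derivative F (Suc i) x) (at x within cball 0 (R/2))" if "x \<in> cball 0 (R/2)" "i \<le> 1" for i x
      proof -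
        have "x \<in> cball 0 R" using that R by auto
        then have "x \<in> ?T" using T by auto
        then have "(F i has_field_derivative F (Suc i) x) (at x)"
          using that d0[of x] d1[of x] by (cases i) (auto simp: F_def)
        then show ?thesis by (rule DERIV_subset) simp
      qed
      show "cmod (F (Suc 1) x) \<le> 8 * M / R\<^sup>2" if "x \<in> cball 0 (R/2)" for x
        using bound[OF that] by (simp add: F_def power_divide numeral_2_eq_2)
    qed (use R in auto)
    moreover have "8 * M / R^2 = (8 * M / \<rho>^2) * (norm w)^2" using False by (simp add: R_def power_divide)
    ultimately show ?thesis by (simp add: F_def \<phi>_def diff_diff_eq)
  qed
  show ?thesis by (rule that[of \<rho> "8 * M / \<rho>^2"]) (use est \<rho> e M_pos in auto)
qed

text \<open>The difference quotients with real step \<open>t\<close> are continuous in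
  \<open>z\<close>, and by \<open>taylor\<close> they differ from \<open>D z w\<close> by at most
  \<open>t * (C * (norm w)^2)\<close>. So \<open>D z w\<close> is locally a uniform limit of
  continuous functions.\<close>

private lemma D_cont: "continuous_on S (\<lambda>z. D z w)"
proof -
  have "\<exists>\<rho>>0. continuous_on (ball z0 \<rho>) (\<lambda>z. D z w)" if z0: "z0 \<in> S" for z0
  proof -
    obtain \<rho> C where \<rho>: "\<rho> > 0" "ball z0 (2*\<rho>) \<subseteq> S" "C \<ge> 0"
      and est: "\<And>z w. z \<in> ball z0 \<rho> \<Longrightarrow> norm w \<le> \<rho> / 2 \<Longrightarrow> norm (f (z + w) - f z - D z w) \<le> C * (norm w)^2"
      using taylor[OF z0] by blast
    define q where "q = (\<lambda>t::real. \<lambda>z. (f (z + of_real t *s w) - f z) / of_real t)"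
    have small: "\<forall>\<^sub>F t in at_right (0::real). 0 < t \<and> norm (of_real t *s w) \<le> \<rho>/2 \<and> t * (C * (norm w)^2) < e" if "e > 0" for e
    proof -
      have "((\<lambda>t. t * (C * (norm w)^2)) \<longlongrightarrow> 0 * (C * (norm w)^2)) (at_right 0)" by (intro tendsto_intros)
      then have 1: "\<forall>\<^sub>F t in at_right (0::real). t * (C * (norm w)^2) < e" using order_tendstoD(2)[of _ _ _ e] that by fastforce
      have "((\<lambda>t. t * norm w) \<longlongrightarrow> 0 * norm w) (at_right 0)" by (intro tendsto_intros)
      then have 2: "\<forall>\<^sub>F t in at_right (0::real). t * norm w < \<rho>/2" using order_tendstoD(2)[of _ _ _ "\<rho>/2"] \<rho> by fastforce
      have 3: "\<forall>\<^sub>F t in at_right (0::real). 0 < t" by (simp add: eventually_at_right_less)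
      from 1 2 3 show ?thesis by eventually_elim (auto simp: norm_vector_smult)
    qed
    have "continuous_on (ball z0 \<rho>) (\<lambda>z. D z w)"
    proof (rule uniform_limit_theorem[where F = "at_right (0::real)" and f = q])
      show "\<forall>\<^sub>F t in at_right 0. continuous_on (ball z0 \<rho>) (q t)"
        using small[of 1, simplified]
      proof eventually_elim
        case (elim t)
        have "z + of_real t *s w \<in> ball z0 (2*\<rho>)" if "z \<in> ball z0 \<rho>" for z
          using elim that \<rho> norm_triangle_ineq4[of "z0 - z" "of_real t *s w"] by (auto simp: dist_norm algebra_simps)
        then have 1: "(\<lambda>z. z + of_real t *s w) ` ball z0 \<rho> \<subseteq> S" using \<rho> by auto
        have 2: "ball z0 \<rho> \<subseteq> S" using \<rho> by (auto simp: subset_iff)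
        have "continuous_on (ball z0 \<rho>) (\<lambda>z. f (z + of_real t *s w))"
          by (rule continuous_on_compose2[OF cont _ 1]) (intro continuous_intros)
        then show ?case unfolding q_def using elim continuous_on_subset[OF cont 2]
          by (intro continuous_intros) auto
      qed
      show "uniform_limit (ball z0 \<rho>) q (\<lambda>z. D z w) (at_right 0)"
      proof (rule uniform_limitI)
        fix e :: real assume "e > 0"
        from small[OF this] show "\<forall>\<^sub>F t in at_right 0. \<forall>z\<in>ball z0 \<rho>. dist (q t z) (D z w) < e"
        proof eventually_elim
          case (elim t)
          then have t: "0 < t" "t * norm w \<le> \<rho> / 2" by (auto simp: norm_vector_smult)
          show ?case
          proof
            fix z assume z: "z \<in> ball z0 \<rho>"
            have zS: "z \<in> S" using z \<rho> by (auto simp: subset_iff)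
            have "norm (f (z + of_real t *s w) - f z - of_real t * D z w) \<le> C * (t * norm w)^2"
              using est[OF z, of "of_real t *s w", unfolded D_scale[OF zS] norm_vector_smult] t by simp
            moreover have "q t z - D z w = (f (z + of_real t *s w) - f z - of_real t * D z w) / of_real t"
              using elim by (simp add: q_def field_simps)
            ultimately have "norm (q t z - D z w) \<le> C * (t * norm w)^2 / t"
              using elim by (simp add: norm_divide divide_right_mono)
            also have "\<dots> = t * (C * (norm w)^2)" using elim by (simp add: power2_eq_square)
            finally show "dist (q t z) (D z w) < e" using elim by (simp add: dist_norm)
          qed
        qed
      qed
    qed simp
    then show ?thesis using \<rho> by blast
  qed
  then have "isCont (\<lambda>z. D z w) z0" if "z0 \<in> S" for z0
    using that continuous_on_eq_continuous_at[OF open_ball] centre_in_ball by blast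
  then show ?thesis by (intro continuous_at_imp_continuous_on ballI)
qed

text \<open>The step along \<open>t (u + v)\<close> is split into a step along \<open>t u\<close>
  from \<open>z\<close> and a step along \<open>t v\<close> from \<open>z + t u\<close>. The
  quotient of the second step is close to \<open>D (z + t u) v\<close> by the uniform estimate, and
  this tends to \<open>D z v\<close> by continuity.\<close>

private lemma D_add: assumes "z \<in> S" shows "D z (u + v) = D z u + D z v"
proof -
  obtain \<rho> C where \<rho>: "\<rho> > 0" "ball z (2*\<rho>) \<subseteq> S" "C \<ge> 0"
    and est: "\<And>y w. y \<in> ball z \<rho> \<Longrightarrow> norm w \<le> \<rho> / 2 \<Longrightarrow> norm (f (y + w) - f y - D y w) \<le> C * (norm w)^2"
    using taylor[OF assms] by blast
  let ?F = "at_right (0::real)"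
  have quot: "((\<lambda>t. (f (z + of_real t *s w) - f z) / of_real t) \<longlongrightarrow> D z w) ?F" for w
  proof -
    have "((\<lambda>t. (f (z + t *s w) - f z) / t) \<longlongrightarrow> D z w) (at 0)"
      using line_deriv[OF assms, of w] by (simp add: DERIV_def)
    moreover have "filterlim (\<lambda>t::real. complex_of_real t) (at 0) ?F"
      by (auto simp: filterlim_at eventually_at_filter intro!: tendsto_eq_intros)
    ultimately show ?thesis by (rule filterlim_compose)
  qed
  have lim1: "((\<lambda>t. z + of_real t *s u) \<longlongrightarrow> z) ?F"
  proof -
    have "continuous (at (0::real)) (\<lambda>t. z + complex_of_real t *s u)"
    proof -
      have "continuous_on UNIV (\<lambda>t::real. z + complex_of_real t *s u)" by (intro continuous_intros)
      then show ?thesis by (simp only: continuous_on_eq_continuous_at open_UNIV ball_UNIV)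
    qed
    then have "((\<lambda>t. z + of_real t *s u) \<longlongrightarrow> z) (at (0::real))" by (auto simp only: isCont_def of_real_0 vector_smult_lzero add_0_right)
    then show ?thesis by (simp only: filterlim_at_split)
  qed
  have Dl: "((\<lambda>t. D (z + of_real t *s u) v) \<longlongrightarrow> D z v) ?F"
    by (rule continuous_on_tendsto_compose[OF D_cont lim1 assms topological_tendstoD[OF lim1 S assms]])
  have ev: "\<forall>\<^sub>F t in ?F. 0 < t \<and> z + of_real t *s u \<in> ball z \<rho> \<and> t * norm v \<le> \<rho> / 2"
  proof -
    have "((\<lambda>t. t * norm v) \<longlongrightarrow> 0 * norm v) ?F" by (intro tendsto_intros)
    then have 2: "\<forall>\<^sub>F t in ?F. t * norm v < \<rho>/2" using order_tendstoD(2)[of _ _ _ "\<rho>/2"] \<rho> by fastforce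
    have 3: "\<forall>\<^sub>F t in ?F. 0 < t" by (simp add: eventually_at_right_less)
    have 4: "\<forall>\<^sub>F t in ?F. z + of_real t *s u \<in> ball z \<rho>" using topological_tendstoD[OF lim1 open_ball, of z \<rho>] \<rho> by simp
    from 2 3 4 show ?thesis by eventually_elim auto
  qed
  let ?y = "\<lambda>t::real. z + of_real t *s u"
  have l0: "((\<lambda>t. (f (?y t + of_real t *s v) - f (?y t)) / of_real t - D (?y t) v) \<longlongrightarrow> 0) ?F"
  proof (rule Lim_null_comparison)
    show "\<forall>\<^sub>F t in ?F. norm ((f (?y t + of_real t *s v) - f (?y t)) / of_real t - D (?y t) v) \<le> t * (C * (norm v)^2)"
      using ev
    proof eventually_elim
      case (elim t)
      have yS: "?y t \<in> S" using elim \<rho> by (auto simp: subset_iff)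
      have "norm (f (?y t + of_real t *s v) - f (?y t) - of_real t * D (?y t) v) \<le> C * (t * norm v)^2"
        using est[of "?y t" "of_real t *s v", unfolded D_scale[OF yS] norm_vector_smult] elim by (simp add: norm_vector_smult)
      moreover have "(f (?y t + of_real t *s v) - f (?y t)) / of_real t - D (?y t) v
         = (f (?y t + of_real t *s v) - f (?y t) - of_real t * D (?y t) v) / of_real t"
        using elim by (simp add: field_simps)
      ultimately have "norm ((f (?y t + of_real t *s v) - f (?y t)) / of_real t - D (?y t) v) \<le> C * (t * norm v)^2 / t"
        using elim by (simp add: norm_divide divide_right_mono)
      also have "\<dots> = t * (C * (norm v)^2)" using elim by (simp add: power2_eq_square)
      finally show ?case .
    qed
    show "((\<lambda>t. t * (C * (norm v)^2)) \<longlongrightarrow> 0) ?F" by (auto intro!: tendsto_eq_intros)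
  qed
  have "((\<lambda>t. ((f (?y t + of_real t *s v) - f (?y t)) / of_real t - D (?y t) v) + D (?y t) v
      + (f (z + of_real t *s u) - f z) / of_real t) \<longlongrightarrow> 0 + D z v + D z u) ?F"
    by (intro tendsto_add l0 Dl quot)
  moreover have "(\<lambda>t. ((f (?y t + of_real t *s v) - f (?y t)) / of_real t - D (?y t) v) + D (?y t) v
      + (f (z + of_real t *s u) - f z) / of_real t) = (\<lambda>t. (f (z + of_real t *s (u+v)) - f z) / of_real t)"
    by (simp add: fun_eq_iff diff_divide_distrib vector_add_ldistrib add.assoc)
  ultimately have "((\<lambda>t. (f (z + of_real t *s (u+v)) - f z) / of_real t) \<longlongrightarrow> 0 + D z v + D z u) ?F"
    by (simp only:)
  from tendsto_unique[OF _ quot this] have "D z (u+v) = 0 + D z v + D z u" by simp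
  then show ?thesis by simp
qed

lemma osgood_has_derivative: assumes "z \<in> S" shows "(f has_derivative D z) (at z)"
proof -
  obtain \<rho> C where \<rho>: "\<rho> > 0" "ball z (2*\<rho>) \<subseteq> S" "C \<ge> 0"
    and est: "\<And>y w. y \<in> ball z \<rho> \<Longrightarrow> norm w \<le> \<rho> / 2 \<Longrightarrow> norm (f (y + w) - f y - D y w) \<le> C * (norm w)^2"
    using taylor[OF assms] by blast
  have "linear (D z)"
  proof (rule linearI)
    show "D z (r *\<^sub>R w) = r *\<^sub>R D z w" for r w
      unfolding of_real_smult[symmetric] D_scale[OF assms] by (simp add: scaleR_conv_of_real)
  qed (rule D_add[OF assms])
  then have "bounded_linear (D z)" by (simp add: linear_conv_bounded_linear)
  moreover have "((\<lambda>h. norm (f (z + h) - f z - D z h) / norm h) \<longlongrightarrow> 0) (at 0)"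
  proof (rule Lim_null_comparison)
    have "\<forall>\<^sub>F h in at 0. norm h < \<rho>/2" using \<rho>
      by (auto simp: eventually_at intro!: exI[of _ "\<rho>/2"])
    then show "\<forall>\<^sub>F h in at 0. norm (norm (f (z + h) - f z - D z h) / norm h) \<le> C * norm h"
    proof eventually_elim
      case (elim h)
      show ?case using est[of z h] elim \<rho>
        by (cases "h = 0") (auto simp: field_simps power2_eq_square)
    qed
    show "((\<lambda>h::complex^'n. C * norm h) \<longlongrightarrow> 0) (at 0)" by (auto intro!: tendsto_eq_intros)
  qed
  ultimately show ?thesis by (simp add: has_derivative_at)
qed

lemma osgood_continuous: "continuous_on S (\<lambda>z. deriv (\<lambda>t. f (z + t *s w)) 0)"
  by (rule D_cont)

text \<open>Intended for functions defined by integrals, where continuity and holomorphy along each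
  line can be checked directly under the integral sign.\<close>

lemma osgood: "holomorphic_cn f S"
  unfolding holomorphic_cn_def using osgood_has_derivative D_scale by blast

end

section \<open>Calculus of holomorphic functions\<close>

lemma holomorphic_cn_derivative:
  assumes "holomorphic_cn f S" "z \<in> S"
  shows "(f has_derivative frechet_derivative f (at z)) (at z)"
    and "frechet_derivative f (at z) (c *s v) = c * frechet_derivative f (at z) v"
proof -
  obtain D where D: "(f has_derivative D) (at z)" "\<forall>c v. D (c *s v) = c * D v"
    using assms by (auto simp: holomorphic_cn_def)
  then have "D = frechet_derivative f (at z)" by (intro frechet_derivative_at)
  with D show "(f has_derivative frechet_derivative f (at z)) (at z)"
    "frechet_derivative f (at z) (c *s v) = c * frechet_derivative f (at z) v" by auto
qed

lemma holomorphic_cn_subset: "holomorphic_cn f S \<Longrightarrow> T \<subseteq> S \<Longrightarrow> holomorphic_cn f T"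
  by (auto simp: holomorphic_cn_def)

lemma holomorphic_cn_continuous_on: "holomorphic_cn f S \<Longrightarrow> continuous_on S f"
  by (intro continuous_at_imp_continuous_on ballI has_derivative_continuous[OF holomorphic_cn_derivative(1)])

lemma holomorphic_cn_cong:
  assumes "open S" "\<And>z. z \<in> S \<Longrightarrow> f z = g z"
  shows "holomorphic_cn f S \<longleftrightarrow> holomorphic_cn g S"
proof -
  have "(f has_derivative D) (at z) \<longleftrightarrow> (g has_derivative D) (at z)" if "z \<in> S" for z D
    using has_derivative_transform_within_open[OF _ assms(1) that] assms(2) by metis
  then show ?thesis by (auto simp: holomorphic_cn_def)
qed

lemma holomorphic_cn_locally:
  "(\<And>z. z \<in> S \<Longrightarrow> \<exists>U. open U \<and> z \<in> U \<and> holomorphic_cn f U) \<Longrightarrow> holomorphic_cn f S"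
  by (auto simp: holomorphic_cn_def)

lemma holomorphic_cn_const: "holomorphic_cn (\<lambda>z. c) S"
  unfolding holomorphic_cn_def by (auto intro!: exI[of _ "\<lambda>_. 0"])

lemma holomorphic_cn_add:
  assumes "holomorphic_cn f S" "holomorphic_cn g S" shows "holomorphic_cn (\<lambda>z. f z + g z) S"
  unfolding holomorphic_cn_def
proof
  fix z assume z: "z \<in> S"
  show "\<exists>D. ((\<lambda>z. f z + g z) has_derivative D) (at z) \<and> (\<forall>c v. D (c *s v) = c * D v)"
    by (rule exI, rule conjI, rule has_derivative_add[OF holomorphic_cn_derivative(1)[OF assms(1) z] holomorphic_cn_derivative(1)[OF assms(2) z]])
      (simp add: holomorphic_cn_derivative(2)[OF assms(1) z] holomorphic_cn_derivative(2)[OF assms(2) z] algebra_simps)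
qed

lemma holomorphic_cn_mult:
  assumes "holomorphic_cn f S" "holomorphic_cn g S" shows "holomorphic_cn (\<lambda>z. f z * g z) S"
  unfolding holomorphic_cn_def
proof
  fix z assume z: "z \<in> S"
  show "\<exists>D. ((\<lambda>z. f z * g z) has_derivative D) (at z) \<and> (\<forall>c v. D (c *s v) = c * D v)"
    by (rule exI, rule conjI, rule has_derivative_mult[OF holomorphic_cn_derivative(1)[OF assms(1) z] holomorphic_cn_derivative(1)[OF assms(2) z]])
      (simp add: holomorphic_cn_derivative(2)[OF assms(1) z] holomorphic_cn_derivative(2)[OF assms(2) z] algebra_simps)
qed

lemma holomorphic_cn_compose_complex:
  assumes f: "holomorphic_cn f S" and g: "g holomorphic_on T" "open T" "f ` S \<subseteq> T"
  shows "holomorphic_cn (\<lambda>z. g (f z)) S"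
  unfolding holomorphic_cn_def
proof
  fix z assume z: "z \<in> S"
  have "(g has_field_derivative deriv g (f z)) (at (f z))" using g z by (auto intro: holomorphic_derivI)
  then have "(g has_derivative (*) (deriv g (f z))) (at (f z))" by (simp add: has_field_derivative_def)
  from has_derivative_compose[OF holomorphic_cn_derivative(1)[OF f z] this]
  show "\<exists>D. ((\<lambda>z. g (f z)) has_derivative D) (at z) \<and> (\<forall>c v. D (c *s v) = c * D v)"
    by (intro exI conjI) (auto simp add: holomorphic_cn_derivative(2)[OF f z])
qed

lemma holomorphic_cn_inverse:
  assumes "holomorphic_cn f S" "\<And>z. z \<in> S \<Longrightarrow> f z \<noteq> 0" shows "holomorphic_cn (\<lambda>z. inverse (f z)) S"
  by (rule holomorphic_cn_compose_complex[OF assms(1), of inverse "- {0}"])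
    (use assms(2) in \<open>auto intro!: holomorphic_intros\<close>)

lemma holomorphic_cn_divide:
  assumes "holomorphic_cn f S" "holomorphic_cn g S" "\<And>z. z \<in> S \<Longrightarrow> g z \<noteq> 0"
  shows "holomorphic_cn (\<lambda>z. f z / g z) S"
  using holomorphic_cn_mult[OF assms(1) holomorphic_cn_inverse[OF assms(2,3)]] by (simp add: divide_inverse)

lemma holomorphic_cn_power: "holomorphic_cn f S \<Longrightarrow> holomorphic_cn (\<lambda>z. f z ^ n) S"
  by (induction n) (auto intro: holomorphic_cn_const holomorphic_cn_mult)

lemma holomorphic_cn_prod: "(\<And>i. i \<in> I \<Longrightarrow> holomorphic_cn (f i) S) \<Longrightarrow> holomorphic_cn (\<lambda>z. \<Prod>i\<in>I. f i z) S"
  by (induction I rule: infinite_finite_induct) (auto intro: holomorphic_cn_const holomorphic_cn_mult)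

lemma holomorphic_cn_line_derivative:
  assumes "holomorphic_cn f S" "z + s *s w \<in> S"
  shows "((\<lambda>t. f (z + t *s w)) has_field_derivative frechet_derivative f (at (z + s *s w)) w) (at s)"
proof -
  have 1: "((\<lambda>t. z + t *s w) has_derivative (\<lambda>t. t *s w)) (at s)"
    using bounded_linear_imp_has_derivative[OF bounded_linear_smult_left] by (auto intro!: derivative_eq_intros)
  have "((\<lambda>t. f (z + t *s w)) has_derivative (\<lambda>t. frechet_derivative f (at (z + s *s w)) (t *s w))) (at s)"
    using has_derivative_compose[OF 1 holomorphic_cn_derivative(1)[OF assms]] .
  then show ?thesis
    by (simp add: holomorphic_cn_derivative(2)[OF assms] has_field_derivative_def mult.commute[of _ "frechet_derivative _ _ _"])
qed

lemma holomorphic_cn_line: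
  assumes "holomorphic_cn f S" shows "(\<lambda>t. f (z + t *s w)) holomorphic_on {t. z + t *s w \<in> S}"
  unfolding holomorphic_on_def
proof
  fix s assume "s \<in> {t. z + t *s w \<in> S}"
  then have "z + s *s w \<in> S" by simp
  from holomorphic_cn_line_derivative[OF assms this]
  show "(\<lambda>t. f (z + t *s w)) field_differentiable at s within {t. z + t *s w \<in> S}"
    using field_differentiable_def has_field_derivative_at_within by blast
qed

text \<open>The definition of \<open>holomorphic_cn\<close> says nothing about how the derivative
  varies with the point. Its continuity is a by-product of Osgood's lemma, since the derivative in
  direction \<open>w\<close> is the one along a line.\<close>

lemma continuous_on_dir_derivative:
  assumes "open S" "holomorphic_cn f S" shows "continuous_on S (\<lambda>z. frechet_derivative f (at z) w)"
proof -
  have 1: "((\<lambda>t. f (z + t *s w)) has_field_derivative frechet_derivative f (at z) w) (at 0)" if "z \<in> S" for z w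
    using holomorphic_cn_line_derivative[OF assms(2), of z 0 w] that by simp
  then have "(\<lambda>t. f (z + t *s w)) field_differentiable at 0" if "z \<in> S" for z w
    using that field_differentiable_def by blast
  from osgood_continuous[OF assms(1) holomorphic_cn_continuous_on[OF assms(2)] this, of w]
  have "continuous_on S (\<lambda>z. deriv (\<lambda>t. f (z + t *s w)) 0)" by simp
  then show ?thesis by (rule continuous_on_eq) (use 1 DERIV_imp_deriv in blast)
qed

section \<open>Circle integrals, directional derivatives and the identity theorem\<close>

lemma continuous_on_circlepath [continuous_intros]:
  "continuous_on X g \<Longrightarrow> continuous_on X (\<lambda>x. circlepath z r (g x))"
  by (auto simp: circlepath intro!: continuous_intros)

lemma cmod_circlepath: "r \<ge> 0 \<Longrightarrow> cmod (circlepath 0 r x) = r"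
  by (simp add: circlepath norm_mult)

lemma continuous_on_circle_compose:
  assumes "continuous_on (sphere 0 r) \<psi>" "r \<ge> 0" "continuous_on X g"
  shows "continuous_on X (\<lambda>x. \<psi> (circlepath 0 r (g x)))"
  by (rule continuous_on_compose2[OF assms(1)])
    (use assms in \<open>auto simp: cmod_circlepath intro!: continuous_intros\<close>)

lemma continuous_on_circle_translate:
  fixes p :: "'b::topological_space \<Rightarrow> complex^'n::finite"
  assumes "continuous_on W k" "continuous_on X p" "continuous_on X g"
    and "\<And>x. x \<in> X \<Longrightarrow> p x + circlepath 0 r (g x) *s v \<in> W"
  shows "continuous_on X (\<lambda>x. k (p x + circlepath 0 r (g x) *s v))"
  by (rule continuous_on_compose2[OF assms(1)])
    (use assms in \<open>auto intro!: continuous_intros\<close>)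

text \<open>The contour integral is written as an integral over the unit interval, which is
  differentiated in one complex parameter at a time; \<open>osgood\<close> then supplies joint
  holomorphy. The weight \<open>\<psi>\<close> only has to be continuous on the circle, which admits
  kernels with a pole at the centre.\<close>

lemma holomorphic_cn_circle_integral:
  fixes k :: "complex^'n::finite \<Rightarrow> complex" and \<psi> :: "complex \<Rightarrow> complex"
  assumes k: "holomorphic_cn k W" "open W" and S: "open S" and r: "r > 0"
    and \<psi>: "continuous_on (sphere 0 r) \<psi>"
    and sub: "\<And>z t. z \<in> S \<Longrightarrow> cmod t = r \<Longrightarrow> z + t *s v \<in> W"
  shows "holomorphic_cn (\<lambda>z. contour_integral (circlepath 0 r) (\<lambda>t. \<psi> t * k (z + t *s v))) S"
proof -
  define c where "c = circlepath (0::complex) r"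
  define c' where "c' = (\<lambda>x::real. 2 * of_real pi * \<i> * r * exp (2 * of_real pi * \<i> * x))"
  have c: "cmod (c x) = r" for x using r by (simp add: c_def cmod_circlepath)
  have c': "continuous_on UNIV c'" by (auto simp: c'_def intro!: continuous_intros)
  have eq: "contour_integral (circlepath 0 r) (\<lambda>t. \<psi> t * k (z + t *s v)) =
     integral (cbox 0 1) (\<lambda>x. \<psi> (c x) * k (z + c x *s v) * c' x)" for z
    by (simp add: contour_integral_integral vector_derivative_circlepath c_def c'_def)
  have kc: "continuous_on W k" using k holomorphic_cn_continuous_on by blast
  let ?h = "\<lambda>z. integral (cbox 0 1) (\<lambda>x. \<psi> (c x) * k (z + c x *s v) * c' x)"
  have "holomorphic_cn ?h S"
  proof (rule osgood[OF S])
    have "continuous_on (S \<times> cbox 0 1) (\<lambda>x. \<psi> (c (snd x)) * k (fst x + c (snd x) *s v) * c' (snd x))"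
      unfolding c_def using r
      by (intro continuous_on_mult continuous_on_circle_compose[OF \<psi>] continuous_on_circle_translate[OF kc]
          continuous_on_compose2[OF c'] continuous_on_fst continuous_on_snd continuous_on_id)
         (auto intro!: sub simp: cmod_circlepath)
    then show "continuous_on S ?h"
      by (intro integral_continuous_on_param) (simp add: case_prod_beta)
    show "(\<lambda>t. ?h (z + t *s w)) field_differentiable at 0" if z: "z \<in> S" for z w
    proof -
      have "open {t. z + t *s w \<in> S}" by (rule open_line_preimage[OF S])
      moreover have "0 \<in> {t. z + t *s w \<in> S}" using z by simp
      ultimately obtain e where e: "e > 0" "ball 0 e \<subseteq> {t. z + t *s w \<in> S}" using openE by blast
      have inW: "z + t *s w + c x *s v \<in> W" if "t \<in> ball 0 e" for t x
        using sub[of "z + t *s w" "c x"] that e c by auto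
      let ?fx = "\<lambda>t x. \<psi> (c x) * frechet_derivative k (at (z + t *s w + c x *s v)) w * c' x"
      have "(\<lambda>t. ?h (z + t *s w)) field_differentiable at 0 within ball 0 e"
      proof (rule leibniz_rule_field_differentiable[where fx = ?fx])
        fix t :: complex and x :: real assume t: "t \<in> ball 0 e"
        have "(z + c x *s v) + t *s w \<in> W" using inW[OF t, of x] by (simp add: algebra_simps)
        from holomorphic_cn_line_derivative[OF k(1) this]
        have "((\<lambda>t. k (z + t *s w + c x *s v)) has_field_derivative
              frechet_derivative k (at (z + t *s w + c x *s v)) w) (at t within ball 0 e)"
          by (simp add: algebra_simps has_field_derivative_at_within)
        then show "((\<lambda>t. \<psi> (c x) * k (z + t *s w + c x *s v) * c' x) has_field_derivative ?fx t x) (at t within ball 0 e)"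
          by (intro DERIV_cmult DERIV_cmult_right)
      next
        fix t :: complex assume t: "t \<in> ball 0 e"
        have "continuous_on (cbox 0 1) (\<lambda>x. \<psi> (c x) * k (z + t *s w + c x *s v) * c' x)"
          unfolding c_def using r
          by (intro continuous_on_mult continuous_on_circle_compose[OF \<psi>] continuous_on_circle_translate[OF kc]
              continuous_on_compose2[OF c'] continuous_on_const continuous_on_id)
            (auto simp: inW[OF t, unfolded c_def])
        then show "(\<lambda>x. \<psi> (c x) * k (z + t *s w + c x *s v) * c' x) integrable_on cbox 0 1"
          by (rule integrable_continuous)
      next
        have "continuous_on (ball 0 e \<times> cbox 0 1) (\<lambda>y. \<psi> (c (snd y)) *
           frechet_derivative k (at (z + fst y *s w + c (snd y) *s v)) w * c' (snd y))"
          unfolding c_def using r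
          by (intro continuous_on_mult continuous_on_circle_compose[OF \<psi>] continuous_on_compose2[OF c']
             continuous_on_circle_translate[OF continuous_on_dir_derivative[OF k(2,1)]] 
             continuous_on_add continuous_on_line continuous_on_const continuous_on_fst continuous_on_snd continuous_on_id)
            (auto simp: inW[unfolded c_def])
        then show "continuous_on (ball 0 e \<times> cbox 0 1) (\<lambda>(t, x). ?fx t x)"
          by (simp add: case_prod_beta)
      qed (use e in auto)
      then show ?thesis using e by (simp add: at_within_open[of 0 "ball 0 e"])
    qed
  qed
  then show ?thesis by (simp only: eq)
qed

lemma translates_in_ball:
  fixes z0 v :: "complex^'n::finite"
  assumes "e > 0"
  obtains r where "r > 0" "\<And>z t. z \<in> ball z0 (e/2) \<Longrightarrow> cmod t \<le> r \<Longrightarrow> z + t *s v \<in> ball z0 e"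
proof
  \<comment> \<open>The summand 1 keeps the denominator of the radius positive when
    \<open>v = 0\<close>.\<close>
  define m where "m = norm v + 1"
  let ?r = "e / (2 * m)"
  have pos: "m > 0" by (simp add: add_nonneg_pos m_def)
  show r: "?r > 0" using assms pos by simp
  show "z + t *s v \<in> ball z0 e" if "z \<in> ball z0 (e/2)" "cmod t \<le> ?r" for z t
  proof -
    have "norm (t *s v) \<le> ?r * norm v" unfolding norm_vector_smult using that by (intro mult_right_mono) auto
    also have "\<dots> \<le> ?r * m" using r by (intro mult_left_mono) (auto simp: m_def)
    also have "\<dots> = e / 2" using pos by simp
    finally have "dist z (z + t *s v) \<le> e/2" by (simp add: dist_norm)
    then show ?thesis using dist_triangle[of z0 "z + t *s v" z] that by simp
  qed
qed

text \<open>Cauchy's formula on a small circle in direction \<open>v\<close> represents the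
  derivative as a circle integral of \<open>f\<close> with kernel \<open>inverse (t^2)\<close>. One
  radius serves for all base points near \<open>z0\<close>, so this integral depends holomorphically
  on the base point.\<close>

lemma holomorphic_cn_dir_derivative:
  assumes S: "open S" and f: "holomorphic_cn f S"
  shows "holomorphic_cn (\<lambda>z. frechet_derivative f (at z) v) S"
proof -
  have "\<exists>U. open U \<and> z0 \<in> U \<and> holomorphic_cn (\<lambda>z. frechet_derivative f (at z) v) U" if z0: "z0 \<in> S" for z0
  proof -
    obtain e where e: "e > 0" "ball z0 e \<subseteq> S" using openE S z0 by blast
    obtain r where r: "r > 0" "\<And>z t. z \<in> ball z0 (e/2) \<Longrightarrow> cmod t \<le> r \<Longrightarrow> z + t *s v \<in> ball z0 e"
      using translates_in_ball[OF e(1)] by blast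
    have inS: "z + t *s v \<in> S" if "z \<in> ball z0 (e/2)" "cmod t \<le> r" for z t
      using r(2)[OF that] e by blast
    have "frechet_derivative f (at z) v = 1 / (2 * of_real pi * \<i>) *
        contour_integral (circlepath 0 r) (\<lambda>t. inverse (t^2) * f (z + t *s v))" if z: "z \<in> ball z0 (e/2)" for z
    proof -
      have holo: "(\<lambda>t. f (z + t *s v)) holomorphic_on cball 0 r"
        using holomorphic_on_subset[OF holomorphic_cn_line[OF f]] inS[OF z] by (simp add: subset_iff)
      have "((\<lambda>t. f (z + t *s v)) has_field_derivative 1 / (2 * of_real pi * \<i>) *
        contour_integral (circlepath 0 r) (\<lambda>t. f (z + t *s v) / (t - 0)^2)) (at 0)"
        using holo r by (intro Cauchy_derivative_integral_circlepath(2))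
          (auto intro: holomorphic_on_imp_continuous_on holomorphic_on_subset)
      moreover have "((\<lambda>t. f (z + t *s v)) has_field_derivative frechet_derivative f (at z) v) (at 0)"
        using holomorphic_cn_line_derivative[OF f, of z 0 v] inS[OF z, of 0] r by simp
      moreover have "(\<lambda>t. f (z + t *s v) / (t - 0)^2) = (\<lambda>t. inverse (t^2) * f (z + t *s v))"
        by (simp add: divide_inverse mult.commute fun_eq_iff)
      ultimately show ?thesis by (simp only: DERIV_unique)
    qed
    moreover have "holomorphic_cn (\<lambda>z. 1 / (2 * of_real pi * \<i>) *
        contour_integral (circlepath 0 r) (\<lambda>t. inverse (t^2) * f (z + t *s v))) (ball z0 (e/2))"
      using r by (intro holomorphic_cn_mult holomorphic_cn_const holomorphic_cn_circle_integral[OF f S])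
        (auto intro!: continuous_intros inS)
    ultimately have "holomorphic_cn (\<lambda>z. frechet_derivative f (at z) v) (ball z0 (e/2))"
      by (subst holomorphic_cn_cong[OF open_ball]) simp_all
    then show ?thesis using e by (intro exI[of _ "ball z0 (e/2)"]) auto
  qed
  then show ?thesis by (rule holomorphic_cn_locally)
qed

text \<open>On the complex line through \<open>a\<close> and \<open>b\<close> the parameters that
  lead into \<open>S\<close> form a convex, hence connected, open set. Analytic continuation in one
  variable carries the zeros near the parameter 0 over to the parameter 1.\<close>

lemma holomorphic_cn_identity_convex:
  assumes f: "holomorphic_cn f S" and S: "open S" "convex S" and U: "open U" "U \<subseteq> S" "a \<in> U"
    and z: "\<And>z. z \<in> U \<Longrightarrow> f z = 0" and b: "b \<in> S"
  shows "f b = 0"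
proof -
  let ?g = "\<lambda>t::complex. a + t *s (b - a)"
  let ?T = "{t. ?g t \<in> S}" and ?V = "{t. ?g t \<in> U}"
  have "convex ?T" by (rule convex_line_preimage[OF S(2)])
  moreover have "open ?T" "open ?V" by (intro open_line_preimage S U)+
  moreover have "0 \<in> ?V" "0 \<in> ?T" "1 \<in> ?T" using U b by auto
  ultimately show ?thesis
    using analytic_continuation[OF holomorphic_cn_line[OF f, of a "b - a"], of ?V 0 1]
      interior_limit_point[of 0 ?V] z U by (force simp: convex_connected interior_open)
qed

section \<open>Zeros on a pencil of parallel lines\<close>

text \<open>Over the injective maps the summand is constant, and the others contribute nothing.\<close>

lemma vandermonde_sum:
  fixes R :: "complex set" and w g :: "complex \<Rightarrow> complex"
  assumes R: "finite R" "card R \<le> k"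
  defines "E \<equiv> \<Sum>\<phi>\<in>{..<k} \<rightarrow>\<^sub>E R. (\<Prod>a<k. w (\<phi> a)) *
     ((\<Prod>(a, b)\<in>{(a, b). a < k \<and> b < k \<and> a \<noteq> b}. \<phi> a - \<phi> b) * (\<Prod>a<k. g (\<phi> a)))"
  shows "card R < k \<Longrightarrow> E = 0"
    and "card R = k \<Longrightarrow> E = fact k * (\<Prod>x\<in>R. w x) *
       (\<Prod>(x, y)\<in>{(x, y). x \<in> R \<and> y \<in> R \<and> x \<noteq> y}. x - y) * (\<Prod>x\<in>R. g x)"
proof -
  define P where "P = {(a, b). a < k \<and> b < k \<and> a \<noteq> (b::nat)}"
  define T where "T = (\<lambda>\<phi>. (\<Prod>a<k. w (\<phi> a)) * ((\<Prod>(a, b)\<in>P. \<phi> a - \<phi> b) * (\<Prod>a<k. g (\<phi> a))))"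
  have finP: "finite P" by (rule finite_subset[of _ "{..<k} \<times> {..<k}"]) (auto simp: P_def)
  have fin: "finite ({..<k} \<rightarrow>\<^sub>E R)" using R by (intro finite_PiE) auto
  let ?I = "{\<phi> \<in> {..<k} \<rightarrow>\<^sub>E R. inj_on \<phi> {..<k}}"
  have "T \<phi> = 0" if "\<phi> \<in> ({..<k} \<rightarrow>\<^sub>E R) - ?I" for \<phi>
  proof -
    from that obtain a b where "a < k" "b < k" "a \<noteq> b" "\<phi> a = \<phi> b" by (auto simp: inj_on_def)
    then have "\<exists>p\<in>P. (case p of (a, b) \<Rightarrow> \<phi> a - \<phi> b) = 0" by (intro bexI[of _ "(a, b)"]) (auto simp: P_def)
    then have "(\<Prod>(a, b)\<in>P. \<phi> a - \<phi> b) = 0" using finP by (subst prod_zero_iff) auto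
    then show ?thesis by (simp add: T_def)
  qed
  then have E: "E = sum T ?I"
    unfolding E_def T_def[symmetric] P_def[symmetric] using fin by (intro sum.mono_neutral_right) auto
  show "E = 0" if "card R < k"
  proof -
    have "\<not> inj_on \<phi> {..<k}" if "\<phi> \<in> {..<k} \<rightarrow>\<^sub>E R" for \<phi>
      using card_inj[of \<phi> "{..<k}" R] that R \<open>card R < k\<close> by auto
    then have "?I = {}" by blast
    then show ?thesis unfolding E by (simp only: sum.empty)
  qed
  show "E = fact k * (\<Prod>x\<in>R. w x) * (\<Prod>(x, y)\<in>{(x, y). x \<in> R \<and> y \<in> R \<and> x \<noteq> y}. x - y) * (\<Prod>x\<in>R. g x)"
    if k: "card R = k"
  proof -
    have T: "T \<phi> = (\<Prod>x\<in>R. w x) * ((\<Prod>(x, y)\<in>{(x, y). x \<in> R \<and> y \<in> R \<and> x \<noteq> y}. x - y) * (\<Prod>x\<in>R. g x))"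
      if "\<phi> \<in> ?I" for \<phi>
    proof -
      have "\<phi> ` {..<k} \<subseteq> R" "card (\<phi> ` {..<k}) = card R" using that k by (auto simp: card_image)
      with R have "\<phi> ` {..<k} = R" by (intro card_subset_eq)
      then have bij: "bij_betw \<phi> {..<k} R" using that by (auto simp: bij_betw_def)
      have "bij_betw (map_prod \<phi> \<phi>) P {(x, y). x \<in> R \<and> y \<in> R \<and> x \<noteq> y}"
        unfolding bij_betw_def
      proof
        show "inj_on (map_prod \<phi> \<phi>) P" using bij by (auto simp: P_def inj_on_def bij_betw_def)
        have "(x, y) \<in> map_prod \<phi> \<phi> ` P" if "x \<in> R" "y \<in> R" "x \<noteq> y" for x y
        proof -
          from that bij have "x \<in> \<phi> ` {..<k}" "y \<in> \<phi> ` {..<k}" by (auto simp: bij_betw_def)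
          then obtain a b where "a < k" "\<phi> a = x" "b < k" "\<phi> b = y" by blast
          then show ?thesis using that by (intro image_eqI[of _ _ "(a, b)"]) (auto simp: P_def)
        qed
        moreover have "map_prod \<phi> \<phi> ` P \<subseteq> {(x, y). x \<in> R \<and> y \<in> R \<and> x \<noteq> y}"
          using bij by (auto simp: P_def bij_betw_def inj_on_def)
        ultimately show "map_prod \<phi> \<phi> ` P = {(x, y). x \<in> R \<and> y \<in> R \<and> x \<noteq> y}" by blast
      qed
      from prod.reindex_bij_betw[OF this, of "\<lambda>(x, y). x - y"] prod.reindex_bij_betw[OF bij, of w]
        prod.reindex_bij_betw[OF bij, of g]
      show ?thesis by (simp add: T_def case_prod_beta map_prod_def)
    qed
    have "card ?I = fact k" using card_inj_on_subset_funcset[of "{..<k}" R "{..<k}"] R k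
      by (simp add: fact_prod_rev atLeast0LessThan)
    then show ?thesis unfolding E by (simp add: T mult.assoc)
  qed
qed

text \<open>Translates between the multiplicities counted by the argument principle and derivatives,
  which are easy to compute for a product.\<close>

lemma line_zorder_one_iff:
  assumes "F holomorphic_on S" "open S" "connected S" "t \<in> S" "F t = 0" "\<exists>s\<in>S. F s \<noteq> 0"
  shows "zorder F t = 1 \<longleftrightarrow> deriv F t \<noteq> 0"
proof
  assume "deriv F t \<noteq> 0"
  then show "zorder F t = 1" using zorder_zero_eqI[of F S t 1] assms by auto
next
  assume 1: "zorder F t = 1"
  have "\<exists>r. r>0 \<and> cball t r \<subseteq> S \<and> zor_poly F t holomorphic_on cball t r
    \<and> (\<forall>w\<in>cball t r. F w  = zor_poly F t w * (w-t) ^ nat (zorder F t) \<and> zor_poly F t w \<noteq> 0)"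
    using zorder_exist_zero[OF assms(1-4,6)] by blast
  then obtain r where r: "r > 0" "zor_poly F t holomorphic_on cball t r"
    "\<And>w. w \<in> cball t r \<Longrightarrow> F w = zor_poly F t w * (w-t)" "\<And>w. w \<in> cball t r \<Longrightarrow> zor_poly F t w \<noteq> 0"
    using 1 by auto
  have "(zor_poly F t has_field_derivative deriv (zor_poly F t) t) (at t)"
    using r holomorphic_derivI[of "zor_poly F t" "ball t r"] by (meson ball_subset_cball centre_in_ball holomorphic_on_subset open_ball)
  then have "((\<lambda>w. zor_poly F t w * (w - t)) has_field_derivative zor_poly F t t) (at t)"
    by (auto intro!: derivative_eq_intros)
  then have "(F has_field_derivative zor_poly F t t) (at t)"
    by (rule has_field_derivative_transform_within_open[of _ _ _ "ball t r"]) (use r in auto)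
  then show "deriv F t \<noteq> 0" using r by (simp add: DERIV_imp_deriv)
qed

lemma translates_compact_in_open:
  fixes p v :: "complex^'n::finite"
  assumes "open U" "compact K" "\<And>t. t \<in> K \<Longrightarrow> p + t *s v \<in> U"
  shows "\<exists>\<delta>>0. \<forall>z\<in>ball p \<delta>. \<forall>t\<in>K. z + t *s v \<in> U"
proof -
  have "compact ((\<lambda>t. p + t *s v) ` K)" by (intro compact_continuous_image continuous_intros assms)
  moreover have "(\<lambda>t. p + t *s v) ` K \<subseteq> U" using assms(3) by blast
  ultimately obtain e where e: "e > 0" "(\<Union>y\<in>(\<lambda>t. p + t *s v) ` K. ball y e) \<subseteq> U"
    using compact_subset_open_imp_ball_epsilon_subset assms(1) by blast
  have "z + t *s v \<in> U" if "z \<in> ball p e" "t \<in> K" for z t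
  proof -
    have "z + t *s v \<in> ball (p + t *s v) e" using that by (simp add: dist_norm)
    then show ?thesis using e that by blast
  qed
  then show ?thesis using e by blast
qed

text \<open>Let \<open>\<mu>\<close> be the minimum of \<open>cmod w\<close> on the circle through
  which the line at \<open>x\<close> is seen. Near \<open>x\<close> the values on the circle stay
  above \<open>\<mu>/2\<close> and those at the centre below it. If \<open>w\<close> had no zero in
  the disc at \<open>z\<close>, the maximum principle for \<open>1/w\<close> would bound its value
  at the centre by \<open>2/\<mu>\<close>, a contradiction.\<close>

lemma zeros_persist:
  fixes x v :: "complex^'n::finite"
  assumes U: "open U" and w: "holomorphic_cn w U" and \<eta>: "\<eta> > 0"
    and disc: "\<And>t. cmod t \<le> \<eta> \<Longrightarrow> x + t *s v \<in> U"
    and circ: "\<And>t. cmod t = \<eta> \<Longrightarrow> w (x + t *s v) \<noteq> 0" and wx: "w x = 0"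
  shows "\<exists>\<delta>>0. \<forall>z\<in>ball x \<delta>. \<exists>t. cmod t \<le> \<eta> \<and> z + t *s v \<in> U \<and> w (z + t *s v) = 0"
proof -
  have wc: "continuous_on U w" using w holomorphic_cn_continuous_on by blast
  let ?l = "\<lambda>t. x + t *s v"
  have cl: "continuous_on X ?l" for X by (intro continuous_intros)
  have K: "compact (?l ` sphere 0 \<eta>)" by (intro compact_continuous_image cl compact_sphere)
  have sub: "?l ` cball 0 \<eta> \<subseteq> U" "?l ` sphere 0 \<eta> \<subseteq> U" using disc by auto
  have "continuous_on (?l ` sphere 0 \<eta>) (\<lambda>y. cmod (w y))" using wc sub by (auto intro!: continuous_intros intro: continuous_on_subset)
  moreover have "?l ` sphere 0 \<eta> \<noteq> {}" using \<eta> by simp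
  ultimately obtain y0 where y0: "y0 \<in> ?l ` sphere 0 \<eta>" "\<And>y. y \<in> ?l ` sphere 0 \<eta> \<Longrightarrow> cmod (w y0) \<le> cmod (w y)"
    using continuous_attains_inf[OF K] by blast
  define \<mu> where "\<mu> = cmod (w y0)"
  have \<mu>: "\<mu> > 0" using y0(1) circ by (auto simp: \<mu>_def)
  have nc: "continuous_on U (\<lambda>y. cmod (w y))" using wc by (rule continuous_on_norm)
  have "open (U \<inter> (\<lambda>y. cmod (w y)) -` {\<mu>/2<..})" "open (U \<inter> (\<lambda>y. cmod (w y)) -` {..<\<mu>/2})"
    by (rule continuous_open_preimage[OF nc U]; simp)+
  then have big: "open {y\<in>U. \<mu>/2 < cmod (w y)}" and small: "open {y\<in>U. cmod (w y) < \<mu>/2}"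
    by (simp_all add: vimage_def Int_def)
  have "?l ` sphere 0 \<eta> \<subseteq> {y\<in>U. \<mu>/2 < cmod (w y)}"
  proof
    fix y assume y: "y \<in> ?l ` sphere 0 \<eta>"
    then have "\<mu> \<le> cmod (w y)" unfolding \<mu>_def by (rule y0(2))
    then show "y \<in> {y\<in>U. \<mu>/2 < cmod (w y)}" using y sub(2) \<mu> by auto
  qed
  then obtain e1 where e1: "e1 > 0" "\<And>z t. z \<in> ball x e1 \<Longrightarrow> t \<in> sphere 0 \<eta> \<Longrightarrow> \<mu>/2 < cmod (w (z + t *s v))"
    using translates_compact_in_open[OF big compact_sphere, of 0 \<eta> x v] by blast
  obtain e2 where e2: "e2 > 0" "\<And>z t. z \<in> ball x e2 \<Longrightarrow> t \<in> cball 0 \<eta> \<Longrightarrow> z + t *s v \<in> U"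
    using translates_compact_in_open[OF U compact_cball, of 0 \<eta> x v] sub(1) by blast
  have "x \<in> {y\<in>U. cmod (w y) < \<mu>/2}" using wx \<mu> disc[of 0] \<eta> by simp
  then obtain e3 where e3: "e3 > 0" "ball x e3 \<subseteq> {y\<in>U. cmod (w y) < \<mu>/2}" using small openE by blast
  define \<delta> where "\<delta> = min e1 (min e2 e3)"
  have "\<exists>t. cmod t \<le> \<eta> \<and> z + t *s v \<in> U \<and> w (z + t *s v) = 0" if z: "z \<in> ball x \<delta>" for z
  proof (rule ccontr)
    assume contra: "\<not> ?thesis"
    have inU: "z + t *s v \<in> U" if "cmod t \<le> \<eta>" for t
      by (rule e2(2)) (use z that in \<open>simp_all add: \<delta>_def\<close>)
    have nz: "w (z + t *s v) \<noteq> 0" if "cmod t \<le> \<eta>" for t using contra inU that by blast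
    have holo: "(\<lambda>t. inverse (w (z + t *s v))) holomorphic_on cball 0 \<eta>"
      using inU nz by (intro holomorphic_on_inverse holomorphic_on_subset[OF holomorphic_cn_line[OF w]]) auto
    have "cmod (inverse (w (z + 0 *s v))) \<le> 2/\<mu>"
    proof (rule maximum_modulus_frontier[where S = "cball 0 \<eta>" and f = "\<lambda>t. inverse (w (z + t *s v))" and \<xi> = 0])
      show "(\<lambda>t. inverse (w (z + t *s v))) holomorphic_on interior (cball 0 \<eta>)"
        using holo interior_subset holomorphic_on_subset by blast
      show "continuous_on (closure (cball 0 \<eta>)) (\<lambda>t. inverse (w (z + t *s v)))"
        using holo holomorphic_on_imp_continuous_on by auto
      show "cmod (inverse (w (z + t *s v))) \<le> 2/\<mu>" if "t \<in> frontier (cball 0 \<eta>)" for t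
      proof -
        have "t \<in> sphere 0 \<eta>" using that \<eta> by simp
        then have "\<mu>/2 < cmod (w (z + t *s v))" by (intro e1(2)) (use z in \<open>simp_all add: \<delta>_def\<close>)
        then have "inverse (cmod (w (z + t *s v))) \<le> inverse (\<mu>/2)" using \<mu> by (intro le_imp_inverse_le) auto
        then show ?thesis by (simp add: norm_inverse)
      qed
    qed (use \<eta> in auto)
    moreover have "cmod (w z) < \<mu>/2" using z e3 by (auto simp: \<delta>_def)
    moreover have "w z \<noteq> 0" using nz[of 0] \<eta> by simp
    ultimately have "inverse (\<mu>/2) < inverse (cmod (w z))" "inverse (cmod (w z)) \<le> 2/\<mu>"
      by (simp_all only: norm_inverse vector_smult_lzero add_0_right less_imp_inverse_less zero_less_norm_iff not_False_eq_True)
    then show False by simp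
  qed
  moreover have "\<delta> > 0" using e1 e2 e3 by (simp add: \<delta>_def)
  ultimately show ?thesis by blast
qed

text \<open>The zero-free annulus between the radii \<open>1/2\<close> and 2 keeps the roots away
  from the unit circle for all lines at once, so none enters or leaves the unit disc as
  \<open>z\<close> moves in \<open>B\<close>, and there are no others in the disc of radius 2. The
  radius 3 leaves room for a holomorphic restriction to a neighbourhood of these discs.\<close>

locale line_roots =
  fixes f :: "complex^'n::finite \<Rightarrow> complex" and S B :: "(complex^'n) set" and v :: "complex^'n"
  assumes S: "open S" and f: "holomorphic_cn f S"
    and B: "open B" "connected B"
    and inS: "\<And>z t. z \<in> B \<Longrightarrow> cmod t \<le> 3 \<Longrightarrow> z + t *s v \<in> S"
    and nz: "\<And>z t. z \<in> B \<Longrightarrow> 1/2 \<le> cmod t \<Longrightarrow> cmod t \<le> 2 \<Longrightarrow> f (z + t *s v) \<noteq> 0"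
begin

definition roots :: "complex^'n \<Rightarrow> complex set" where
  "roots z = {t. cmod t < 1 \<and> f (z + t *s v) = 0}"

definition mult :: "complex^'n \<Rightarrow> complex \<Rightarrow> int" where
  "mult z = zorder (\<lambda>t. f (z + t *s v))"

lemma line_holomorphic: "z \<in> B \<Longrightarrow> (\<lambda>t. f (z + t *s v)) holomorphic_on ball 0 3"
  by (rule holomorphic_on_subset[OF holomorphic_cn_line[OF f]]) (auto intro!: inS)

lemma roots_eq: "z \<in> B \<Longrightarrow> {t \<in> ball 0 2. f (z + t *s v) = 0} = roots z"
  using nz by (force simp: roots_def)

lemma nonzero_at_1: "z \<in> B \<Longrightarrow> f (z + 1 *s v) \<noteq> 0"
  using nz[of z 1] by simp

lemma finite_roots: assumes "z \<in> B" shows "finite (roots z)"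
proof (cases "roots z = {}")
  case False
  then obtain t where "t \<in> roots z" by blast
  then have "f (z + t *s v) = 0" "t \<in> ball 0 3" by (auto simp: roots_def)
  then have "\<not> (\<lambda>t. f (z + t *s v)) constant_on ball 0 3"
    using nonzero_at_1[OF assms] unfolding constant_on_def by (metis dist_0_norm mem_ball norm_one one_less_numeral_iff semiring_norm(77))
  from holomorphic_compact_finite_zeros[OF line_holomorphic[OF assms] _ _ _ _ this, of "cball 0 1"]
  have "finite {t \<in> cball 0 1. f (z + t *s v) = 0}" by (auto simp: subset_iff)
  then show ?thesis by (rule finite_subset[rotated]) (auto simp: roots_def)
qed simp

lemma mult_pos: assumes "z \<in> B" "t \<in> roots z" shows "mult z t \<ge> 1"
proof -
  have t: "t \<in> ball 0 3" "f (z + t *s v) = 0" using assms by (auto simp: roots_def)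
  have "\<exists>w\<in>ball 0 3. f (z + w *s v) \<noteq> 0" using nonzero_at_1[OF assms(1)] by (intro bexI[of _ 1]) auto
  with zorder_exist_zero[OF line_holomorphic[OF assms(1)] _ _ t(1)] t(2)
  show ?thesis by (auto simp: mult_def)
qed

text \<open>Newton's power sums of the roots, counted with multiplicity: symmetric expressions that
  remain holomorphic where roots collide.\<close>

definition power_sum :: "complex^'n \<Rightarrow> nat \<Rightarrow> complex" where
  "power_sum z e = (\<Sum>t\<in>roots z. of_int (mult z t) * t ^ e)"

text \<open>The argument principle with weight \<open>t ^ e\<close>; the winding number of the unit
  circle is 1 around each root. The derivative along the line is rewritten as a directional
  derivative of \<open>f\<close>, so that the integrand is a function of
  \<open>z + t *s v\<close>.\<close>

lemma power_sum_integral: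
  assumes z: "z \<in> B"
  shows "power_sum z e = 1 / (2 * of_real pi * \<i>) * contour_integral (circlepath 0 1)
    (\<lambda>t. t ^ e * (frechet_derivative f (at (z + t *s v)) v / f (z + t *s v)))"
proof -
  let ?F = "\<lambda>t. f (z + t *s v)"
  have pz: "{t \<in> ball 0 2. ?F t = 0 \<or> t \<in> {}} = roots z" using roots_eq[OF z] by simp
  have "contour_integral (circlepath 0 1) (\<lambda>t. deriv ?F t * t ^ e / ?F t) =
     2 * pi * \<i> * (\<Sum>t\<in>{t \<in> ball 0 2. ?F t = 0 \<or> t \<in> {}}. winding_number (circlepath 0 1) t * t ^ e * zorder ?F t)"
  proof (rule argument_principle)
    show "?F holomorphic_on ball 0 2 - {}" using holomorphic_on_subset[OF line_holomorphic[OF z], of "ball 0 2"] by (simp add: subset_ball)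
    show "path_image (circlepath 0 1) \<subseteq> ball 0 2 - {t \<in> ball 0 2. ?F t = 0 \<or> t \<in> {}}"
      unfolding pz by (auto simp: roots_def)
    show "\<forall>t. t \<notin> ball 0 2 \<longrightarrow> winding_number (circlepath 0 1) t = 0"
      by (auto intro!: winding_number_zero_outside[of _ "cball 0 1"])
    show "finite {t \<in> ball 0 2. ?F t = 0 \<or> t \<in> {}}" unfolding pz using finite_roots[OF z] .
  qed (auto intro!: holomorphic_intros)
  moreover have "winding_number (circlepath 0 1) t * t ^ e * zorder ?F t = of_int (mult z t) * t ^ e" if "t \<in> roots z" for t
    using that by (subst winding_number_circlepath) (auto simp: roots_def mult_def)
  ultimately have "contour_integral (circlepath 0 1) (\<lambda>t. deriv ?F t * t ^ e / ?F t) = 2 * pi * \<i> * power_sum z e"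
    unfolding pz power_sum_def by simp
  moreover have "contour_integral (circlepath 0 1) (\<lambda>t. deriv ?F t * t ^ e / ?F t) =
     contour_integral (circlepath 0 1) (\<lambda>t. t ^ e * (frechet_derivative f (at (z + t *s v)) v / f (z + t *s v)))"
  proof (rule contour_integral_cong[OF refl])
    fix t assume "t \<in> path_image (circlepath (0::complex) 1)"
    then have "z + t *s v \<in> S" using inS[OF z, of t] by simp
    from DERIV_imp_deriv[OF holomorphic_cn_line_derivative[OF f this]]
    show "deriv ?F t * t ^ e / ?F t = t ^ e * (frechet_derivative f (at (z + t *s v)) v / f (z + t *s v))" by simp
  qed
  ultimately show ?thesis by simp
qed

lemma power_sum_holomorphic: "holomorphic_cn (\<lambda>z. power_sum z e) B"
proof -
  let ?W = "{y \<in> S. f y \<noteq> 0}"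
  have "open (S \<inter> f -` (- {0}))"
    by (intro continuous_open_preimage holomorphic_cn_continuous_on[OF f] S) auto
  then have W: "open ?W" by (simp add: vimage_def Int_def)
  have "holomorphic_cn (\<lambda>y. frechet_derivative f (at y) v / f y) ?W"
    by (intro holomorphic_cn_divide holomorphic_cn_subset[OF holomorphic_cn_dir_derivative[OF S f]] holomorphic_cn_subset[OF f]) auto
  then have "holomorphic_cn (\<lambda>z. contour_integral (circlepath 0 1)
    (\<lambda>t. t ^ e * (frechet_derivative f (at (z + t *s v)) v / f (z + t *s v)))) B"
    by (rule holomorphic_cn_circle_integral[OF _ W B(1)]) (auto intro!: continuous_intros inS simp: nz)
  then show ?thesis
    by (subst holomorphic_cn_cong[OF B(1) power_sum_integral]) (assumption, rule holomorphic_cn_mult[OF holomorphic_cn_const])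
qed

text \<open>Summation runs over all maps from \<open>k\<close> indices to the roots, so that a
  monomial in the \<open>\<phi> a\<close> gives a product of power sums. The free exponents
  \<open>e\<close> make the property stable under multiplication of \<open>H\<close> by any
  \<open>\<phi> a\<close>; hence it holds for all polynomials that are built up below.\<close>

definition hol_sym :: "nat \<Rightarrow> ((nat \<Rightarrow> complex) \<Rightarrow> complex) \<Rightarrow> bool" where
  "hol_sym k H \<longleftrightarrow> (\<forall>e. holomorphic_cn
     (\<lambda>z. \<Sum>\<phi>\<in>{..<k} \<rightarrow>\<^sub>E roots z. (\<Prod>a<k. of_int (mult z (\<phi> a)) * \<phi> a ^ e a) * H \<phi>) B)"

text \<open>A sum over all maps of a product over the indices factors into the product of the
  \<open>power_sum z (e a)\<close>.\<close>

lemma hol_sym_1: "hol_sym k (\<lambda>\<phi>. 1)"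
  unfolding hol_sym_def
proof
  fix e :: "nat \<Rightarrow> nat"
  have "(\<Sum>\<phi>\<in>{..<k} \<rightarrow>\<^sub>E roots z. (\<Prod>a<k. of_int (mult z (\<phi> a)) * \<phi> a ^ e a) * 1) = (\<Prod>a<k. power_sum z (e a))"
    if "z \<in> B" for z
    unfolding power_sum_def by (subst prod_sum_PiE) (auto simp: finite_roots[OF that])
  then show "holomorphic_cn (\<lambda>z. \<Sum>\<phi>\<in>{..<k} \<rightarrow>\<^sub>E roots z. (\<Prod>a<k. of_int (mult z (\<phi> a)) * \<phi> a ^ e a) * 1) B"
    by (subst holomorphic_cn_cong[OF B(1)]) (auto intro: holomorphic_cn_prod power_sum_holomorphic)
qed

lemma hol_sym_var: assumes "hol_sym k H" "a < k" shows "hol_sym k (\<lambda>\<phi>. \<phi> a * H \<phi>)"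
  unfolding hol_sym_def
proof
  fix e :: "nat \<Rightarrow> nat"
  have "(\<Prod>b<k. of_int (mult z (\<phi> b)) * \<phi> b ^ (e(a := Suc (e a))) b) =
      (\<Prod>b<k. of_int (mult z (\<phi> b)) * \<phi> b ^ e b) * \<phi> a" for z \<phi>
    using assms(2) by (simp add: prod.remove[of "{..<k}" a])
  then show "holomorphic_cn (\<lambda>z. \<Sum>\<phi>\<in>{..<k} \<rightarrow>\<^sub>E roots z.
      (\<Prod>b<k. of_int (mult z (\<phi> b)) * \<phi> b ^ e b) * (\<phi> a * H \<phi>)) B"
    using assms(1)[unfolded hol_sym_def, rule_format, of "e(a := Suc (e a))"] by (simp add: mult.assoc)
qed

lemma hol_sym_add: assumes "hol_sym k H" "hol_sym k G" shows "hol_sym k (\<lambda>\<phi>. H \<phi> + G \<phi>)"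
  unfolding hol_sym_def distrib_left sum.distrib
  using assms by (auto simp: hol_sym_def intro!: holomorphic_cn_add)

lemma hol_sym_uminus: assumes "hol_sym k H" shows "hol_sym k (\<lambda>\<phi>. - H \<phi>)"
  unfolding hol_sym_def mult_minus_right sum_negf
proof
  fix e :: "nat \<Rightarrow> nat"
  from holomorphic_cn_mult[OF holomorphic_cn_const[of "-1"] assms[unfolded hol_sym_def, rule_format, of e]]
  show "holomorphic_cn (\<lambda>z. - (\<Sum>\<phi>\<in>{..<k} \<rightarrow>\<^sub>E roots z.
    (\<Prod>a<k. of_int (mult z (\<phi> a)) * \<phi> a ^ e a) * H \<phi>)) B" by simp
qed

lemma hol_sym_prod:
  assumes "finite I" "hol_sym k H" "\<And>i H. i \<in> I \<Longrightarrow> hol_sym k H \<Longrightarrow> hol_sym k (\<lambda>\<phi>. l i \<phi> * H \<phi>)"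
  shows "hol_sym k (\<lambda>\<phi>. (\<Prod>i\<in>I. l i \<phi>) * H \<phi>)"
  using assms by (induction I rule: finite_induct) (auto simp: mult.assoc)

text \<open>When there are exactly \<open>k\<close> distinct roots, this is a nonzero multiple of
  their discriminant times the product of the values of \<open>g\<close>. For
  \<open>g = uminus\<close> the additional factor detects whether 0 is a root, that is, whether the
  base point \<open>z\<close> itself is a zero of \<open>f\<close>; for \<open>g = 1\<close> the sum
  detects whether the number of distinct roots drops.\<close>

definition disc_sum :: "nat \<Rightarrow> (complex \<Rightarrow> complex) \<Rightarrow> complex^'n \<Rightarrow> complex" where
  "disc_sum k g z = (\<Sum>\<phi>\<in>{..<k} \<rightarrow>\<^sub>E roots z. (\<Prod>a<k. of_int (mult z (\<phi> a))) *
     ((\<Prod>(a, b)\<in>{(a, b). a < k \<and> b < k \<and> a \<noteq> b}. \<phi> a - \<phi> b) * (\<Prod>a<k. g (\<phi> a))))"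

lemma disc_sum_holomorphic:
  assumes "g = uminus \<or> g = (\<lambda>t. 1)"
  shows "holomorphic_cn (disc_sum k g) B"
proof -
  have fin: "finite {(a, b). a < k \<and> b < k \<and> a \<noteq> b}" by (rule finite_subset[of _ "{..<k} \<times> {..<k}"]) auto
  have g: "hol_sym k (\<lambda>\<phi>. \<Prod>a<k. g (\<phi> a))"
  proof -
    have "hol_sym k (\<lambda>\<phi>. (\<Prod>a\<in>{..<k}. g (\<phi> a)) * 1)"
      by (rule hol_sym_prod[OF _ hol_sym_1]) (use assms hol_sym_var hol_sym_uminus in auto)
    then show ?thesis by simp
  qed
  have "hol_sym k (\<lambda>\<phi>. (\<Prod>i\<in>{(a, b). a < k \<and> b < k \<and> a \<noteq> b}. \<phi> (fst i) - \<phi> (snd i)) * (\<Prod>a<k. g (\<phi> a)))"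
  proof (rule hol_sym_prod[OF fin g])
    fix i H assume i: "i \<in> {(a, b). a < k \<and> b < k \<and> a \<noteq> b}" and H: "hol_sym k H"
    have "hol_sym k (\<lambda>\<phi>. \<phi> (fst i) * H \<phi> + - (\<phi> (snd i) * H \<phi>))"
      using i by (intro hol_sym_add hol_sym_uminus hol_sym_var[OF H]) auto
    then show "hol_sym k (\<lambda>\<phi>. (\<phi> (fst i) - \<phi> (snd i)) * H \<phi>)" by (simp add: left_diff_distrib)
  qed
  from this[unfolded hol_sym_def, rule_format, of "\<lambda>_. 0"] show ?thesis
    unfolding disc_sum_def[abs_def] by (simp add: case_prod_beta)
qed

lemma disc_sum_eq_0: "z \<in> B \<Longrightarrow> card (roots z) < k \<Longrightarrow> disc_sum k g z = 0"
  unfolding disc_sum_def by (rule vandermonde_sum(1)) (auto simp: finite_roots)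

lemma disc_sum_eq:
  "z \<in> B \<Longrightarrow> card (roots z) = k \<Longrightarrow> disc_sum k g z = fact k * (\<Prod>x\<in>roots z. of_int (mult z x)) *
       (\<Prod>(x, y)\<in>{(x, y). x \<in> roots z \<and> y \<in> roots z \<and> x \<noteq> y}. x - y) * (\<Prod>x\<in>roots z. g x)"
  unfolding disc_sum_def by (rule vandermonde_sum(2)) (auto simp: finite_roots)

lemma disc_factor_nonzero:
  assumes "z \<in> B"
  shows "fact k * (\<Prod>x\<in>roots z. of_int (mult z x)) *
       (\<Prod>(x, y)\<in>{(x, y). x \<in> roots z \<and> y \<in> roots z \<and> x \<noteq> y}. x - y) \<noteq> (0::complex)"
proof -
  have "finite {(x, y). x \<in> roots z \<and> y \<in> roots z \<and> x \<noteq> y}"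
    by (rule finite_subset[of _ "roots z \<times> roots z"]) (auto simp: finite_roots[OF assms])
  moreover have "mult z x \<noteq> 0" if "x \<in> roots z" for x using mult_pos[OF assms that] by simp
  ultimately show ?thesis using finite_roots[OF assms] by (auto simp: prod_zero_iff)
qed

text \<open>The power sum with exponent 0 counts the roots with multiplicity. It is continuous and
  takes integer values, so it is constant on the connected set \<open>B\<close>.\<close>

lemma total_mult_constant: "\<exists>d. \<forall>z\<in>B. (\<Sum>t\<in>roots z. mult z t) = d"
proof -
  have eq: "power_sum z 0 = of_int (\<Sum>t\<in>roots z. mult z t)" for z by (simp add: power_sum_def)
  have "(\<lambda>z. power_sum z 0) constant_on B"
  proof (rule continuous_discrete_range_constant[OF B(2) holomorphic_cn_continuous_on[OF power_sum_holomorphic]])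
    fix x assume "x \<in> B"
    have "1 \<le> cmod (power_sum y 0 - power_sum x 0)" if "power_sum y 0 \<noteq> power_sum x 0" for y
    proof -
      let ?a = "(\<Sum>t\<in>roots y. mult y t) - (\<Sum>t\<in>roots x. mult x t)"
      have "power_sum y 0 - power_sum x 0 = of_int ?a" by (simp only: eq of_int_diff)
      moreover have "?a \<noteq> 0"
      proof
        assume "?a = 0"
        then have "(\<Sum>t\<in>roots y. mult y t) = (\<Sum>t\<in>roots x. mult x t)" by linarith
        then show False using that unfolding eq by (simp only:)
      qed
      then have "1 \<le> \<bar>?a\<bar>" by linarith
      then have "1 \<le> cmod (of_int ?a)" by (metis norm_of_int of_int_1_le_iff of_int_abs)
      ultimately show ?thesis by simp
    qed
    then show "\<exists>e>0. \<forall>y. y \<in> B \<and> power_sum y 0 \<noteq> power_sum x 0 \<longrightarrow> e \<le> norm (power_sum y 0 - power_sum x 0)"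
      by (intro exI[of _ 1]) auto
  qed
  then obtain c where c: "\<And>z. z \<in> B \<Longrightarrow> power_sum z 0 = c" unfolding constant_on_def by blast
  show ?thesis
  proof (cases "B = {}")
    case False
    then obtain b where b: "b \<in> B" by blast
    have "(\<Sum>t\<in>roots z. mult z t) = (\<Sum>t\<in>roots b. mult b t)" if "z \<in> B" for z
      using c[OF that] c[OF b] unfolding eq by (metis of_int_eq_iff)
    then show ?thesis by blast
  qed simp
qed

lemma card_le_total_mult: assumes "z \<in> B" shows "int (card (roots z)) \<le> (\<Sum>t\<in>roots z. mult z t)"
  using sum_mono[of "roots z" "\<lambda>_. 1" "mult z"] mult_pos[OF assms] by simp

lemma mult_one_iff: assumes "z \<in> B" "t \<in> roots z"
  shows "mult z t = 1 \<longleftrightarrow> deriv (\<lambda>t. f (z + t *s v)) t \<noteq> 0"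
  unfolding mult_def
proof (rule line_zorder_one_iff[OF line_holomorphic[OF assms(1)]])
  show "\<exists>s\<in>ball 0 3. f (z + s *s v) \<noteq> 0" using nonzero_at_1[OF assms(1)] by (intro bexI[of _ 1]) auto
qed (use assms in \<open>auto simp: roots_def\<close>)

end

text \<open>A point near \<open>p\<close> where \<open>f\<close> does not vanish determines a line
  through \<open>p\<close> on which \<open>f\<close> is not identically 0. Its zeros are isolated,
  so after rescaling the direction only the parameter 0 can be a zero with
  \<open>cmod t \<le> 2\<close>; compactness of the disc and of the annulus extends the conditions
  to nearby parallel lines.\<close>

lemma line_roots_exist:
  fixes f :: "complex^'n::finite \<Rightarrow> complex"
  assumes S: "open S" and f: "holomorphic_cn f S" and p: "p \<in> S"
    and nz: "\<And>W. open W \<Longrightarrow> p \<in> W \<Longrightarrow> \<exists>z\<in>W. f z \<noteq> 0"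
  obtains v \<delta> where "\<delta> > 0" "line_roots f S (ball p \<delta>) v"
    "\<And>t. 0 < cmod t \<Longrightarrow> cmod t \<le> 2 \<Longrightarrow> p + t *s v \<in> S \<and> f (p + t *s v) \<noteq> 0"
proof -
  obtain e where e: "e > 0" "ball p e \<subseteq> S" using S p openE by blast
  obtain z0 where z0: "z0 \<in> ball p e" "f z0 \<noteq> 0" using nz[of "ball p e"] e by auto
  define u where "u = z0 - p"
  have nu: "norm u < e" using z0 by (simp add: u_def dist_norm norm_minus_commute)
  \<comment> \<open>If \<open>z0 = p\<close> the direction is 0 and every parameter is allowed. Any
    value above 1 will do, since the disc of radius \<open>\<rho>\<close> only has to contain the
    parameter 1 of \<open>z0\<close>.\<close>
  define \<rho> where "\<rho> = (if u = 0 then 2 else e / norm u)"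
  have \<rho>: "\<rho> > 1" using nu by (auto simp: \<rho>_def)
  have inb: "p + t *s u \<in> ball p e" if "cmod t < \<rho>" for t
    using that e by (cases "u = 0") (auto simp: \<rho>_def dist_norm norm_vector_smult field_simps)
  have holo: "(\<lambda>t. f (p + t *s u)) holomorphic_on ball 0 \<rho>"
    by (rule holomorphic_on_subset[OF holomorphic_cn_line[OF f]]) (use inb e in auto)
  have "\<forall>\<^sub>F w in at 0. f (p + w *s u) \<noteq> 0 \<and> w \<in> ball 0 \<rho>"
    by (rule non_zero_neighbour_alt[OF holo, of _ 1]) (use \<rho> z0 in \<open>auto simp: u_def\<close>)
  then obtain r where r: "r > 0" "\<And>w. w \<noteq> 0 \<Longrightarrow> cmod w < r \<Longrightarrow> f (p + w *s u) \<noteq> 0 \<and> cmod w < \<rho>"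
    by (auto simp: eventually_at)
  \<comment> \<open>With the factor \<open>r / 4\<close>, parameters up to 3 correspond to at most
    \<open>3 * r / 4 < r\<close> on the original line.\<close>
  define v where "v = of_real (r / 4) *s u"
  have v: "p + t *s v = p + (t * of_real (r/4)) *s u" for t by (simp add: v_def)
  have small: "cmod (t * of_real (r/4)) < r" if "cmod t \<le> 3" for t
  proof -
    have "cmod t * (r / 4) \<le> 3 * (r / 4)" using that r by (intro mult_right_mono) auto
    then show ?thesis using r by (simp add: norm_mult)
  qed
  have inS: "p + t *s v \<in> S" if "cmod t \<le> 3" for t
  proof (cases "t = 0")
    case False
    then have "t * of_real (r/4) \<noteq> 0" using r by simp
    then show ?thesis unfolding v using r(2)[OF _ small[OF that]] inb e by blast
  qed (use p in simp)
  have nz': "f (p + t *s v) \<noteq> 0" if "0 < cmod t" "cmod t \<le> 2" for t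
  proof -
    have "t * of_real (r/4) \<noteq> 0" using r that by auto
    then show ?thesis unfolding v using r(2)[OF _ small] that by auto
  qed
  obtain \<delta>1 where \<delta>1: "\<delta>1 > 0" "\<forall>z\<in>ball p \<delta>1. \<forall>t\<in>cball 0 3. z + t *s v \<in> S"
    using translates_compact_in_open[OF S, of "cball 0 3" p v] inS by auto
  have "open (S \<inter> f -` (- {0}))"
    by (intro continuous_open_preimage holomorphic_cn_continuous_on[OF f] S) auto
  moreover have "compact (cball 0 2 - ball (0::complex) (1/2))" by (intro compact_diff) auto
  moreover have "p + t *s v \<in> S \<inter> f -` (- {0})" if "t \<in> cball 0 2 - ball 0 (1/2)" for t
  proof -
    have "1/2 \<le> cmod t" "cmod t \<le> 2" using that by auto
    then have "0 < cmod t" "cmod t \<le> 2" "cmod t \<le> 3" by linarith+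
    then show ?thesis using nz'[of t] inS[of t] by simp
  qed
  ultimately obtain \<delta>2 where \<delta>2: "\<delta>2 > 0"
    "\<forall>z\<in>ball p \<delta>2. \<forall>t\<in>cball 0 2 - ball 0 (1/2). z + t *s v \<in> S \<inter> f -` (- {0})"
    using translates_compact_in_open[of "S \<inter> f -` (- {0})" "cball 0 2 - ball 0 (1/2)" p v] by blast
  show ?thesis
  proof
    show "line_roots f S (ball p (min \<delta>1 \<delta>2)) v"
      by unfold_locales (use S f \<delta>1 \<delta>2 in auto)
    show "min \<delta>1 \<delta>2 > 0" using \<delta>1 \<delta>2 by simp
    show "p + t *s v \<in> S \<and> f (p + t *s v) \<noteq> 0" if "0 < cmod t" "cmod t \<le> 2" for t
      using nz'[OF that] inS[of t] that by simp
  qed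
qed

text \<open>The discriminant sum \<open>disc_sum k uminus\<close>, with \<open>k\<close> the generic number of distinct
  roots on a line, vanishes on \<open>Y\<close>, but only to first order at the roots on a generic line.
  Being divisible by \<open>f\<close>, it forces these roots to be simple for \<open>f\<close>. A square factor of \<open>f\<close>
  at some nearby point would make the discriminant \<open>disc_sum k (\<lambda>t. 1)\<close> vanish identically.\<close>

theorem generator_reduced_nearby:
  fixes f :: "complex^'n::finite \<Rightarrow> complex"
  assumes S: "open S" and f: "holomorphic_cn f S" and p: "p \<in> S"
    and Y: "\<And>z. z \<in> S \<Longrightarrow> f z = 0 \<longleftrightarrow> z \<in> Y"
    and gen: "\<And>V g. open V \<Longrightarrow> p \<in> V \<Longrightarrow> holomorphic_cn g V \<Longrightarrow> (\<forall>z\<in>Y \<inter> V. g z = 0) \<Longrightarrow>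
       \<exists>W k. open W \<and> p \<in> W \<and> holomorphic_cn k W \<and> (\<forall>z\<in>W. g z = f z * k z)"
    and nz: "\<And>W. open W \<Longrightarrow> p \<in> W \<Longrightarrow> \<exists>z\<in>W. f z \<noteq> 0"
  shows "\<exists>\<delta>>0. \<forall>x\<in>ball p \<delta>. \<forall>U f' w. open U \<longrightarrow> x \<in> U \<longrightarrow> holomorphic_cn f' U \<longrightarrow> holomorphic_cn w U \<longrightarrow>
      (\<forall>z\<in>U. f z = f' z * w z) \<longrightarrow> (\<forall>z\<in>Y \<inter> U. f' z = 0) \<longrightarrow> f x = 0 \<longrightarrow> w x \<noteq> 0"
proof -
  obtain v \<delta>0 where \<delta>0: "\<delta>0 > 0" and LR: "line_roots f S (ball p \<delta>0) v"
    and pnz: "\<And>t. 0 < cmod t \<Longrightarrow> cmod t \<le> 2 \<Longrightarrow> p + t *s v \<in> S \<and> f (p + t *s v) \<noteq> 0"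
    using line_roots_exist[OF S f p nz] by blast
  interpret line_roots f S "ball p \<delta>0" v by (rule LR)
  have BS: "ball p \<delta>0 \<subseteq> S" using inS[of _ 0] by auto
  obtain d where d: "\<And>z. z \<in> ball p \<delta>0 \<Longrightarrow> (\<Sum>t\<in>roots z. mult z t) = d" using total_mult_constant by blast
  \<comment> \<open>\<open>k\<close> will be the least number that bounds the count of distinct
    roots on some ball around \<open>p\<close>. By minimality it is attained on every smaller
    ball.\<close>
  define P where "P = (\<lambda>j \<delta>. 0 < \<delta> \<and> \<delta> \<le> \<delta>0 \<and> (\<forall>z\<in>ball p \<delta>. card (roots z) \<le> j))"
  have "P (nat d) \<delta>0" using card_le_total_mult d \<delta>0 by (fastforce simp: P_def)
  then have ex: "\<exists>j \<delta>. P j \<delta>" by blast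
  define k where "k = (LEAST j. \<exists>\<delta>. P j \<delta>)"
  have "\<exists>\<delta>. P k \<delta>" unfolding k_def by (rule LeastI_ex[OF ex])
  then obtain \<delta>1 where P1: "P k \<delta>1" by blast
  then have \<delta>1: "0 < \<delta>1" "\<delta>1 \<le> \<delta>0" "\<And>z. z \<in> ball p \<delta>1 \<Longrightarrow> card (roots z) \<le> k" by (auto simp: P_def)
  have attained: "\<exists>z\<in>ball p \<delta>. card (roots z) = k" if \<delta>: "0 < \<delta>" "\<delta> \<le> \<delta>1" for \<delta>
  proof (rule ccontr)
    assume no: "\<not> ?thesis"
    have le: "card (roots z) < k" if "z \<in> ball p \<delta>" for z
      using \<delta>1(3)[of z] no that \<delta> by (force simp: le_less)
    have "k > 0" using le[of p] \<delta> by simp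
    then have "P (k - 1) \<delta>" using le \<delta> \<delta>1 by (force simp: P_def)
    then show False using \<open>k > 0\<close> not_less_Least[of "k - 1" "\<lambda>j. \<exists>\<delta>. P j \<delta>"] unfolding k_def by auto
  qed
  have sub1: "ball p \<delta>1 \<subseteq> ball p \<delta>0" using \<delta>1 by auto
  have holB: "holomorphic_cn (disc_sum k uminus) (ball p \<delta>1)"
    using holomorphic_cn_subset[OF disc_sum_holomorphic sub1] by blast
  \<comment> \<open>For \<open>z\<close> on \<open>Y\<close> the parameter 0 is a root, and it
    contributes a factor 0 to the product of the values of \<open>uminus\<close>; with fewer than
    \<open>k\<close> roots the sum vanishes anyway.\<close>
  have van: "\<forall>z\<in>Y \<inter> ball p \<delta>1. disc_sum k uminus z = 0"
  proof
    fix z assume z: "z \<in> Y \<inter> ball p \<delta>1"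
    then have z0: "z \<in> ball p \<delta>0" using sub1 by blast
    then have "0 \<in> roots z" using z Y BS by (auto simp: roots_def)
    then have "(\<Prod>x\<in>roots z. - x) = 0" using finite_roots[OF z0] by (intro prod_zero) auto
    then show "disc_sum k uminus z = 0"
      using disc_sum_eq_0[OF z0] disc_sum_eq[OF z0] \<delta>1(3)[of z] z by (cases "card (roots z) = k") (auto simp: le_less)
  qed
  obtain W \<kappa> where W: "open W" "p \<in> W" "holomorphic_cn \<kappa> W" "\<And>z. z \<in> W \<Longrightarrow> disc_sum k uminus z = f z * \<kappa> z"
    using gen[OF open_ball _ holB van] \<delta>1 by auto
  let ?W = "W \<inter> ball p \<delta>1"
  have "open {t. p + t *s v \<in> ?W}" by (intro open_line_preimage open_Int W open_ball)
  moreover have "0 \<in> {t. p + t *s v \<in> ?W}" using W \<delta>1 by simp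
  ultimately obtain \<epsilon>0 where \<epsilon>0: "\<epsilon>0 > 0" "cball 0 \<epsilon>0 \<subseteq> {t. p + t *s v \<in> ?W}" using open_contains_cball by blast
  \<comment> \<open>The bound \<open>1/4\<close> lets base points move along the line by less than
    \<open>\<epsilon>\<close> without a root leaving the unit disc, and without a zero coming in
    from outside the zero-free range that ends at 2.\<close>
  define \<epsilon> where "\<epsilon> = min \<epsilon>0 (1/4)"
  have \<epsilon>: "0 < \<epsilon>" "\<epsilon> \<le> 1/4" "cball 0 \<epsilon> \<subseteq> {t. p + t *s v \<in> ?W}" using \<epsilon>0 by (auto simp: \<epsilon>_def)
  obtain \<delta>2 where \<delta>2: "\<delta>2 > 0" "\<forall>z\<in>ball p \<delta>2. \<forall>t\<in>cball 0 \<epsilon>. z + t *s v \<in> ?W"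
    using translates_compact_in_open[of ?W "cball 0 \<epsilon>" p v] W \<epsilon> by (auto simp: subset_iff)
  have "open (S \<inter> f -` (- {0}))"
    by (intro continuous_open_preimage holomorphic_cn_continuous_on[OF f] S) auto
  moreover have "compact (cball 0 2 - ball (0::complex) \<epsilon>)" by (intro compact_diff) auto
  moreover have "p + t *s v \<in> S \<inter> f -` (- {0})" if "t \<in> cball 0 2 - ball 0 \<epsilon>" for t
  proof -
    have "\<epsilon> \<le> cmod t" "cmod t \<le> 2" using that by auto
    then have "0 < cmod t" "cmod t \<le> 2" using \<epsilon> by linarith+
    then show ?thesis using pnz[of t] by simp
  qed
  ultimately obtain \<delta>3 where \<delta>3: "\<delta>3 > 0"
    "\<forall>z\<in>ball p \<delta>3. \<forall>t\<in>cball 0 2 - ball 0 \<epsilon>. z + t *s v \<in> S \<inter> f -` (- {0})"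
    using translates_compact_in_open[of "S \<inter> f -` (- {0})" "cball 0 2 - ball 0 \<epsilon>" p v] by blast
  \<comment> \<open>A line with the generic number of roots, so close to \<open>p\<close> that all
    its roots lie in the disc of radius \<open>\<epsilon>\<close>, and that the factorization of the
    discriminant sum through \<open>f\<close> is valid along this disc.\<close>
  obtain z1 where z1: "z1 \<in> ball p (min \<delta>1 (min \<delta>2 \<delta>3))" "card (roots z1) = k"
    using attained[of "min \<delta>1 (min \<delta>2 \<delta>3)"] \<delta>1 \<delta>2 \<delta>3 by auto
  have z1B: "z1 \<in> ball p \<delta>0" using z1 sub1 by auto
  have nz1: "f (z1 + t *s v) \<noteq> 0" if "\<epsilon> \<le> cmod t" "cmod t \<le> 2" for t
    using \<delta>3 z1 that by auto
  have small: "cmod t < \<epsilon>" if "t \<in> roots z1" for t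
    using nz1[of t] that by (force simp: roots_def)
  have zW: "z1 + t *s v \<in> ?W" if "cmod t \<le> \<epsilon>" for t using \<delta>2 z1 that by auto
  have shift: "z1 + \<tau> *s v + (s - \<tau>) *s v = z1 + s *s v" for \<tau> s
    by (simp add: vec_eq_iff algebra_simps)
  \<comment> \<open>Moving the base point along its own line translates the roots and keeps their
    differences and multiplicities. So on this line only the factor coming from
    \<open>uminus\<close> varies, and the discriminant sum becomes the constant \<open>c\<close>
    times the product of all \<open>\<tau> - b\<close>.\<close>
  have roots_shift: "roots (z1 + \<tau> *s v) = (\<lambda>b. b - \<tau>) ` roots z1" if \<tau>: "cmod \<tau> < \<epsilon>" for \<tau>
  proof
    show "(\<lambda>b. b - \<tau>) ` roots z1 \<subseteq> roots (z1 + \<tau> *s v)"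
    proof
      fix s assume "s \<in> (\<lambda>b. b - \<tau>) ` roots z1"
      then obtain b where b: "b \<in> roots z1" "s = b - \<tau>" by blast
      have "cmod (b - \<tau>) < 1" using norm_triangle_ineq4[of b \<tau>] small[OF b(1)] \<tau> \<epsilon> by linarith
      then show "s \<in> roots (z1 + \<tau> *s v)" using b shift[of \<tau> b] by (simp add: roots_def)
    qed
    show "roots (z1 + \<tau> *s v) \<subseteq> (\<lambda>b. b - \<tau>) ` roots z1"
    proof
      fix s assume s: "s \<in> roots (z1 + \<tau> *s v)"
      have "z1 + \<tau> *s v + s *s v = z1 + (s + \<tau>) *s v" by (simp add: vec_eq_iff algebra_simps)
      with s have s1: "cmod s < 1" "f (z1 + (s + \<tau>) *s v) = 0" by (simp_all add: roots_def)
      have "cmod (s + \<tau>) \<le> 2" using norm_triangle_ineq[of s \<tau>] s1 \<tau> \<epsilon> by linarith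
      then have "cmod (s + \<tau>) < \<epsilon>" using nz1[of "s + \<tau>"] s1 by (meson not_le)
      then have "s + \<tau> \<in> roots z1" using s1 \<epsilon> by (simp add: roots_def)
      then show "s \<in> (\<lambda>b. b - \<tau>) ` roots z1" by (intro image_eqI[of _ _ "s + \<tau>"]) auto
    qed
  qed
  have mult_shift: "mult (z1 + \<tau> *s v) (b - \<tau>) = mult z1 b" for \<tau> b
  proof -
    have "z1 + \<tau> *s v + (u + (b - \<tau>)) *s v = z1 + (u + b) *s v" for u using shift[of \<tau> "u + b"] by (simp add: add_diff_eq)
    then show ?thesis
      unfolding mult_def zorder_shift[of _ "b - \<tau>"] zorder_shift[of _ b] by (simp only:)
  qed
  define c where "c = fact k * (\<Prod>x\<in>roots z1. of_int (mult z1 x)) *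
       (\<Prod>(x, y)\<in>{(x, y). x \<in> roots z1 \<and> y \<in> roots z1 \<and> x \<noteq> y}. x - y)"
  have c: "c \<noteq> (0::complex)" unfolding c_def by (rule disc_factor_nonzero[OF z1B])
  have Bline: "disc_sum k uminus (z1 + \<tau> *s v) = c * (\<Prod>b\<in>roots z1. \<tau> - b)" if \<tau>: "cmod \<tau> < \<epsilon>" for \<tau>
  proof -
    have inj: "inj_on (\<lambda>b. b - \<tau>) X" for X by (auto simp: inj_on_def)
    have zB: "z1 + \<tau> *s v \<in> ball p \<delta>0" using zW[of \<tau>] \<tau> sub1 by auto
    have pairs: "{(x, y). x \<in> (\<lambda>b. b - \<tau>) ` roots z1 \<and> y \<in> (\<lambda>b. b - \<tau>) ` roots z1 \<and> x \<noteq> y} =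
        map_prod (\<lambda>b. b - \<tau>) (\<lambda>b. b - \<tau>) ` {(x, y). x \<in> roots z1 \<and> y \<in> roots z1 \<and> x \<noteq> y}"
      by (auto simp: image_iff)
    have inj2: "inj_on (map_prod (\<lambda>b. b - \<tau>) (\<lambda>b. b - \<tau>)) X" for X by (auto simp: inj_on_def)
    have card: "card (roots (z1 + \<tau> *s v)) = k" unfolding roots_shift[OF \<tau>] using z1 card_image[OF inj] by metis
    show ?thesis
      unfolding disc_sum_eq[OF zB card] unfolding roots_shift[OF \<tau>] pairs prod.reindex[OF inj] prod.reindex[OF inj2]
      by (simp add: c_def mult_shift case_prod_beta)
  qed
  \<comment> \<open>A multiple zero of \<open>f\<close> at \<open>\<beta>\<close> would be a
    multiple zero of the product with \<open>\<kappa>\<close>, which is a polynomial whose zeros are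
    distinct.\<close>
  have simple: "mult z1 \<beta> = 1" if \<beta>: "\<beta> \<in> roots z1" for \<beta>
  proof (rule ccontr)
    assume "mult z1 \<beta> \<noteq> 1"
    then have d0: "deriv (\<lambda>t. f (z1 + t *s v)) \<beta> = 0" using mult_one_iff[OF z1B \<beta>] by blast
    have \<beta>0: "cmod \<beta> < \<epsilon>" "f (z1 + \<beta> *s v) = 0" using small[OF \<beta>] \<beta> by (auto simp: roots_def)
    have "z1 + \<beta> *s v \<in> S" using inS[OF z1B, of \<beta>] \<beta>0 \<epsilon> by simp
    from holomorphic_cn_line_derivative[OF f this]
    have F: "((\<lambda>t. f (z1 + t *s v)) has_field_derivative 0) (at \<beta>)" using d0 DERIV_imp_deriv by metis
    have "z1 + \<beta> *s v \<in> W" using zW[of \<beta>] \<beta>0 by simp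
    from DERIV_mult[OF F holomorphic_cn_line_derivative[OF W(3) this]]
    have "((\<lambda>t. f (z1 + t *s v) * \<kappa> (z1 + t *s v)) has_field_derivative 0) (at \<beta>)" using \<beta>0 by simp
    moreover have "f (z1 + t *s v) * \<kappa> (z1 + t *s v) = c * (\<Prod>b\<in>roots z1. t - b)" if "t \<in> ball 0 \<epsilon>" for t
      using Bline[of t] W(4)[of "z1 + t *s v"] zW[of t] that by simp
    ultimately have D0: "((\<lambda>t. c * (\<Prod>b\<in>roots z1. t - b)) has_field_derivative 0) (at \<beta>)"
      using has_field_derivative_transform_within_open[of _ _ \<beta> "ball 0 \<epsilon>"] \<beta>0 by simp
    define Q where "Q = (\<lambda>t. c * (\<Prod>b\<in>roots z1 - {\<beta>}. t - b))"
    have QQ: "c * (\<Prod>b\<in>roots z1. t - b) = Q t * (t - \<beta>)" for t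
      using finite_roots[OF z1B] \<beta> by (simp add: Q_def prod.remove mult.commute)
    have "isCont Q \<beta>" unfolding Q_def by (intro continuous_intros)
    then have "((\<lambda>t. Q t * (t - \<beta>)) has_field_derivative Q \<beta>) (at \<beta>)"
      unfolding CARAT_DERIV by (intro exI[of _ Q]) simp
    then have "Q \<beta> = 0" using D0 unfolding QQ by (rule DERIV_unique)
    then show False using c finite_roots[OF z1B] by (auto simp: Q_def prod_zero_iff)
  qed
  \<comment> \<open>The generic number of distinct roots equals the total multiplicity
    \<open>d\<close>. Hence a line with a multiple root anywhere over the ball has fewer than
    \<open>k\<close> distinct roots.\<close>
  have dk: "d = int k" using d[OF z1B] simple z1 by simp
  let ?D = "disc_sum k (\<lambda>t. 1)"
  have D1: "?D z1 \<noteq> 0" using disc_sum_eq[OF z1B z1(2), of "\<lambda>t. 1"] c by (simp add: c_def)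
  \<comment> \<open>If \<open>w x = 0\<close>, zeros of \<open>w\<close> persist on all lines near
    \<open>x\<close>. They are zeros of \<open>f\<close>, so they lie on \<open>Y\<close> and are
    zeros of \<open>f'\<close> too, which makes them multiple zeros of \<open>f\<close>. Then the
    discriminant vanishes on an open set and, by the identity theorem, also at
    \<open>z1\<close>.\<close>
  have "w x \<noteq> 0" if x: "x \<in> ball p \<delta>0" "open U" "x \<in> U" "holomorphic_cn f' U" "holomorphic_cn w U"
      and fw: "\<forall>z\<in>U. f z = f' z * w z" and f'Y: "\<forall>z\<in>Y \<inter> U. f' z = 0" and "f x = 0" for x U f' w
  proof
    assume wx: "w x = 0"
    let ?U = "U \<inter> S"
    have U: "open ?U" "x \<in> ?U" using x S BS by auto
    have "open {t. x + t *s v \<in> ?U}" by (intro open_line_preimage U)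
    moreover have "0 \<in> {t. x + t *s v \<in> ?U}" using U by simp
    ultimately obtain \<eta>0 where \<eta>0: "\<eta>0 > 0" "cball 0 \<eta>0 \<subseteq> {t. x + t *s v \<in> ?U}" using open_contains_cball by blast
    \<comment> \<open>There are finitely many roots, so \<open>\<eta>\<close> can avoid their
      absolute values. The circle of radius \<open>\<eta>\<close> then contains no zero of
      \<open>f\<close>, and none of \<open>w\<close>.\<close>
    have "finite (cmod ` roots x)" using finite_roots[OF x(1)] by simp
    moreover have "infinite {0<..<min \<eta>0 1}" using \<eta>0 by (intro infinite_Ioo) auto
    ultimately have "\<not> {0<..<min \<eta>0 1} \<subseteq> cmod ` roots x" using finite_subset by blast
    then obtain \<eta> where "\<eta> \<in> {0<..<min \<eta>0 1}" "\<eta> \<notin> cmod ` roots x" by blast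
    then have \<eta>: "0 < \<eta>" "\<eta> < \<eta>0" "\<eta> < 1" "\<eta> \<notin> cmod ` roots x" by simp_all
    have disc: "x + t *s v \<in> ?U" if "cmod t \<le> \<eta>" for t using \<eta>0 \<eta> that by (auto simp: subset_iff)
    have circ: "w (x + t *s v) \<noteq> 0" if "cmod t = \<eta>" for t
    proof -
      have "t \<notin> roots x" using \<eta> that by blast
      then have "f (x + t *s v) \<noteq> 0" using \<eta> that by (auto simp: roots_def)
      then show ?thesis using fw disc[of t] that by auto
    qed
    have "holomorphic_cn w ?U" using x holomorphic_cn_subset by blast
    from zeros_persist[OF U(1) this \<eta>(1) disc circ wx] obtain \<delta>' where \<delta>': "\<delta>' > 0"
      "\<forall>z\<in>ball x \<delta>'. \<exists>t. cmod t \<le> \<eta> \<and> z + t *s v \<in> ?U \<and> w (z + t *s v) = 0" by blast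
    have "?D z = 0" if z: "z \<in> ball x \<delta>' \<inter> ball p \<delta>0" for z
    proof -
      have zB: "z \<in> ball p \<delta>0" using z by simp
      obtain t where t: "cmod t \<le> \<eta>" "z + t *s v \<in> U" "z + t *s v \<in> S" "w (z + t *s v) = 0" using \<delta>' z by blast
      have f0: "f (z + t *s v) = 0" using fw t by simp
      then have tr: "t \<in> roots z" using t \<eta> by (simp add: roots_def)
      have f'0: "f' (z + t *s v) = 0" using f'Y Y f0 t by blast
      have "((\<lambda>s. f' (z + s *s v) * w (z + s *s v)) has_field_derivative 0) (at t)"
        using DERIV_mult[OF holomorphic_cn_line_derivative[OF x(4) t(2)] holomorphic_cn_line_derivative[OF x(5) t(2)]] t f'0 by simp
      then have "((\<lambda>s. f (z + s *s v)) has_field_derivative 0) (at t)"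
        by (rule has_field_derivative_transform_within_open[OF _ open_line_preimage[OF x(2)]]) (use t fw in auto)
      then have "mult z t \<noteq> 1" using mult_one_iff[OF zB tr] DERIV_imp_deriv by blast
      then have "1 < mult z t" using mult_pos[OF zB tr] by simp
      then have "(\<Sum>t\<in>roots z. 1) < (\<Sum>t\<in>roots z. mult z t)"
        using mult_pos[OF zB] tr by (intro sum_strict_mono_ex1 finite_roots[OF zB]) auto
      then have "card (roots z) < k" using d[OF zB] dk by simp
      then show ?thesis by (rule disc_sum_eq_0[OF zB])
    qed
    then have "?D z1 = 0"
      using x(1) \<delta>' by (intro holomorphic_cn_identity_convex[OF disc_sum_holomorphic open_ball convex_ball _ _ _ _ z1B,
          of _ "ball x \<delta>' \<inter> ball p \<delta>0" x]) auto
    then show False using D1 by blast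
  qed
  then show ?thesis using \<delta>0 by blast
qed

lemma holomorphic_cn_derivative_expand:
  fixes f :: "complex^'n::finite \<Rightarrow> complex"
  assumes "holomorphic_cn f S" "z \<in> S"
  shows "frechet_derivative f (at z) u = (\<Sum>i\<in>UNIV. u $ i * frechet_derivative f (at z) (axis i 1))"
proof -
  have "linear (frechet_derivative f (at z))"
    using holomorphic_cn_derivative(1)[OF assms] has_derivative_linear by blast
  then have "frechet_derivative f (at z) (\<Sum>i\<in>UNIV. u $ i *s axis i 1) =
      (\<Sum>i\<in>UNIV. frechet_derivative f (at z) (u $ i *s axis i 1))" by (rule linear_sum)
  then show ?thesis by (simp only: basis_expansion holomorphic_cn_derivative(2)[OF assms])
qed

text \<open>On each line through \<open>p\<close> the function solves a homogeneous linear differential equation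
  with initial value \<open>0\<close>.\<close>

lemma zero_if_divides_derivatives:
  fixes f :: "complex^'n::finite \<Rightarrow> complex"
  assumes S: "open S" and f: "holomorphic_cn f S" and p: "p \<in> S" "f p = 0"
    and dv: "\<And>i. \<exists>W k. open W \<and> p \<in> W \<and> holomorphic_cn k W \<and> (\<forall>z\<in>W. frechet_derivative f (at z) (axis i 1) = f z * k z)"
  shows "\<exists>W. open W \<and> p \<in> W \<and> (\<forall>z\<in>W. f z = 0)"
proof -
  from dv obtain W k where W: "\<And>i. open (W i)" "\<And>i. p \<in> W i" "\<And>i. holomorphic_cn (k i) (W i)"
    "\<And>i z. z \<in> W i \<Longrightarrow> frechet_derivative f (at z) (axis i 1) = f z * k i z" by metis
  have "open (S \<inter> (\<Inter>i. W i))" using S W(1) by (intro open_Int open_INT) auto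
  moreover have "p \<in> S \<inter> (\<Inter>i. W i)" using p W(2) by auto
  ultimately obtain \<delta> where \<delta>: "\<delta> > 0" "ball p \<delta> \<subseteq> S \<inter> (\<Inter>i. W i)" using openE by blast
  have "f z = 0" if z: "z \<in> ball p \<delta>" for z
  proof -
    define u where "u = z - p"
    let ?V = "{t. p + t *s u \<in> ball p \<delta>}"
    have V: "open ?V" "convex ?V" by (intro open_line_preimage convex_line_preimage; simp)+
    have V01: "0 \<in> ?V" "1 \<in> ?V" using \<delta> z by (auto simp: u_def)
    define K where "K = (\<lambda>t. \<Sum>i\<in>UNIV. u $ i * k i (p + t *s u))"
    have "K holomorphic_on ?V" unfolding K_def
      by (intro holomorphic_intros holomorphic_on_subset[OF holomorphic_cn_line[OF W(3)]]) (use \<delta> in auto)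
    then obtain \<Phi> where \<Phi>: "\<And>t. t \<in> ?V \<Longrightarrow> (\<Phi> has_field_derivative K t) (at t within ?V)"
      using holomorphic_convex_primitive'[OF V(2,1)] by blast
    \<comment> \<open>Along the line the restriction \<open>F\<close> satisfies
      \<open>F' = F * K\<close>, and \<open>exp (- \<Phi> t)\<close> with \<open>\<Phi>' = K\<close>
      is the integrating factor.\<close>
    have "((\<lambda>t. f (p + t *s u) * exp (- \<Phi> t)) has_field_derivative 0) (at t within ?V)" if t: "t \<in> ?V" for t
    proof -
      have tS: "p + t *s u \<in> S" "\<And>i. p + t *s u \<in> W i" using \<delta> t by auto
      have "frechet_derivative f (at (p + t *s u)) u = f (p + t *s u) * K t"
        unfolding holomorphic_cn_derivative_expand[OF f tS(1), of u] K_def sum_distrib_left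
        by (rule sum.cong) (simp_all add: W(4)[OF tS(2)])
      with holomorphic_cn_line_derivative[OF f tS(1)]
      have "((\<lambda>t. f (p + t *s u)) has_field_derivative f (p + t *s u) * K t) (at t within ?V)"
        by (simp add: has_field_derivative_at_within)
      from this \<Phi>[OF t] show ?thesis by (auto intro!: derivative_eq_intros)
    qed
    from has_field_derivative_zero_constant[OF V(2) this] obtain c
      where c: "\<And>t. t \<in> ?V \<Longrightarrow> f (p + t *s u) * exp (- \<Phi> t) = c" by blast
    have "c = 0" using c[OF V01(1)] p by simp
    then show ?thesis using c[OF V01(2)] by (simp add: u_def)
  qed
  then show ?thesis using \<delta> by (intro exI[of _ "ball p \<delta>"]) auto
qed

lemma generator_smooth_nearby:
  fixes f :: "complex^'n::finite \<Rightarrow> complex"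
  assumes S: "open S" and f: "holomorphic_cn f S" and p: "p \<in> S" "f p = 0"
    and Y: "\<And>z. z \<in> S \<Longrightarrow> f z = 0 \<longleftrightarrow> z \<in> Y"
    and gen: "\<And>V g. open V \<Longrightarrow> p \<in> V \<Longrightarrow> holomorphic_cn g V \<Longrightarrow> (\<forall>z\<in>Y \<inter> V. g z = 0) \<Longrightarrow>
       \<exists>W k. open W \<and> p \<in> W \<and> holomorphic_cn k W \<and> (\<forall>z\<in>W. g z = f z * k z)"
    and nz: "\<And>W. open W \<Longrightarrow> p \<in> W \<Longrightarrow> \<exists>z\<in>W. f z \<noteq> 0"
  shows "\<exists>z\<in>S. z \<in> Y \<and> (\<exists>u. frechet_derivative f (at z) u \<noteq> 0)"
proof (rule ccontr)
  assume "\<not> ?thesis"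
  then have z: "\<forall>z\<in>Y \<inter> S. frechet_derivative f (at z) u = 0" for u by blast
  have "\<exists>W. open W \<and> p \<in> W \<and> (\<forall>z\<in>W. f z = 0)"
    by (rule zero_if_divides_derivatives[OF S f p]) (rule gen[OF S p(1) holomorphic_cn_dir_derivative[OF S f] z])
  then show False using nz by blast
qed

section \<open>Composition with holomorphic maps\<close>

lemma has_derivative_coordinatewise:
  fixes \<phi> :: "'a::real_normed_vector \<Rightarrow> complex^'n::finite"
  assumes "\<And>i. ((\<lambda>z. \<phi> z $ i) has_derivative D i) F"
  shows "(\<phi> has_derivative (\<lambda>h. \<Sum>i\<in>UNIV. D i h *s axis i 1)) F"
proof -
  have "((\<lambda>z. \<Sum>i\<in>UNIV. \<phi> z $ i *s axis i 1) has_derivative (\<lambda>h. \<Sum>i\<in>UNIV. D i h *s axis i 1)) F"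
    by (intro has_derivative_sum bounded_linear.has_derivative[OF bounded_linear_smult_left] assms)
  then show ?thesis by (simp only: basis_expansion)
qed

lemma holomorphic_cn_map_derivative:
  fixes \<phi> :: "complex^'m::finite \<Rightarrow> complex^'n::finite"
  assumes "\<And>i. holomorphic_cn (\<lambda>z. \<phi> z $ i) T" "z \<in> T"
  obtains D where "(\<phi> has_derivative D) (at z)" "\<And>c v. D (c *s v) = c *s D v"
proof
  show "(\<phi> has_derivative (\<lambda>h. \<Sum>i\<in>UNIV. frechet_derivative (\<lambda>z. \<phi> z $ i) (at z) h *s axis i 1)) (at z)"
    by (intro has_derivative_coordinatewise holomorphic_cn_derivative(1)[OF assms])
  show "(\<Sum>i\<in>UNIV. frechet_derivative (\<lambda>z. \<phi> z $ i) (at z) (c *s v) *s axis i 1) =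
    c *s (\<Sum>i\<in>UNIV. frechet_derivative (\<lambda>z. \<phi> z $ i) (at z) v *s axis i 1)" for c v
    by (simp add: holomorphic_cn_derivative(2)[OF assms] vec_eq_iff sum_distrib_left mult.assoc)
qed

lemma holomorphic_cn_compose:
  fixes \<phi> :: "complex^'m::finite \<Rightarrow> complex^'n::finite"
  assumes f: "holomorphic_cn f S" and \<phi>: "\<And>i. holomorphic_cn (\<lambda>z. \<phi> z $ i) T" and sub: "\<And>z. z \<in> T \<Longrightarrow> \<phi> z \<in> S"
  shows "holomorphic_cn (\<lambda>z. f (\<phi> z)) T"
  unfolding holomorphic_cn_def
proof
  fix z assume z: "z \<in> T"
  obtain D where D: "(\<phi> has_derivative D) (at z)" "\<And>c v. D (c *s v) = c *s D v"
    using holomorphic_cn_map_derivative[OF \<phi> z] by blast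
  have "((\<lambda>z. f (\<phi> z)) has_derivative (\<lambda>h. frechet_derivative f (at (\<phi> z)) (D h))) (at z)"
    by (rule has_derivative_compose[OF D(1) holomorphic_cn_derivative(1)[OF f sub[OF z]]])
  then show "\<exists>D. ((\<lambda>z. f (\<phi> z)) has_derivative D) (at z) \<and> (\<forall>c v. D (c *s v) = c * D v)"
    by (intro exI conjI) (auto simp: D(2) holomorphic_cn_derivative(2)[OF f sub[OF z]])
qed

section \<open>Positivity of the Liouville density\<close>

text \<open>For a form in \<open>n\<close> complex dimensions this is \<open>2^n * n!\<close> times
  the Pfaffian of the matrix of values on the frame \<open>w\<close>. The frame is arbitrary so that
  column operations can be carried out on it.\<close>

definition pfaffian_sum :: "('v \<Rightarrow> 'v \<Rightarrow> real) \<Rightarrow> ('n::finite \<times> bool \<Rightarrow> 'v) \<Rightarrow> real" where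
  "pfaffian_sum \<omega> w = (\<Sum>p | p permutes (UNIV :: ('n \<times> bool) set).
     of_int (sign p) * (\<Prod>j\<in>UNIV. \<omega> (w (p (j, False))) (w (p (j, True)))))"

text \<open>Since \<open>p\<close> is a bijection, the vector with index \<open>a\<close> enters
  exactly one factor, in exactly one of its two arguments.\<close>

lemma pfaffian_term_linear:
  fixes \<omega> :: "'v::real_vector \<Rightarrow> 'v \<Rightarrow> real" and w :: "'n::finite \<times> bool \<Rightarrow> 'v"
  assumes bl: "bilinear \<omega>" and p: "p permutes UNIV"
  defines "T \<equiv> \<lambda>w. \<Prod>j\<in>UNIV. \<omega> (w (p (j, False))) (w (p (j, True)))"
  shows "T (w(a := x + c *\<^sub>R y)) = T (w(a := x)) + c * T (w(a := y))"
proof -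
  obtain j0 s where a: "p (j0, s) = a" using permutes_surj[OF p] by (metis surj_def surj_pair)
  have inj: "p i = p i' \<longleftrightarrow> i = i'" for i i' using permutes_inj[OF p] by (auto dest: injD)
  define Q where "Q = (\<Prod>j\<in>UNIV - {j0}. \<omega> (w (p (j, False))) (w (p (j, True))))"
  have T: "T (w(a := z)) = \<omega> ((w(a := z)) (p (j0, False))) ((w(a := z)) (p (j0, True))) * Q" for z
  proof -
    have "(\<Prod>j\<in>UNIV - {j0}. \<omega> ((w(a := z)) (p (j, False))) ((w(a := z)) (p (j, True)))) = Q"
      unfolding Q_def by (rule prod.cong) (auto simp: inj simp flip: a)
    then show ?thesis unfolding T_def by (subst prod.remove[of UNIV j0]) auto
  qed
  show ?thesis
    unfolding T using inj
    by (cases s) (auto simp flip: a simp: bilinear_ladd[OF bl] bilinear_radd[OF bl] bilinear_lmul[OF bl] bilinear_rmul[OF bl] algebra_simps)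
qed

lemma pfaffian_sum_linear:
  fixes w :: "'n::finite \<times> bool \<Rightarrow> 'v::real_vector"
  assumes "bilinear \<omega>"
  shows "pfaffian_sum \<omega> (w(a := x + c *\<^sub>R y)) = pfaffian_sum \<omega> (w(a := x)) + c * pfaffian_sum \<omega> (w(a := y))"
proof -
  have "pfaffian_sum \<omega> (w(a := x + c *\<^sub>R y)) = (\<Sum>p | p permutes UNIV.
      of_int (sign p) * (\<Prod>j\<in>UNIV. \<omega> ((w(a := x)) (p (j, False))) ((w(a := x)) (p (j, True)))) +
      c * (of_int (sign p) * (\<Prod>j\<in>UNIV. \<omega> ((w(a := y)) (p (j, False))) ((w(a := y)) (p (j, True))))))"
    unfolding pfaffian_sum_def
  proof (rule sum.cong[OF refl])
    fix p :: "'n \<times> bool \<Rightarrow> 'n \<times> bool" assume "p \<in> {p. p permutes UNIV}"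
    then have p: "p permutes UNIV" by simp
    show "of_int (sign p) * (\<Prod>j\<in>UNIV. \<omega> ((w(a := x + c *\<^sub>R y)) (p (j, False))) ((w(a := x + c *\<^sub>R y)) (p (j, True)))) =
      of_int (sign p) * (\<Prod>j\<in>UNIV. \<omega> ((w(a := x)) (p (j, False))) ((w(a := x)) (p (j, True)))) +
      c * (of_int (sign p) * (\<Prod>j\<in>UNIV. \<omega> ((w(a := y)) (p (j, False))) ((w(a := y)) (p (j, True)))))"
      unfolding pfaffian_term_linear[OF assms p] by (simp add: algebra_simps)
  qed
  then show ?thesis unfolding pfaffian_sum_def by (simp add: sum.distrib sum_distrib_left)
qed

text \<open>Composing every permutation with the transposition of \<open>a\<close> and
  \<open>b\<close> keeps the products and reverses the signs, so the sum equals its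
  negative.\<close>

lemma pfaffian_sum_repeated:
  fixes w :: "'n::finite \<times> bool \<Rightarrow> 'v"
  assumes "a \<noteq> b" "w a = w b" shows "pfaffian_sum \<omega> w = 0"
proof -
  let ?t = "Transposition.transpose a b"
  have w: "w (?t i) = w i" for i using assms by (auto simp: Transposition.transpose_def)
  have "pfaffian_sum \<omega> w = (\<Sum>p | p permutes (UNIV :: ('n \<times> bool) set).
     of_int (sign (?t \<circ> p)) * (\<Prod>j\<in>UNIV. \<omega> (w ((?t \<circ> p) (j, False))) (w ((?t \<circ> p) (j, True)))))"
    unfolding pfaffian_sum_def by (rule setum_permutations_compose_left) (simp add: permutes_swap_id)
  also have "\<dots> = - pfaffian_sum \<omega> w"
    unfolding pfaffian_sum_def sum_negf[symmetric]
    by (rule sum.cong) (auto simp: w sign_compose permutation_swap_id sign_swap_id assms(1) permutes_imp_permutation)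
  finally show ?thesis by simp
qed

lemma pfaffian_sum_elementary:
  fixes w :: "'n::finite \<times> bool \<Rightarrow> 'v::real_vector"
  assumes "bilinear \<omega>" "a \<noteq> b"
  shows "pfaffian_sum \<omega> (w(a := w a + c *\<^sub>R w b)) = pfaffian_sum \<omega> w"
  using pfaffian_sum_linear[OF assms(1), of w a "w a" c "w b"] pfaffian_sum_repeated[of a b "w(a := w b)" \<omega>] assms(2)
  by simp

definition complex_frame :: "('n \<Rightarrow> complex^'m) \<Rightarrow> 'n \<times> bool \<Rightarrow> complex^'m" where
  "complex_frame u = (\<lambda>(j, b). (if b then \<i> else 1) *s u j)"

lemma smult_Complex: "\<alpha> *s (x :: complex^'m) = Re \<alpha> *\<^sub>R x + Im \<alpha> *\<^sub>R (\<i> *s x)"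
  by (simp add: vec_eq_iff) (simp add: complex_eq_iff)

text \<open>Adding \<open>\<alpha> *s u j\<close> to \<open>u k\<close> amounts to four real
  elementary operations: \<open>Re \<alpha>\<close> times \<open>u j\<close> and
  \<open>Im \<alpha>\<close> times \<open>\<i> *s u j\<close> are added to \<open>u k\<close>, and
  correspondingly \<open>Re \<alpha>\<close> times \<open>\<i> *s u j\<close> and
  \<open>- Im \<alpha>\<close> times \<open>u j\<close> to \<open>\<i> *s u k\<close>.\<close>

lemma pfaffian_sum_frame_step:
  fixes u :: "'n::finite \<Rightarrow> complex^'m::finite"
  assumes bl: "bilinear \<omega>" and kj: "k \<noteq> j"
  shows "pfaffian_sum \<omega> (complex_frame (u(k := u k + \<alpha> *s u j))) = pfaffian_sum \<omega> (complex_frame u)"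
proof -
  let ?a = "Re \<alpha>" and ?b = "Im \<alpha>"
  define w0 where "w0 = complex_frame u"
  define w1 where "w1 = w0((k, False) := w0 (k, False) + ?a *\<^sub>R w0 (j, False))"
  define w2 where "w2 = w1((k, False) := w1 (k, False) + ?b *\<^sub>R w1 (j, True))"
  define w3 where "w3 = w2((k, True) := w2 (k, True) + ?a *\<^sub>R w2 (j, True))"
  define w4 where "w4 = w3((k, True) := w3 (k, True) + (- ?b) *\<^sub>R w3 (j, False))"
  have "pfaffian_sum \<omega> w4 = pfaffian_sum \<omega> w0"
    unfolding w4_def w3_def w2_def w1_def using kj by (simp only: pfaffian_sum_elementary[OF bl] prod.inject simp_thms)
  moreover have "w4 = complex_frame (u(k := u k + \<alpha> *s u j))"
  proof
    fix i :: "'n \<times> bool"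
    obtain l s where i: "i = (l, s)" by (cases i)
    have "\<i> *s (u k + \<alpha> *s u j) = \<i> *s u k + ?a *\<^sub>R (\<i> *s u j) + (- ?b) *\<^sub>R u j"
      by (simp add: vec_eq_iff) (simp add: complex_eq_iff)
    then show "w4 i = complex_frame (u(k := u k + \<alpha> *s u j)) i"
      using kj smult_Complex[of \<alpha> "u j"] unfolding i w4_def w3_def w2_def w1_def w0_def complex_frame_def
      by (cases s) auto
  qed
  ultimately show ?thesis by (simp add: w0_def)
qed

lemma pfaffian_sum_frame_eliminate:
  fixes u :: "'n::finite \<Rightarrow> complex^'m::finite"
  assumes bl: "bilinear \<omega>" and "j \<notin> K"
  shows "pfaffian_sum \<omega> (complex_frame (\<lambda>k. if k \<in> K then u k + \<alpha> k *s u j else u k)) = pfaffian_sum \<omega> (complex_frame u)"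
proof -
  have "finite K" by simp
  then show ?thesis using assms(2)
  proof (induction K rule: finite_induct)
    case (insert k K)
    let ?u = "\<lambda>k. if k \<in> K then u k + \<alpha> k *s u j else u k"
    have "(\<lambda>i. if i \<in> insert k K then u i + \<alpha> i *s u j else u i) = ?u(k := ?u k + \<alpha> k *s ?u j)"
      using insert by auto
    then show ?case using pfaffian_sum_frame_step[OF bl, of k j ?u "\<alpha> k"] insert by auto
  qed simp
qed

text \<open>A transposition of indices lifts to two transpositions of pairs, one for each value of
  the second component, so every lifted permutation is even.\<close>

lemma sign_lift:
  assumes "\<pi> permutes (UNIV :: 'n::finite set)"
  shows "sign (\<lambda>(j, b::bool). (\<pi> j, b)) = 1 \<and> permutation (\<lambda>(j, b::bool). (\<pi> j, b))"
  using assms finite[of UNIV]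
proof (induction \<pi> rule: permutes_induct)
  case id
  have "(\<lambda>(j, b). (id j, b)) = (id :: 'n \<times> bool \<Rightarrow> _)" by auto
  then show ?case by (simp only: sign_id permutation_id simp_thms)
next
  case (swap a c \<pi>)
  show ?case
  proof (cases "a = c")
    case False
    let ?t = "\<lambda>b::bool. Transposition.transpose (a, b) (c, b)"
    have "(\<lambda>(j, b). ((Transposition.transpose a c \<circ> \<pi>) j, b)) = ?t False \<circ> (?t True \<circ> (\<lambda>(j, b). (\<pi> j, b)))"
      by (auto simp: fun_eq_iff Transposition.transpose_def)
    moreover define l where "l = (\<lambda>(j, b::bool). (\<pi> j, b))"
    moreover have "sign l = 1" "permutation l" using swap by (auto simp: l_def)
    moreover have "(a, b) \<noteq> (c, b)" for b :: bool using False by simp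
    ultimately show ?thesis
      by (simp only: sign_compose permutation_swap_id sign_swap_id permutation_compose if_False) simp
  qed (use swap in simp)
qed

context
  fixes \<omega> :: "complex^'n::finite \<Rightarrow> complex^'n \<Rightarrow> real"
  assumes bl: "bilinear \<omega>" and alt: "\<And>u v. \<omega> u v = - \<omega> v u"
    and J: "\<And>u v. \<omega> (\<i> *s u) (\<i> *s v) = \<omega> u v" and pos: "\<And>u. u \<noteq> 0 \<Longrightarrow> \<omega> u (\<i> *s u) > 0"
begin

private lemma self0: "\<omega> u u = 0" using alt[of u u] by simp

private lemma JJ: "\<i> *s (\<i> *s u) = - (u :: complex^'n)" by (simp add: vec_eq_iff)

private lemma J_swap: "\<omega> (\<i> *s u) v = - \<omega> u (\<i> *s v)"
  using J[of u "\<i> *s v"] by (simp add: JJ bilinear_rneg[OF bl])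

private lemma lin: "\<omega> x (y + \<alpha> *s z) = \<omega> x y + Re \<alpha> * \<omega> x z + Im \<alpha> * \<omega> x (\<i> *s z)"
  by (subst smult_Complex) (simp add: bilinear_radd[OF bl] bilinear_rmul[OF bl])

private lemma linJ: "\<omega> x (\<i> *s (y + \<alpha> *s z)) = \<omega> x (\<i> *s y) + Re \<alpha> * \<omega> x (\<i> *s z) - Im \<alpha> * \<omega> x z"
proof -
  have "\<i> *s (y + \<alpha> *s z) = \<i> *s y + \<alpha> *s (\<i> *s z)" by (simp add: vec_eq_iff algebra_simps)
  then show ?thesis by (simp only: lin JJ bilinear_rneg[OF bl])
qed

text \<open>Gram-Schmidt for the hermitian form whose real and imaginary parts are, up to sign,
  \<open>\<omega> u (\<i> *s v)\<close> and \<open>\<omega> u v\<close>, treating one index at a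
  time. The last clause records that the vectors not yet treated agree with the standard basis in
  the coordinates outside \<open>S\<close>; this ensures that the next one is nonzero.\<close>

private lemma gram_schmidt:
  "finite S \<Longrightarrow> \<exists>u :: 'n \<Rightarrow> complex^'n.
     pfaffian_sum \<omega> (complex_frame u) = pfaffian_sum \<omega> (complex_frame (\<lambda>j. axis j 1)) \<and>
     (\<forall>j\<in>S. \<omega> (u j) (\<i> *s u j) > 0) \<and>
     (\<forall>j\<in>S. \<forall>k. k \<noteq> j \<longrightarrow> \<omega> (u j) (u k) = 0 \<and> \<omega> (u j) (\<i> *s u k) = 0) \<and>
     (\<forall>k. k \<notin> S \<longrightarrow> u k $ k = 1 \<and> (\<forall>i. i \<notin> S \<longrightarrow> i \<noteq> k \<longrightarrow> u k $ i = 0))"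
proof (induction S rule: finite_induct)
  case empty
  show ?case by (rule exI[of _ "\<lambda>j. axis j 1"]) (auto simp: axis_def)
next
  case (insert j S)
  from insert.IH obtain u :: "'n \<Rightarrow> complex^'n" where u: "pfaffian_sum \<omega> (complex_frame u) = pfaffian_sum \<omega> (complex_frame (\<lambda>j. axis j 1)) \<and>
     (\<forall>j\<in>S. \<omega> (u j) (\<i> *s u j) > 0) \<and>
     (\<forall>j\<in>S. \<forall>k. k \<noteq> j \<longrightarrow> \<omega> (u j) (u k) = 0 \<and> \<omega> (u j) (\<i> *s u k) = 0) \<and>
     (\<forall>k. k \<notin> S \<longrightarrow> u k $ k = 1 \<and> (\<forall>i. i \<notin> S \<longrightarrow> i \<noteq> k \<longrightarrow> u k $ i = 0))"
    by (elim exE)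
  have u1: "pfaffian_sum \<omega> (complex_frame u) = pfaffian_sum \<omega> (complex_frame (\<lambda>j. axis j 1))"
    using u by (elim conjE)
  have u2: "\<omega> (u j) (\<i> *s u j) > 0" if "j \<in> S" for j using u that by (elim conjE) (rule bspec)
  have u3: "\<omega> (u j) (u k) = 0 \<and> \<omega> (u j) (\<i> *s u k) = 0" if "j \<in> S" "k \<noteq> j" for j k using u that by (elim conjE) simp
  have u4: "u k $ k = 1" if "k \<notin> S" for k using u that by (elim conjE) simp
  have u5: "u k $ i = 0" if "k \<notin> S" "i \<notin> S" "i \<noteq> k" for k i using u that by (elim conjE) simp
  have "u j \<noteq> 0" using u4[OF insert(2)] by auto
  then have l: "\<omega> (u j) (\<i> *s u j) > 0" by (rule pos)
  define l where "l = \<omega> (u j) (\<i> *s u j)"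
  \<comment> \<open>The solution of the two real equations that make \<open>u j\<close> orthogonal
    to \<open>u k + \<alpha> k *s u j\<close> and to its multiple by \<open>\<i>\<close>: by
    \<open>lin\<close> the imaginary part of \<open>\<alpha> k\<close> enters the first, and by
    \<open>linJ\<close> the real part enters the second, each with the factor
    \<open>l\<close>.\<close>
  define \<alpha> where "\<alpha> = (\<lambda>k. Complex (- \<omega> (u j) (\<i> *s u k) / l) (- \<omega> (u j) (u k) / l))"
  define K where "K = - insert j S"
  define u' where "u' = (\<lambda>k. if k \<in> K then u k + \<alpha> k *s u j else u k)"
  have jS: "u' k = u k" if "k \<in> insert j S" for k using that by (auto simp: u'_def K_def)
  have oS: "\<omega> (u i) (u' k) = 0 \<and> \<omega> (u i) (\<i> *s u' k) = 0" if "i \<in> S" "k \<noteq> i" for i k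
  proof -
    have "j \<noteq> i" using that insert(2) by auto
    then show ?thesis using u3[OF that] u3[OF that(1), of j] by (simp add: u'_def lin linJ)
  qed
  have oj: "\<omega> (u j) (u' k) = 0 \<and> \<omega> (u j) (\<i> *s u' k) = 0" if "k \<noteq> j" for k
  proof (cases "k \<in> S")
    case True
    then show ?thesis using u3[OF True, of j] insert(2) alt[of "u j" "u k"] alt[of "u j" "\<i> *s u k"] J_swap[of "u k" "u j"]
      by (auto simp: jS)
  next
    case False
    then have "k \<in> K" using that by (simp add: K_def)
    then show ?thesis using l unfolding u'_def by (simp add: lin linJ self0 \<alpha>_def l_def[symmetric])
  qed
  show ?case
  proof (intro exI[of _ u'] conjI ballI allI impI)
    show "pfaffian_sum \<omega> (complex_frame u') = pfaffian_sum \<omega> (complex_frame (\<lambda>j. axis j 1))"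
      unfolding u'_def using pfaffian_sum_frame_eliminate[OF bl, of j K u \<alpha>] u1 by (simp add: K_def)
    show "\<omega> (u' i) (\<i> *s u' i) > 0" if "i \<in> insert j S" for i using that l u2 by (auto simp: jS)
    show "\<omega> (u' i) (u' k) = 0" "\<omega> (u' i) (\<i> *s u' k) = 0" if "i \<in> insert j S" "k \<noteq> i" for i k
      using that oj[of k] oS[of i k] by (auto simp: jS)
    show "u' k $ k = 1" if "k \<notin> insert j S" for k
      using that u4 u5[of j k] insert(2) by (auto simp: u'_def)
    show "u' k $ i = 0" if "k \<notin> insert j S" "i \<notin> insert j S" "i \<noteq> k" for i k
      using that u5[of k i] u5[of j i] insert(2) by (auto simp: u'_def)
  qed
qed

text \<open>Exchanging the two entries of a pair changes both the sign of the permutation and the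
  sign of one factor.\<close>

private lemma flip_pair:
  fixes w :: "'n \<times> bool \<Rightarrow> complex^'n" and j :: 'n
  assumes p: "p permutes UNIV"
  defines "q \<equiv> p \<circ> Transposition.transpose (j, False) (j, True)"
  shows "of_int (sign q) * (\<Prod>i\<in>UNIV. \<omega> (w (q (i, False))) (w (q (i, True)))) =
    of_int (sign p) * (\<Prod>i\<in>UNIV. \<omega> (w (p (i, False))) (w (p (i, True))))"
proof -
  have "sign q = - sign p" unfolding q_def
    by (subst sign_compose) (auto simp: p permutes_imp_permutation[OF finite p] permutation_swap_id sign_swap_id)
  moreover have "(\<Prod>i\<in>UNIV - {j}. \<omega> (w (q (i, False))) (w (q (i, True)))) = (\<Prod>i\<in>UNIV - {j}. \<omega> (w (p (i, False))) (w (p (i, True))))"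
    by (rule prod.cong) (auto simp: q_def Transposition.transpose_def)
  ultimately show ?thesis
    using alt[of "w (p (j, True))" "w (p (j, False))"] by (simp add: prod.remove[of UNIV j] q_def)
qed

text \<open>For an orthogonal frame a nonzero product must pair each \<open>u k\<close> with
  \<open>\<i> *s u k\<close>. The induction counts the pairs in the wrong order and removes one by
  \<open>flip_pair\<close>, which does not change the term. When none is left, \<open>p\<close> is a
  lifted permutation of even sign and every factor is positive.\<close>

private lemma orthogonal_term_nonneg:
  fixes u :: "'n \<Rightarrow> complex^'n"
  assumes up: "\<And>j. \<omega> (u j) (\<i> *s u j) > 0"
    and uo: "\<And>j k. k \<noteq> j \<Longrightarrow> \<omega> (u j) (u k) = 0 \<and> \<omega> (u j) (\<i> *s u k) = 0"
  defines "w \<equiv> complex_frame u"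
  shows "p permutes UNIV \<Longrightarrow> of_int (sign p) * (\<Prod>i\<in>UNIV. \<omega> (w (p (i, False))) (w (p (i, True)))) \<ge> 0"
proof (induction "card {j. snd (p (j, False))}" arbitrary: p rule: less_induct)
  case less
  show ?case
  proof (cases "(\<Prod>i\<in>UNIV. \<omega> (w (p (i, False))) (w (p (i, True)))) = 0")
    case True
    then show ?thesis by (simp only: mult_zero_right order_refl)
  next
    case False
    have w0: "\<omega> (w (k, b)) (w (l, c)) = 0" if "k \<noteq> l" for k l b c
      using uo[OF that[symmetric]] J[of "u k" "u l"] J_swap[of "u k" "u l"] unfolding w_def complex_frame_def by auto
    have fst: "fst (p (i, False)) = fst (p (i, True))" for i
    proof (rule ccontr)
      assume "fst (p (i, False)) \<noteq> fst (p (i, True))"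
      then have "\<omega> (w (p (i, False))) (w (p (i, True))) = 0" using w0 by (metis prod.collapse)
      then show False using False by auto
    qed
    have snd: "snd (p (i, False)) \<noteq> snd (p (i, True))" for i
    proof
      assume "snd (p (i, False)) = snd (p (i, True))"
      then have "p (i, False) = p (i, True)" using fst by (simp add: prod_eq_iff)
      then show False using permutes_inj[OF less.prems] by (auto dest: injD)
    qed
    show ?thesis
    proof (cases "\<exists>j. snd (p (j, False))")
      case True
      then obtain j where j: "snd (p (j, False))" by blast
      define q where "q = p \<circ> Transposition.transpose (j, False) (j, True)"
      have "q permutes UNIV" unfolding q_def by (intro permutes_compose less.prems permutes_swap_id) auto
      moreover have "{i. snd (q (i, False))} = {i. snd (p (i, False))} - {j}"
        using j snd[of j] by (auto simp: q_def Transposition.transpose_def)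
      then have "card {i. snd (q (i, False))} < card {i. snd (p (i, False))}"
        using j by (simp only:) (intro card_Diff1_less; simp)
      ultimately show ?thesis using less.hyps[of q] flip_pair[OF less.prems, of j w] by (simp add: q_def)
    next
      case no: False
      define \<pi> where "\<pi> = (\<lambda>j. fst (p (j, False)))"
      have p_eq: "p = (\<lambda>(j, b). (\<pi> j, b))"
      proof
        fix i :: "'n \<times> bool" obtain j b where i: "i = (j, b)" by (cases i)
        show "p i = (\<lambda>(j, b). (\<pi> j, b)) i" unfolding i
          using fst[of j] snd[of j] no by (cases b) (auto simp: \<pi>_def prod_eq_iff)
      qed
      have "inj \<pi>"
      proof (rule injI)
        fix i k assume "\<pi> i = \<pi> k"
        then have "p (i, False) = p (k, False)" by (simp add: p_eq)
        then show "i = k" using permutes_inj[OF less.prems] by (auto dest: injD)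
      qed
      then have "\<pi> permutes UNIV" by (intro bij_imp_permutes) (auto simp: bij_betw_def finite_UNIV_inj_surj)
      then have "sign p = 1" using sign_lift p_eq by metis
      moreover have "\<omega> (w (p (i, False))) (w (p (i, True))) \<ge> 0" for i
        using up[of "\<pi> i"] by (simp add: p_eq w_def complex_frame_def)
      ultimately show ?thesis by (simp add: prod_nonneg)
    qed
  qed
qed

lemma pfaffian_sum_basis_pos: "pfaffian_sum \<omega> (real_basis :: 'n \<times> bool \<Rightarrow> complex^'n) > 0"
proof -
  from gram_schmidt[OF finite[of UNIV]] obtain u :: "'n \<Rightarrow> complex^'n" where
    u: "pfaffian_sum \<omega> (complex_frame u) = pfaffian_sum \<omega> (complex_frame (\<lambda>j. axis j 1)) \<and>
     (\<forall>j\<in>UNIV. \<omega> (u j) (\<i> *s u j) > 0) \<and>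
     (\<forall>j\<in>UNIV. \<forall>k. k \<noteq> j \<longrightarrow> \<omega> (u j) (u k) = 0 \<and> \<omega> (u j) (\<i> *s u k) = 0) \<and>
     (\<forall>k. k \<notin> UNIV \<longrightarrow> u k $ k = 1 \<and> (\<forall>i. i \<notin> UNIV \<longrightarrow> i \<noteq> k \<longrightarrow> u k $ i = 0))"
    by (elim exE)
  have u1: "pfaffian_sum \<omega> (complex_frame u) = pfaffian_sum \<omega> (complex_frame (\<lambda>j. axis j 1))"
    using u by (elim conjE)
  have u2: "\<omega> (u j) (\<i> *s u j) > 0" for j using u by (elim conjE) simp
  have u3: "\<omega> (u j) (u k) = 0 \<and> \<omega> (u j) (\<i> *s u k) = 0" if "k \<noteq> j" for j k
    using u that by (elim conjE) simp
  have "complex_frame (\<lambda>j. axis j 1) = (real_basis :: 'n \<times> bool \<Rightarrow> complex^'n)"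
    by (auto simp: complex_frame_def real_basis_def fun_eq_iff vec_eq_iff axis_def)
  moreover have "pfaffian_sum \<omega> (complex_frame u) > 0"
    unfolding pfaffian_sum_def
  proof (rule sum_pos2[where i = id])
    show "0 < of_int (sign id) * (\<Prod>j\<in>UNIV. \<omega> (complex_frame u (id (j, False))) (complex_frame u (id (j, True))))"
      using u2 by (auto simp: complex_frame_def intro!: prod_pos)
  qed (use orthogonal_term_nonneg[OF u2 u3] in \<open>auto simp: permutes_id finite_permutations\<close>)
  ultimately show ?thesis using u1 by simp
qed

end

section \<open>Charts and germs\<close>

locale complex_mfd =
  fixes A :: "('m::t2_space, 'n::finite) chart set"
  assumes manifold: "complex_manifold A"
begin

lemma chart_at: obtains c where "c \<in> A" "x \<in> fst c"
  using manifold unfolding complex_manifold_def by blast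

lemma chart_open: assumes "c \<in> A" shows "open (fst c)" "open (snd c ` fst c)"
  using manifold assms unfolding complex_manifold_def by blast+

lemma chart_homeo: assumes "c \<in> A" shows "homeomorphism (fst c) (snd c ` fst c) (snd c) (unchart c)"
proof -
  obtain g where g: "homeomorphism (fst c) (snd c ` fst c) (snd c) g"
    using manifold assms unfolding complex_manifold_def by blast
  have inj: "inj_on (snd c) (fst c)" using g by (metis homeomorphism_apply1 inj_on_inverseI)
  have "unchart c z = g z" if "z \<in> snd c ` fst c" for z
    using g that inj unfolding unchart_def by (auto simp: homeomorphism_apply1)
  then show ?thesis using g by (intro homeomorphism_cong[OF g]) auto
qed

lemma unchart_chart: "c \<in> A \<Longrightarrow> x \<in> fst c \<Longrightarrow> unchart c (snd c x) = x"
  using chart_homeo homeomorphism_apply1 by blast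

lemma chart_unchart: "c \<in> A \<Longrightarrow> z \<in> snd c ` fst c \<Longrightarrow> snd c (unchart c z) = z"
  using chart_homeo homeomorphism_apply2 by blast

lemma unchart_in: "c \<in> A \<Longrightarrow> z \<in> snd c ` fst c \<Longrightarrow> unchart c z \<in> fst c"
  by (auto simp: unchart_chart)

lemma continuous_chart: "c \<in> A \<Longrightarrow> continuous_on (fst c) (snd c)"
  using chart_homeo homeomorphism_cont1 by blast

lemma continuous_unchart: "c \<in> A \<Longrightarrow> continuous_on (snd c ` fst c) (unchart c)"
  using chart_homeo homeomorphism_cont2 by blast

lemma chart_image_eq: assumes "c \<in> A" "U \<subseteq> fst c"
  shows "snd c ` U = {z \<in> snd c ` fst c. unchart c z \<in> U}"
proof
  show "snd c ` U \<subseteq> {z \<in> snd c ` fst c. unchart c z \<in> U}" using assms unchart_chart[OF assms(1)] by auto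
  show "{z \<in> snd c ` fst c. unchart c z \<in> U} \<subseteq> snd c ` U"
  proof
    fix z assume z: "z \<in> {z \<in> snd c ` fst c. unchart c z \<in> U}"
    then have "z = snd c (unchart c z)" using chart_unchart[OF assms(1)] by simp
    then show "z \<in> snd c ` U" using z by blast
  qed
qed

lemma open_chart_image: assumes "c \<in> A" "open U" shows "open (snd c ` (fst c \<inter> U))"
proof -
  have "open (snd c ` fst c \<inter> unchart c -` U)"
    by (intro continuous_open_preimage continuous_unchart chart_open assms)
  moreover have "snd c ` fst c \<inter> unchart c -` U = snd c ` (fst c \<inter> U)"
    using chart_image_eq[OF assms(1), of "fst c \<inter> U"] unchart_in[OF assms(1)] by auto
  ultimately show ?thesis by simp
qed

lemma open_chart_preimage: assumes "c \<in> A" "open V" shows "open {x \<in> fst c. snd c x \<in> V}"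
proof -
  have "open (fst c \<inter> snd c -` V)" by (intro continuous_open_preimage continuous_chart chart_open assms)
  then show ?thesis by (simp add: vimage_def Int_def)
qed

lemma transition_holomorphic:
  "c \<in> A \<Longrightarrow> d \<in> A \<Longrightarrow> holomorphic_cn (\<lambda>z. snd d (unchart c z) $ i) (snd c ` (fst c \<inter> fst d))"
  using manifold unfolding complex_manifold_def by blast

lemma holo_on_chart: "holo_on A W f \<Longrightarrow> c \<in> A \<Longrightarrow> holomorphic_cn (\<lambda>z. f (unchart c z)) (snd c ` (fst c \<inter> W))"
  by (simp add: holo_on_def)

lemma holo_on_subset: "holo_on A W f \<Longrightarrow> V \<subseteq> W \<Longrightarrow> holo_on A V f"
  unfolding holo_on_def by (blast intro: holomorphic_cn_subset)

lemma holo_on_const: "holo_on A W (\<lambda>x. k)"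
  unfolding holo_on_def by (simp add: holomorphic_cn_const)

lemma holo_on_mult: "holo_on A W f \<Longrightarrow> holo_on A W g \<Longrightarrow> holo_on A W (\<lambda>x. f x * g x)"
  unfolding holo_on_def by (simp add: holomorphic_cn_mult)

lemma holo_on_add: "holo_on A W f \<Longrightarrow> holo_on A W g \<Longrightarrow> holo_on A W (\<lambda>x. f x + g x)"
  unfolding holo_on_def by (simp add: holomorphic_cn_add)

lemma holo_on_power: "holo_on A W f \<Longrightarrow> holo_on A W (\<lambda>x. f x ^ k)"
  unfolding holo_on_def by (simp add: holomorphic_cn_power)

lemma holo_on_inverse: assumes "holo_on A W f" "\<And>x. x \<in> W \<Longrightarrow> f x \<noteq> 0" shows "holo_on A W (\<lambda>x. inverse (f x))"
  unfolding holo_on_def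
proof
  fix c assume c: "c \<in> A"
  have "f (unchart c z) \<noteq> 0" if "z \<in> snd c ` (fst c \<inter> W)" for z
    using that assms(2) unchart_chart[OF c] by auto
  then show "holomorphic_cn (\<lambda>z. inverse (f (unchart c z))) (snd c ` (fst c \<inter> W))"
    by (rule holomorphic_cn_inverse[OF holo_on_chart[OF assms(1) c]])
qed

lemma holo_on_cong:
  assumes "open W" "\<And>x. x \<in> W \<Longrightarrow> f x = g x" "holo_on A W f" shows "holo_on A W g"
  unfolding holo_on_def
proof
  fix c assume c: "c \<in> A"
  have "f (unchart c z) = g (unchart c z)" if "z \<in> snd c ` (fst c \<inter> W)" for z
    using that assms(2) unchart_chart[OF c] by auto
  from holomorphic_cn_cong[where f = "\<lambda>z. f (unchart c z)" and g = "\<lambda>z. g (unchart c z)",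
      OF open_chart_image[OF c assms(1)] this]
  show "holomorphic_cn (\<lambda>z. g (unchart c z)) (snd c ` (fst c \<inter> W))"
    using holo_on_chart[OF assms(3) c] by blast
qed

lemma holo_on_continuous: assumes "open W" "holo_on A W f" shows "continuous_on W f"
proof (rule continuous_at_imp_continuous_on, rule ballI)
  fix x assume x: "x \<in> W"
  obtain c where c: "c \<in> A" "x \<in> fst c" by (rule chart_at)
  have "continuous_on (fst c \<inter> W) (snd c)" by (rule continuous_on_subset[OF continuous_chart[OF c(1)]]) simp
  from continuous_on_compose2[OF holomorphic_cn_continuous_on[OF holo_on_chart[OF assms(2) c(1)]] this order_refl]
  have "continuous_on (fst c \<inter> W) (\<lambda>y. f (unchart c (snd c y)))" .
  then have "continuous_on (fst c \<inter> W) f"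
    by (rule continuous_on_eq) (auto simp: unchart_chart[OF c(1)])
  moreover have "open (fst c \<inter> W)" using chart_open[OF c(1)] assms(1) by blast
  ultimately show "isCont f x" using x c by (simp add: continuous_on_eq_continuous_at)
qed

lemma holo_on_pullback:
  assumes c: "c \<in> A" and G: "holomorphic_cn G V"
  shows "holo_on A {x \<in> fst c. snd c x \<in> V} (\<lambda>x. G (snd c x))"
  unfolding holo_on_def
proof
  fix d assume d: "d \<in> A"
  show "holomorphic_cn (\<lambda>z. G (snd c (unchart d z))) (snd d ` (fst d \<inter> {x \<in> fst c. snd c x \<in> V}))"
  proof (rule holomorphic_cn_compose[OF G])
    show "holomorphic_cn (\<lambda>z. snd c (unchart d z) $ i) (snd d ` (fst d \<inter> {x \<in> fst c. snd c x \<in> V}))" for i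
      by (rule holomorphic_cn_subset[OF transition_holomorphic[OF d c]]) auto
  qed (use unchart_chart[OF d] in auto)
qed

text \<open>\<open>smooth_hypersurface_at\<close> asks for a nonzero differential in every chart
  around the point. By the chain rule for the transition map one chart suffices.\<close>

lemma differential_nonzero_chart_change:
  assumes c: "c \<in> A" "p \<in> fst c" and d: "d \<in> A" "p \<in> fst d" and W: "open W" "p \<in> W" "holo_on A W f"
    and nz: "frechet_derivative (\<lambda>z. f (unchart c z)) (at (snd c p)) v \<noteq> 0"
  shows "\<exists>v. frechet_derivative (\<lambda>z. f (unchart d z)) (at (snd d p)) v \<noteq> 0"
proof (rule ccontr)
  assume no: "\<not> ?thesis"
  let ?T = "snd c ` (fst c \<inter> (fst d \<inter> W))"
  have pT: "snd c p \<in> ?T" using c d W by auto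
  have oT: "open ?T" using open_chart_image[OF c(1)] chart_open[OF d(1)] W(1) by (metis open_Int)
  have tr: "holomorphic_cn (\<lambda>z. snd d (unchart c z) $ i) ?T" for i
    by (rule holomorphic_cn_subset[OF transition_holomorphic[OF c(1) d(1)]]) auto
  obtain D where D: "((\<lambda>z. snd d (unchart c z)) has_derivative D) (at (snd c p))"
    by (rule holomorphic_cn_map_derivative[of "\<lambda>z. snd d (unchart c z)", OF tr pT])
  have eq: "snd d (unchart c (snd c p)) = snd d p" by (simp add: unchart_chart[OF c])
  have "snd d p \<in> snd d ` (fst d \<inter> W)" using d W by auto
  from holomorphic_cn_derivative(1)[OF holo_on_chart[OF W(3) d(1)] this]
  have F: "((\<lambda>z. f (unchart d z)) has_derivative frechet_derivative (\<lambda>z. f (unchart d z)) (at (snd d p)))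
     (at (snd d (unchart c (snd c p))))" unfolding eq .
  have "((\<lambda>z. f (unchart d (snd d (unchart c z)))) has_derivative (\<lambda>h. 0)) (at (snd c p))"
    using has_derivative_compose[OF D F] no by simp
  then have "((\<lambda>z. f (unchart c z)) has_derivative (\<lambda>h. 0)) (at (snd c p))"
    by (rule has_derivative_transform_within_open[OF _ oT pT])
      (use unchart_chart[OF c(1)] unchart_chart[OF d(1)] in auto)
  then have "frechet_derivative (\<lambda>z. f (unchart c z)) (at (snd c p)) = (\<lambda>h. 0)"
    by (simp add: frechet_derivative_at[symmetric])
  then show False using nz by simp
qed

lemma closed_analytic_subset: assumes "analytic_subset A V" shows "closed V"
proof -
  have "\<exists>T. open T \<and> p \<in> T \<and> T \<subseteq> - V" if p: "p \<in> - V" for p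
  proof -
    obtain U F where U: "open U" "p \<in> U" "finite F" "\<forall>f\<in>F. holo_on A U f" "V \<inter> U = {x\<in>U. \<forall>f\<in>F. f x = 0}"
      using assms unfolding analytic_subset_def by meson
    obtain f where f: "f \<in> F" "f p \<noteq> 0" using U p by blast
    have "open (U \<inter> f -` (- {0}))"
      using f U by (intro continuous_open_preimage holo_on_continuous) auto
    moreover have "U \<inter> f -` (- {0}) \<subseteq> - V" using U f by blast
    ultimately show ?thesis using f U by (intro exI[of _ "U \<inter> f -` (- {0})"]) auto
  qed
  then have "open (- V)" by (subst open_subopen) blast
  then show ?thesis by (simp add: closed_def)
qed

lemma analytic_subset_Int:
  assumes "analytic_subset A V" "analytic_subset A W" shows "analytic_subset A (V \<inter> W)"
  unfolding analytic_subset_def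
proof
  fix p
  obtain U F where U: "open U" "p \<in> U" "finite F" "\<forall>f\<in>F. holo_on A U f" "V \<inter> U = {x\<in>U. \<forall>f\<in>F. f x = 0}"
    using assms(1) unfolding analytic_subset_def by meson
  obtain U' F' where U': "open U'" "p \<in> U'" "finite F'" "\<forall>f\<in>F'. holo_on A U' f" "W \<inter> U' = {x\<in>U'. \<forall>f\<in>F'. f x = 0}"
    using assms(2) unfolding analytic_subset_def by meson
  show "\<exists>U F. open U \<and> p \<in> U \<and> finite F \<and> (\<forall>f\<in>F. holo_on A U f) \<and> V \<inter> W \<inter> U = {x\<in>U. \<forall>f\<in>F. f x = 0}"
  proof (intro exI conjI)
    show "\<forall>f\<in>F \<union> F'. holo_on A (U \<inter> U') f" using U U' holo_on_subset by blast
    have "V \<inter> W \<inter> (U \<inter> U') = (V \<inter> U) \<inter> (W \<inter> U')" by blast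
    also have "\<dots> = {x \<in> U \<inter> U'. \<forall>f\<in>F \<union> F'. f x = 0}" unfolding U(5) U'(5) by blast
    finally show "V \<inter> W \<inter> (U \<inter> U') = {x \<in> U \<inter> U'. \<forall>f\<in>F \<union> F'. f x = 0}" .
  qed (use U U' in auto)
qed

end

section \<open>The scalar product of sections\<close>

locale compact_kaehler = complex_mfd A for A :: "('m::t2_space, 'n::finite) chart set" +
  fixes \<omega> :: "('m, 'n) two_form"
  assumes kaehler: "kaehler_manifold A \<omega>" and compact_space: "compact (UNIV :: 'm set)"
begin

text \<open>\<open>liouville_integral\<close> selects its cover with \<open>SOME\<close>, which
  yields a cover only because one exists. It is made from closed coordinate balls, finitely many of
  which suffice by compactness.\<close>

lemma exists_compact_chart_cover: "\<exists>cs. compact_chart_cover A cs"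
proof -
  define R where "R = (\<lambda>x c K U. c \<in> A \<and> compact K \<and> K \<subseteq> fst c \<and> open U \<and> x \<in> U \<and> U \<subseteq> K)"
  have "\<exists>c K U. R x c K U" for x
  proof -
    obtain c where c: "c \<in> A" "x \<in> fst c" by (rule chart_at)
    obtain e where e: "e > 0" "cball (snd c x) e \<subseteq> snd c ` fst c"
      using chart_open(2)[OF c(1)] c(2) open_contains_cball by blast
    let ?K = "unchart c ` cball (snd c x) e" and ?U = "{y \<in> fst c. snd c y \<in> ball (snd c x) e}"
    have "compact ?K" by (intro compact_continuous_image continuous_on_subset[OF continuous_unchart[OF c(1)] e(2)]) simp
    moreover have "?K \<subseteq> fst c" using e(2) unchart_in[OF c(1)] by blast
    moreover have "open ?U" by (rule open_chart_preimage[OF c(1) open_ball])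
    moreover have "?U \<subseteq> ?K"
    proof
      fix y assume y: "y \<in> ?U"
      then have "y = unchart c (snd c y)" using unchart_chart[OF c(1)] by simp
      then show "y \<in> ?K" using y by (intro image_eqI[of _ _ "snd c y"]) auto
    qed
    moreover have "x \<in> ?U" using c e by simp
    ultimately have "R x c ?K ?U" using c(1) unfolding R_def by blast
    then show ?thesis by blast
  qed
  then obtain c where "\<forall>x. \<exists>K U. R x (c x) K U" using choice[of "\<lambda>x c. \<exists>K U. R x c K U"] by blast
  then obtain K where "\<forall>x. \<exists>U. R x (c x) (K x) U" using choice[of "\<lambda>x K. \<exists>U. R x (c x) K U"] by blast
  then obtain U where "\<forall>x. R x (c x) (K x) (U x)" using choice[of "\<lambda>x U. R x (c x) (K x) U"] by blast
  then have cK: "\<And>x. c x \<in> A" "\<And>x. compact (K x)" "\<And>x. K x \<subseteq> fst (c x)"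
    "\<And>x. open (U x)" "\<And>x. x \<in> U x" "\<And>x. U x \<subseteq> K x" unfolding R_def by blast+
  have "UNIV \<subseteq> (\<Union>x\<in>UNIV. U x)" using cK(5) by blast
  with cK(4) obtain X where X: "finite X" "UNIV \<subseteq> (\<Union>x\<in>X. U x)"
    by (rule compactE_image[OF compact_space])
  obtain xs where xs: "set xs = X" using X(1) finite_list by blast
  have "(\<Union>x\<in>X. U x) \<subseteq> (\<Union>x\<in>X. K x)" using cK(6) by (intro UN_mono) auto
  then have "(\<Union>x\<in>X. K x) = UNIV" using X(2) by blast
  then have "compact_chart_cover A (map (\<lambda>x. (c x, K x)) xs)"
    unfolding compact_chart_cover_def using cK(1-3) by (simp add: xs image_image)
  then show ?thesis by blast
qed

definition cover :: "(('m, 'n) chart \<times> 'm set) list" where "cover = (SOME cs. compact_chart_cover A cs)"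
definition piece_chart :: "nat \<Rightarrow> ('m, 'n) chart" where "piece_chart i = fst (cover ! i)"
definition cover_set :: "nat \<Rightarrow> 'm set" where "cover_set i = snd (cover ! i)"
definition piece :: "nat \<Rightarrow> 'm set" where "piece i = cover_set i - (\<Union>j<i. cover_set j)"

lemma compact_chart_cover_cover: "compact_chart_cover A cover"
  unfolding cover_def using exists_compact_chart_cover by (rule someI_ex)

lemma cover_props:
  assumes "i < length cover"
  shows "piece_chart i \<in> A" "compact (cover_set i)" "cover_set i \<subseteq> fst (piece_chart i)"
proof -
  have "cover ! i \<in> set cover" using assms by simp
  with compact_chart_cover_cover show "piece_chart i \<in> A" "compact (cover_set i)" "cover_set i \<subseteq> fst (piece_chart i)"
    unfolding compact_chart_cover_def piece_chart_def cover_set_def by (auto simp: case_prod_beta)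
qed

lemma cover_covers: "(\<Union>i<length cover. cover_set i) = UNIV"
proof -
  have "(\<Union>(c, K)\<in>set cover. K) = UNIV" using compact_chart_cover_cover unfolding compact_chart_cover_def by blast
  then show ?thesis unfolding cover_set_def set_conv_nth by (auto simp: case_prod_beta)
qed

definition integrand :: "nat \<Rightarrow> ('m \<Rightarrow> 'b::real_vector) \<Rightarrow> complex^'n \<Rightarrow> 'b" where
  "integrand i f z = liouville_density \<omega> (piece_chart i) (unchart (piece_chart i) z) *\<^sub>R f (unchart (piece_chart i) z)"

lemma liouville_integral_eq:
  "liouville_integral A \<omega> f = (\<Sum>i<length cover. LINT z : snd (piece_chart i) ` piece i | lborel. integrand i f z)"
  unfolding liouville_integral_def Let_def integrand_def piece_def piece_chart_def cover_set_def cover_def ..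

lemma continuous_density:
  assumes c: "c \<in> A" shows "continuous_on (snd c ` fst c) (\<lambda>z. liouville_density \<omega> c (unchart c z))"
proof -
  have "two_form_on A \<omega>" using kaehler unfolding kaehler_manifold_def by blast
  then have "smooth_on (snd c ` fst c) (\<lambda>z. \<omega> c (unchart c z) u v)" for u v
    using c unfolding two_form_on_def by blast
  then have "Ck_on 0 (snd c ` fst c) (\<lambda>z. \<omega> c (unchart c z) u v)" for u v
    unfolding smooth_on_def by blast
  then have "continuous_on (snd c ` fst c) (\<lambda>z. \<omega> c (unchart c z) u v)" for u v by simp
  then show ?thesis unfolding liouville_density_def by (intro continuous_intros) auto
qed

lemma density_pos:
  assumes c: "c \<in> A" and x: "x \<in> fst c" shows "liouville_density \<omega> c x > 0"
proof -
  note k = kaehler[unfolded kaehler_manifold_def, THEN conjunct2]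
  from k[THEN conjunct2, THEN conjunct2, THEN bspec, OF c, THEN bspec, OF x]
  have K: "\<And>u v. \<omega> c x (\<i> *s u) (\<i> *s v) = \<omega> c x u v" "\<And>u. u \<noteq> 0 \<Longrightarrow> \<omega> c x u (\<i> *s u) > 0" by simp_all
  from k[THEN conjunct1, unfolded two_form_on_def, THEN conjunct1, THEN bspec, OF c, THEN bspec, OF x]
  have bl: "bilinear (\<omega> c x)" and alt: "\<forall>u v. \<omega> c x u v = - \<omega> c x v u" by (rule conjunct1, rule conjunct2)
  from bl alt[rule_format] have "pfaffian_sum (\<omega> c x) real_basis > 0"
    by (rule pfaffian_sum_basis_pos) (rule K; assumption?)+
  then show ?thesis unfolding liouville_density_def pfaffian_sum_def by simp
qed

text \<open>The chart is injective on the cover set, so the image of the piece is a difference of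
  two compact sets.\<close>

lemma piece_measurable:
  assumes i: "i < length cover" shows "snd (piece_chart i) ` piece i \<in> sets borel"
proof -
  let ?c = "piece_chart i"
  have cov: "closed (\<Union>j<i. cover_set j)"
    using i cover_props(2) by (intro closed_UN) (auto intro: compact_imp_closed)
  have inj: "inj_on (snd ?c) (cover_set i)"
    using unchart_chart[OF cover_props(1)[OF i]] cover_props(3)[OF i] by (metis inj_on_inverseI subsetD)
  have cK: "continuous_on (cover_set i) (snd ?c)"
    by (rule continuous_on_subset[OF continuous_chart[OF cover_props(1)[OF i]] cover_props(3)[OF i]])
  have "compact (snd ?c ` cover_set i)" by (rule compact_continuous_image[OF cK cover_props(2)[OF i]])
  moreover have "compact (snd ?c ` (cover_set i \<inter> (\<Union>j<i. cover_set j)))"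
    by (rule compact_continuous_image[OF continuous_on_subset[OF cK] compact_Int_closed[OF cover_props(2)[OF i] cov]]) simp
  moreover have "snd ?c ` piece i = snd ?c ` cover_set i - snd ?c ` (cover_set i \<inter> (\<Union>j<i. cover_set j))"
    unfolding piece_def using inj by (auto simp: inj_on_def)
  ultimately show ?thesis by (simp add: compact_imp_closed borel_closed sets.Diff)
qed

lemma integrand_integrable:
  fixes f :: "'m \<Rightarrow> 'b::{banach, second_countable_topology}"
  assumes i: "i < length cover" and f: "continuous_on UNIV f"
  shows "set_integrable lborel (snd (piece_chart i) ` piece i) (integrand i f)"
proof (rule set_integrable_subset)
  let ?c = "piece_chart i"
  note c = cover_props[OF i]
  have sub: "snd ?c ` cover_set i \<subseteq> snd ?c ` fst ?c" using c(3) by blast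
  have "continuous_on (snd ?c ` fst ?c) (integrand i f)"
    unfolding integrand_def[abs_def]
    by (intro continuous_on_scaleR continuous_density c(1) continuous_on_compose2[OF f continuous_unchart]) auto
  then show "set_integrable lborel (snd ?c ` cover_set i) (integrand i f)"
    unfolding set_integrable_def
    by (intro borel_integrable_compact compact_continuous_image[OF continuous_on_subset[OF continuous_chart[OF c(1)] c(3)] c(2)]
        continuous_on_subset[OF _ sub])
  show "snd ?c ` piece i \<in> sets lborel" using piece_measurable[OF i] by simp
  show "snd ?c ` piece i \<subseteq> snd ?c ` cover_set i" unfolding piece_def by blast
qed

lemma liouville_integral_add:
  assumes "continuous_on UNIV f" "continuous_on UNIV g"
  shows "liouville_integral A \<omega> (\<lambda>x. f x + g x) = liouville_integral A \<omega> f + liouville_integral A \<omega> g"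
  unfolding liouville_integral_eq sum.distrib[symmetric]
proof (rule sum.cong[OF refl])
  fix i assume "i \<in> {..<length cover}"
  then have i: "i < length cover" by simp
  have "integrand i (\<lambda>x. f x + g x) z = integrand i f z + integrand i g z" for z
    by (simp add: integrand_def scaleR_add_right)
  then show "(LINT z : snd (piece_chart i) ` piece i | lborel. integrand i (\<lambda>x. f x + g x) z) =
    (LINT z : snd (piece_chart i) ` piece i | lborel. integrand i f z) + (LINT z : snd (piece_chart i) ` piece i | lborel. integrand i g z)"
    by (simp add: set_integral_add(2)[OF integrand_integrable[OF i assms(1)] integrand_integrable[OF i assms(2)]])
qed

lemma liouville_integral_cmult: "liouville_integral A \<omega> (\<lambda>x. a * f x) = a * liouville_integral A \<omega> f"
proof -
  have "integrand i (\<lambda>x. a * f x) = (\<lambda>z. a * integrand i f z)" for i by (simp add: integrand_def fun_eq_iff)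
  then show ?thesis unfolding liouville_integral_eq sum_distrib_left by simp
qed

lemma liouville_integral_cnj: "liouville_integral A \<omega> (\<lambda>x. cnj (f x)) = cnj (liouville_integral A \<omega> f)"
proof -
  have "integrand i (\<lambda>x. cnj (f x)) = (\<lambda>z. cnj (integrand i f z))" for i by (simp add: integrand_def fun_eq_iff)
  moreover have "(LINT z : S | lborel. cnj (F z)) = cnj (LINT z : S | lborel. F z)" for S and F :: "complex^'n \<Rightarrow> complex"
  proof -
    have "(LINT z : S | lborel. cnj (F z)) = integral\<^sup>L lborel (\<lambda>z. cnj (indicator S z *\<^sub>R F z))"
      unfolding set_lebesgue_integral_def by simp
    then show ?thesis by (simp only: Bochner_Integration.integral_cnj set_lebesgue_integral_def)
  qed
  ultimately show ?thesis unfolding liouville_integral_eq by simp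
qed

text \<open>Take the least \<open>j\<close> such that the first \<open>j\<close> cover sets together
  contain a nonempty open subset \<open>V\<close> of \<open>U\<close>. Removing from
  \<open>V\<close> the closed union of all but the last of them leaves an open part of a single
  piece, and it is nonempty by minimality.\<close>

lemma open_meets_piece:
  assumes "open U" "U \<noteq> {}"
  obtains i V where "i < length cover" "open V" "V \<noteq> {}" "V \<subseteq> U" "V \<subseteq> piece i"
proof -
  define P where "P = (\<lambda>j. \<exists>V. open V \<and> V \<noteq> {} \<and> V \<subseteq> U \<and> V \<subseteq> (\<Union>i<j. cover_set i))"
  have "P (length cover)" unfolding P_def cover_covers using assms by blast
  define j where "j = (LEAST j. P j)"
  have j: "P j" "j \<le> length cover" unfolding j_def using \<open>P (length cover)\<close> by (auto intro: LeastI Least_le)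
  have "\<not> P 0" unfolding P_def by simp
  then obtain i where i: "j = Suc i" using j by (cases j) auto
  then have "\<not> P i" using not_less_Least[of i P] unfolding j_def by simp
  from j(1) obtain V where V: "open V" "V \<noteq> {}" "V \<subseteq> U" "V \<subseteq> (\<Union>i<j. cover_set i)" unfolding P_def by blast
  let ?V = "V - (\<Union>k<i. cover_set k)"
  have "closed (\<Union>k<i. cover_set k)" using i j(2) cover_props(2) by (intro closed_UN) (auto intro: compact_imp_closed)
  then have "open ?V" using V(1) by (simp add: open_Diff)
  moreover have "?V \<noteq> {}" using \<open>\<not> P i\<close> V unfolding P_def by blast
  moreover have "?V \<subseteq> piece i" using V(4) unfolding i piece_def lessThan_Suc by auto
  ultimately show ?thesis using that[of i ?V] i j(2) V(3) by auto
qed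

text \<open>All summands are nonnegative because the density is positive. The open set where
  \<open>g\<close> is positive contains a nonempty open part of some piece; its coordinate image is
  open, hence not negligible, and the integrand is positive there.\<close>

lemma liouville_integral_pos:
  fixes g :: "'m \<Rightarrow> real"
  assumes g: "continuous_on UNIV g" "\<And>x. g x \<ge> 0" and x: "g x > 0"
  shows "liouville_integral A \<omega> (\<lambda>x. of_real (g x)) \<noteq> 0"
proof -
  let ?S = "\<lambda>i. snd (piece_chart i) ` piece i"
  have nonneg: "indicator (?S i) z *\<^sub>R integrand i g z \<ge> 0" if i: "i < length cover" for i z
  proof (cases "z \<in> ?S i")
    case True
    then have "z \<in> snd (piece_chart i) ` fst (piece_chart i)" using cover_props(3)[OF i] unfolding piece_def by blast
    then show ?thesis using density_pos[OF cover_props(1)[OF i] unchart_in[OF cover_props(1)[OF i]]] g(2)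
      by (simp add: integrand_def less_imp_le)
  qed simp
  have "open (g -` {0<..})" using g(1) by (simp add: continuous_on_open_vimage)
  moreover have "g -` {0<..} \<noteq> {}" using x by auto
  ultimately obtain i V where i: "i < length cover" and V: "open V" "V \<noteq> {}" "V \<subseteq> g -` {0<..}" "V \<subseteq> piece i"
    by (rule open_meets_piece)
  note c = cover_props[OF i]
  have pos: "(LINT z : ?S i | lborel. integrand i g z) \<noteq> 0"
  proof
    assume 0: "(LINT z : ?S i | lborel. integrand i g z) = 0"
    have int: "integrable lborel (\<lambda>z. indicator (?S i) z *\<^sub>R integrand i g z)"
      using integrand_integrable[OF i g(1)] unfolding set_integrable_def .
    have "AE z in lborel. indicator (?S i) z *\<^sub>R integrand i g z = 0"
      using 0 integral_nonneg_eq_0_iff_AE[OF int] nonneg[OF i] unfolding set_lebesgue_integral_def by auto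
    then obtain N where N: "{z. indicator (?S i) z *\<^sub>R integrand i g z \<noteq> 0} \<subseteq> N" "N \<in> null_sets lborel"
      by (auto elim!: AE_E simp: null_sets_def)
    have Vf: "V \<subseteq> fst (piece_chart i)" using V(4) c(3) unfolding piece_def by blast
    have "snd (piece_chart i) ` V \<subseteq> N"
    proof
      fix z assume "z \<in> snd (piece_chart i) ` V"
      then obtain y where y: "y \<in> V" "z = snd (piece_chart i) y" by blast
      have uy: "unchart (piece_chart i) z = y" using y Vf unchart_chart[OF c(1)] by auto
      have "z \<in> ?S i" using y V(4) by blast
      moreover have "integrand i g z > 0"
        unfolding integrand_def uy real_scaleR_def
        by (rule mult_pos_pos[OF density_pos[OF c(1)]]) (use y(1) Vf V(3) in auto)
      ultimately show "z \<in> N" using N(1) by auto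
    qed
    moreover have "open (snd (piece_chart i) ` V)"
      using open_chart_image[OF c(1) V(1)] Vf by (simp add: Int_absorb1)
    moreover have "negligible N" using N(2) null_sets_completionI negligible_iff_null_sets by blast
    ultimately show False using V(2) open_not_negligible negligible_subset by blast
  qed
  have eq: "liouville_integral A \<omega> (\<lambda>x. of_real (g x)) = of_real (\<Sum>i<length cover. LINT z : ?S i | lborel. integrand i g z)"
  proof -
    have "integrand i (\<lambda>x. complex_of_real (g x)) = (\<lambda>z. of_real (integrand i g z))" for i
      by (simp add: integrand_def scaleR_conv_of_real fun_eq_iff)
    then show ?thesis unfolding liouville_integral_eq by (simp add: set_integral_complex_of_real)
  qed
  have "(\<Sum>i<length cover. LINT z : ?S i | lborel. integrand i g z) > 0"
  proof (rule sum_pos2[of _ i])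
    have ge: "0 \<le> (LINT z : ?S j | lborel. integrand j g z)" if "j < length cover" for j
      unfolding set_lebesgue_integral_def by (rule Bochner_Integration.integral_nonneg) (rule nonneg[OF that])
    then show "0 \<le> (LINT z : ?S j | lborel. integrand j g z)" if "j \<in> {..<length cover}" for j using that by simp
    show "0 < (LINT z : ?S i | lborel. integrand i g z)" using pos ge[OF i] by (simp only: less_le) simp
  qed (use i in auto)
  then have "(\<Sum>i<length cover. LINT z : ?S i | lborel. integrand i g z) \<noteq> 0" by (rule less_imp_neq[THEN not_sym])
  then show ?thesis unfolding eq of_real_eq_0_iff .
qed

end

text \<open>The hypothesis excludes, for each leading block, a left null vector with last entry 1.
  It is inherited by smaller systems, so one equation can be added at a time; for Gram matrices it
  expresses definiteness and linear independence.\<close>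

lemma gram_system_solvable:
  fixes G :: "nat \<Rightarrow> nat \<Rightarrow> complex"
  assumes "\<And>k w. k < n \<Longrightarrow> (\<forall>j\<le>k. (\<Sum>i\<le>k. w i * G i j) = 0) \<Longrightarrow> w k \<noteq> 1"
  shows "\<exists>b. \<forall>j<n. (\<Sum>i<n. b i * G i j) = l j"
  using assms
proof (induction n arbitrary: l)
  case (Suc n)
  have IH: "\<exists>b. \<forall>j<n. (\<Sum>i<n. b i * G i j) = l j" for l
    by (rule Suc.IH) (rule Suc.prems[OF less_SucI])
  obtain b where b: "\<And>j. j < n \<Longrightarrow> (\<Sum>i<n. b i * G i j) = l j" using IH by blast
  obtain c where c: "\<And>j. j < n \<Longrightarrow> (\<Sum>i<n. c i * G i j) = G n j" using IH[of "\<lambda>j. G n j"] by blast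
  \<comment> \<open>The last row minus the combination of earlier rows that agrees with it in the
    columns before \<open>n\<close>. What remains is the single entry \<open>g\<close> in column
    \<open>n\<close>, the pivot, so a multiple of \<open>w\<close> corrects equation
    \<open>n\<close> without disturbing the others.\<close>
  define w where "w = (\<lambda>i. if i < n then - c i else 1)"
  have "(\<Sum>i<n. w i * G i j) = - (\<Sum>i<n. c i * G i j)" for j
    unfolding sum_negf[symmetric] by (rule sum.cong) (simp_all add: w_def)
  then have w: "(\<Sum>i<Suc n. w i * G i j) = G n j - (\<Sum>i<n. c i * G i j)" for j
    by (simp add: w_def)
  define g where "g = (\<Sum>i<Suc n. w i * G i n)"
  have "g \<noteq> 0"
  proof
    assume "g = 0"
    have "(\<Sum>i\<le>n. w i * G i j) = 0" if "j \<le> n" for j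
    proof (cases "j = n")
      case True
      then show ?thesis using \<open>g = 0\<close> by (simp only: g_def lessThan_Suc_atMost)
    next
      case False
      then have "j < n" using that by simp
      then show ?thesis using w[of j] c[of j] by (simp only: lessThan_Suc_atMost diff_self)
    qed
    then show False using Suc.prems[of n w] by (simp add: w_def)
  qed
  define \<beta> where "\<beta> = (l n - (\<Sum>i<n. b i * G i n)) / g"
  define b' where "b' = (\<lambda>i. (if i < n then b i else 0) + \<beta> * w i)"
  have b': "(\<Sum>i<Suc n. b' i * G i j) = (\<Sum>i<n. b i * G i j) + \<beta> * (\<Sum>i<Suc n. w i * G i j)" for j
  proof -
    have "(\<Sum>i<Suc n. b' i * G i j) = (\<Sum>i<Suc n. (if i < n then b i else 0) * G i j) + (\<Sum>i<Suc n. \<beta> * (w i * G i j))"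
      unfolding sum.distrib[symmetric] by (rule sum.cong) (simp_all add: b'_def distrib_right mult.assoc)
    also have "(\<Sum>i<Suc n. (if i < n then b i else 0) * G i j) = (\<Sum>i<n. b i * G i j)"
      unfolding sum.lessThan_Suc by simp
    finally show ?thesis by (simp only: sum_distrib_left)
  qed
  have "(\<Sum>i<Suc n. b' i * G i j) = l j" if "j < Suc n" for j
  proof (cases "j = n")
    case True
    then show ?thesis unfolding b' True g_def[symmetric] using \<open>g \<noteq> 0\<close> by (simp add: \<beta>_def)
  next
    case False
    then have "j < n" using that by simp
    then show ?thesis unfolding b' using b[of j] w[of j] c[of j] by (simp only: diff_self mult_zero_right add_0_right)
  qed
  then show ?case by blast
qed simp

section \<open>Sections of the quantum line bundle and coherent vectors\<close>

locale quantized = compact_kaehler A \<omega>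
  for A :: "('m::t2_space, 'n::finite) chart set" and \<omega> +
  fixes L :: "('m, 'l) line_bundle" and h :: "'l \<Rightarrow> 'l \<Rightarrow> complex"
  assumes quantum: "quantum_line_bundle A \<omega> L h" and ample: "very_ample A L"
    and connected_space: "connected (UNIV :: 'm set)"
begin

lemmas bundle_facts = quantum[unfolded quantum_line_bundle_def, THEN conjunct1, unfolded holomorphic_line_bundle_def]
lemmas metric_facts = quantum[unfolded quantum_line_bundle_def, THEN conjunct2, THEN conjunct1, unfolded hermitian_metric_def]

lemma triv_at: obtains U \<tau> where "(U, \<tau>) \<in> trivs L" "x \<in> U"
proof -
  have "x \<in> (\<Union>t\<in>trivs L. fst t)" using bundle_facts[THEN conjunct1] by simp
  then show ?thesis using that by auto
qed

lemma proj_fadd: "proj L q = proj L q' \<Longrightarrow> proj L (fadd L q q') = proj L q"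
  using bundle_facts[THEN conjunct2, THEN conjunct1] by simp

lemma proj_fscale: "proj L (fscale L a q) = proj L q"
  using bundle_facts[THEN conjunct2, THEN conjunct2, THEN conjunct1] by simp

lemma triv_props:
  assumes "(U, \<tau>) \<in> trivs L"
  shows "open U" "\<And>x. x \<in> U \<Longrightarrow> bij_betw \<tau> {q. proj L q = x} UNIV"
    "\<And>q q'. proj L q \<in> U \<Longrightarrow> proj L q' = proj L q \<Longrightarrow> \<tau> (fadd L q q') = \<tau> q + \<tau> q'"
    "\<And>a q. proj L q \<in> U \<Longrightarrow> \<tau> (fscale L a q) = a * \<tau> q"
  using bundle_facts[THEN conjunct2, THEN conjunct2, THEN conjunct2, THEN conjunct1, THEN bspec, OF assms]
  by simp_all

lemma triv_transition:
  assumes "(U, \<tau>) \<in> trivs L" "(U', \<tau>') \<in> trivs L"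
  obtains g where "holo_on A (U \<inter> U') g" "\<And>q. proj L q \<in> U \<Longrightarrow> proj L q \<in> U' \<Longrightarrow> g (proj L q) \<noteq> 0 \<and> \<tau>' q = g (proj L q) * \<tau> q"
proof -
  have "\<exists>g. holo_on A (U \<inter> U') g \<and> (\<forall>q. proj L q \<in> U \<inter> U' \<longrightarrow> g (proj L q) \<noteq> 0 \<and> \<tau>' q = g (proj L q) * \<tau> q)"
    using bundle_facts[THEN conjunct2, THEN conjunct2, THEN conjunct2, THEN conjunct2, THEN bspec, OF assms(1)] assms(2)
    by (auto dest!: bspec)
  then show ?thesis using that by auto
qed

lemma triv_inj:
  assumes "(U, \<tau>) \<in> trivs L" "proj L q \<in> U" "proj L q' = proj L q" "\<tau> q = \<tau> q'" shows "q = q'"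
  using triv_props(2)[OF assms(1,2)] assms(3,4) by (auto simp: bij_betw_def inj_on_def)

lemma triv_surj:
  assumes "(U, \<tau>) \<in> trivs L" "x \<in> U" obtains q where "proj L q = x" "\<tau> q = a"
proof -
  have "a \<in> \<tau> ` {q. proj L q = x}" using triv_props(2)[OF assms] by (simp add: bij_betw_def)
  then show ?thesis using that by auto
qed

lemma nonzero_iff:
  assumes "(U, \<tau>) \<in> trivs L" "proj L q \<in> U" shows "q \<in> nonzero_vectors L \<longleftrightarrow> \<tau> q \<noteq> 0"
proof -
  have "q = fscale L 0 q \<longleftrightarrow> \<tau> q = \<tau> (fscale L 0 q)"
    using triv_inj[OF assms(1,2) proj_fscale] by auto
  then show ?thesis using triv_props(4)[OF assms] by (simp add: nonzero_vectors_def)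
qed

lemma triv_frame_props:
  assumes "(U, \<tau>) \<in> trivs L" "x \<in> U"
  shows "proj L (triv_frame L \<tau> x) = x" "\<tau> (triv_frame L \<tau> x) = 1"
proof -
  obtain q where q: "proj L q = x" "\<tau> q = 1" by (rule triv_surj[OF assms])
  have "\<exists>!q. proj L q = x \<and> \<tau> q = 1"
  proof (rule ex1I[of _ q])
    fix q' assume "proj L q' = x \<and> \<tau> q' = 1"
    then show "q' = q" using triv_inj[OF assms(1), of q' q] q assms(2) by auto
  qed (use q in simp)
  from theI'[OF this] show "proj L (triv_frame L \<tau> x) = x" "\<tau> (triv_frame L \<tau> x) = 1"
    unfolding triv_frame_def by auto
qed

abbreviation sections where "sections \<equiv> global_sections A L"

lemma section_proj: "s \<in> sections \<Longrightarrow> proj L (s x) = x"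
  unfolding global_sections_def holo_section_on_def by simp

lemma section_holo: assumes "s \<in> sections" "(U, \<tau>) \<in> trivs L" shows "holo_on A U (\<lambda>x. \<tau> (s x))"
proof -
  have "\<forall>(U, \<tau>)\<in>trivs L. holo_on A (U \<inter> UNIV) (\<lambda>x. \<tau> (s x))"
    using assms(1) unfolding global_sections_def holo_section_on_def by simp
  from bspec[OF this assms(2)] show ?thesis by simp
qed

lemma sectionI:
  assumes "\<And>x. proj L (s x) = x" "\<And>U \<tau>. (U, \<tau>) \<in> trivs L \<Longrightarrow> holo_on A U (\<lambda>x. \<tau> (s x))"
  shows "s \<in> sections"
  unfolding global_sections_def holo_section_on_def using assms by auto

lemma section_add: assumes "s \<in> sections" "t \<in> sections" shows "(\<lambda>x. fadd L (s x) (t x)) \<in> sections"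
proof (rule sectionI)
  show "proj L (fadd L (s x) (t x)) = x" for x using assms by (simp add: proj_fadd section_proj)
  fix U \<tau> assume \<tau>: "(U, \<tau>) \<in> trivs L"
  show "holo_on A U (\<lambda>x. \<tau> (fadd L (s x) (t x)))"
    by (rule holo_on_cong[OF triv_props(1)[OF \<tau>] _ holo_on_add[OF section_holo[OF assms(1) \<tau>] section_holo[OF assms(2) \<tau>]]])
      (use assms in \<open>simp add: triv_props(3)[OF \<tau>] section_proj\<close>)
qed

lemma section_scale: assumes "s \<in> sections" shows "(\<lambda>x. fscale L a (s x)) \<in> sections"
proof (rule sectionI)
  show "proj L (fscale L a (s x)) = x" for x using assms by (simp add: proj_fscale section_proj)
  fix U \<tau> assume \<tau>: "(U, \<tau>) \<in> trivs L"
  show "holo_on A U (\<lambda>x. \<tau> (fscale L a (s x)))"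
    by (rule holo_on_cong[OF triv_props(1)[OF \<tau>] _ holo_on_mult[OF holo_on_const[of U a] section_holo[OF assms(1) \<tau>]]])
      (use assms in \<open>simp add: triv_props(4)[OF \<tau>] section_proj\<close>)
qed

lemma lincomb_section: "(\<And>i. i \<le> k \<Longrightarrow> s i \<in> sections) \<Longrightarrow> lincomb L a s k \<in> sections"
proof (induction k)
  case (Suc k)
  have "lincomb L a s k \<in> sections" by (rule Suc.IH) (rule Suc.prems, simp)
  then show ?case unfolding lincomb.simps by (intro section_add section_scale Suc.prems) auto
qed (simp add: section_scale)

lemma lincomb_triv:
  assumes "(U, \<tau>) \<in> trivs L" "x \<in> U"
  shows "(\<And>i. i \<le> k \<Longrightarrow> s i \<in> sections) \<Longrightarrow> \<tau> (lincomb L a s k x) = (\<Sum>i\<le>k. a i * \<tau> (s i x))"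
proof (induction k)
  case 0
  then show ?case using assms by (simp add: triv_props(4)[OF assms(1)] section_proj)
next
  case (Suc k)
  then have "proj L (lincomb L a s k x) = x" "proj L (s (Suc k) x) = x" using lincomb_section section_proj by auto
  then show ?case using Suc assms by (simp add: triv_props(3,4)[OF assms(1)] proj_fscale)
qed

lemma qhat_eq:
  assumes q: "q \<in> nonzero_vectors L" and s: "s \<in> sections" and \<tau>: "(U, \<tau>) \<in> trivs L" "proj L q \<in> U"
  shows "qhat L q s = \<tau> (s (proj L q)) / \<tau> q"
proof -
  have nz: "\<tau> q \<noteq> 0" using nonzero_iff[OF \<tau>] q by simp
  show ?thesis unfolding qhat_def
  proof (rule the_equality)
    show "s (proj L q) = fscale L (\<tau> (s (proj L q)) / \<tau> q) q"
      by (rule triv_inj[OF \<tau>(1)]) (use \<tau> nz s in \<open>auto simp: section_proj proj_fscale triv_props(4)[OF \<tau>(1)]\<close>)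
  next
    fix a assume "s (proj L q) = fscale L a q"
    then have "\<tau> (s (proj L q)) = a * \<tau> q" using triv_props(4)[OF \<tau>(1)] \<tau>(2) by simp
    then show "a = \<tau> (s (proj L q)) / \<tau> q" using nz by simp
  qed
qed

lemma metric_fibre:
  assumes "proj L p = proj L q" "proj L q = proj L r"
  shows "h p (fadd L q r) = h p q + h p r \<and> (\<forall>a. h p (fscale L a q) = a * h p q) \<and> h q p = cnj (h p q)"
  by (rule metric_facts[THEN conjunct1, THEN spec[of _ p], THEN spec[of _ q], THEN spec[of _ r], THEN mp, THEN mp, OF assms])

lemma h_add: "proj L p = proj L q \<Longrightarrow> proj L q = proj L r \<Longrightarrow> h p (fadd L q r) = h p q + h p r"
  by (rule metric_fibre[THEN conjunct1])

lemma h_scale: "proj L p = proj L q \<Longrightarrow> h p (fscale L a q) = a * h p q"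
  by (rule metric_fibre[OF _ refl, THEN conjunct2, THEN conjunct1, THEN spec])

lemma h_cnj: "proj L p = proj L q \<Longrightarrow> h q p = cnj (h p q)"
  by (rule metric_fibre[OF _ refl, THEN conjunct2, THEN conjunct2])

lemma h_pos: "q \<in> nonzero_vectors L \<Longrightarrow> Re (h q q) > 0"
  by (rule metric_facts[THEN conjunct2, THEN conjunct1, THEN bspec])

lemma h_self: "h q q = of_real (Re (h q q))"
  using arg_cong[OF h_cnj[OF refl, of q], of Im] by (simp add: complex_eq_iff)

lemma h_triv:
  assumes \<tau>: "(U, \<tau>) \<in> trivs L" and "proj L p \<in> U" "proj L q = proj L p"
  shows "h p q = cnj (\<tau> p) * \<tau> q * h (triv_frame L \<tau> (proj L p)) (triv_frame L \<tau> (proj L p))"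
proof -
  let ?f = "triv_frame L \<tau> (proj L p)"
  note f = triv_frame_props[OF \<tau> assms(2)]
  have e: "r = fscale L (\<tau> r) ?f" if "proj L r = proj L p" for r
    by (rule triv_inj[OF \<tau>]) (use that f assms in \<open>auto simp: proj_fscale triv_props(4)[OF \<tau>]\<close>)
  have "h p q = \<tau> q * h p ?f" using e[OF assms(3)] h_scale[of p ?f "\<tau> q"] f(1) by simp
  also have "h p ?f = cnj (h ?f p)" by (rule h_cnj) (simp add: f)
  also have "h ?f p = \<tau> p * h ?f ?f" using e[of p] h_scale[of ?f ?f "\<tau> p"] f(1) by simp
  also have "cnj (\<tau> p * h ?f ?f) = cnj (\<tau> p) * h ?f ?f" by (simp only: complex_cnj_mult h_cnj[OF refl, symmetric])
  finally show ?thesis by (simp add: mult_ac)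
qed

text \<open>Smoothness of the metric is only stated for the local functions
  \<open>h(\<sigma>, \<sigma>)\<close>. In a trivialization every pairing is such a function times
  the coefficients of the two sections, the first one conjugated.\<close>

lemma continuous_pairing:
  assumes s: "s \<in> sections" and t: "t \<in> sections" shows "continuous_on UNIV (\<lambda>x. h (s x) (t x))"
proof (rule continuous_at_imp_continuous_on, rule ballI)
  fix x
  obtain U \<tau> where \<tau>: "(U, \<tau>) \<in> trivs L" "x \<in> U" by (rule triv_at)
  obtain c where c: "c \<in> A" "x \<in> fst c" by (rule chart_at)
  let ?W = "fst c \<inter> U"
  have W: "open ?W" by (intro open_Int chart_open(1)[OF c(1)] triv_props(1)[OF \<tau>(1)])
  have "smooth_on (snd c ` (fst c \<inter> U)) (local_metric L h c \<tau>)"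
    using metric_facts[THEN conjunct2, THEN conjunct2, THEN bspec, OF c(1), THEN bspec, OF \<tau>(1)] by simp
  then have "Ck_on 0 (snd c ` (fst c \<inter> U)) (local_metric L h c \<tau>)" unfolding smooth_on_def by blast
  then have "continuous_on (snd c ` ?W) (local_metric L h c \<tau>)" by simp
  moreover have "continuous_on ?W (snd c)" by (rule continuous_on_subset[OF continuous_chart[OF c(1)]]) simp
  ultimately have "continuous_on ?W (\<lambda>y. local_metric L h c \<tau> (snd c y))"
    by (rule continuous_on_compose2) simp
  moreover have "continuous_on ?W (\<lambda>y. \<tau> (s y))" "continuous_on ?W (\<lambda>y. \<tau> (t y))"
    using holo_on_continuous[OF triv_props(1)[OF \<tau>(1)] section_holo[OF s \<tau>(1)]]
      holo_on_continuous[OF triv_props(1)[OF \<tau>(1)] section_holo[OF t \<tau>(1)]] by (auto intro: continuous_on_subset)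
  ultimately have "continuous_on ?W (\<lambda>y. cnj (\<tau> (s y)) * \<tau> (t y) * of_real (local_metric L h c \<tau> (snd c y)))"
    by (intro continuous_intros)
  then have "continuous_on ?W (\<lambda>x. h (s x) (t x))"
  proof (rule continuous_on_eq)
    fix y assume y: "y \<in> ?W"
    have "h (triv_frame L \<tau> y) (triv_frame L \<tau> y) = of_real (local_metric L h c \<tau> (snd c y))"
      unfolding local_metric_def using y unchart_chart[OF c(1), of y] by (simp only: h_self[symmetric] IntD1)
    then show "cnj (\<tau> (s y)) * \<tau> (t y) * of_real (local_metric L h c \<tau> (snd c y)) = h (s y) (t y)"
      using h_triv[OF \<tau>(1), of "s y" "t y"] y s t by (simp add: section_proj)
  qed
  then show "isCont (\<lambda>x. h (s x) (t x)) x" using W \<tau> c by (simp add: continuous_on_eq_continuous_at)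
qed

abbreviation inner_sec where "inner_sec \<equiv> section_inner A \<omega> h"

lemma inner_add: "s \<in> sections \<Longrightarrow> t \<in> sections \<Longrightarrow> t' \<in> sections \<Longrightarrow>
    inner_sec s (\<lambda>x. fadd L (t x) (t' x)) = inner_sec s t + inner_sec s t'"
  unfolding section_inner_def
  by (simp add: h_add section_proj liouville_integral_add continuous_pairing)

lemma inner_scale: "s \<in> sections \<Longrightarrow> t \<in> sections \<Longrightarrow> inner_sec s (\<lambda>x. fscale L a (t x)) = a * inner_sec s t"
  unfolding section_inner_def by (simp add: h_scale section_proj liouville_integral_cmult)

lemma inner_cnj: assumes "s \<in> sections" "t \<in> sections" shows "inner_sec t s = cnj (inner_sec s t)"
proof -
  have "(\<lambda>x. h (t x) (s x)) = (\<lambda>x. cnj (h (s x) (t x)))"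
    by (rule ext, rule h_cnj) (simp add: section_proj assms)
  then show ?thesis unfolding section_inner_def by (simp add: liouville_integral_cnj)
qed

lemma inner_self_zero:
  assumes s: "s \<in> sections" and 0: "inner_sec s s = 0" shows "s x \<notin> nonzero_vectors L"
proof
  assume x: "s x \<in> nonzero_vectors L"
  have nn: "Re (h (s y) (s y)) \<ge> 0" for y
  proof (cases "s y \<in> nonzero_vectors L")
    case False
    then have "s y = fscale L 0 (s y)" by (simp add: nonzero_vectors_def)
    then have "h (s y) (s y) = 0 * h (s y) (s y)" using h_scale[OF refl, of "s y" 0] by (simp only:)
    then show ?thesis by simp
  qed (use h_pos in \<open>simp add: less_imp_le\<close>)
  have "continuous_on UNIV (\<lambda>y. Re (h (s y) (s y)))" using continuous_pairing[OF s s] by (intro continuous_intros)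
  from liouville_integral_pos[OF this nn h_pos[OF x]]
  have "liouville_integral A \<omega> (\<lambda>y. of_real (Re (h (s y) (s y)))) \<noteq> 0" .
  then show False using 0 unfolding section_inner_def h_self[symmetric] by (rule notE)
qed

lemma inner_lincomb:
  assumes "e \<in> sections"
  shows "(\<And>i. i \<le> k \<Longrightarrow> s i \<in> sections) \<Longrightarrow> inner_sec e (lincomb L a s k) = (\<Sum>i\<le>k. a i * inner_sec e (s i))"
proof (induction k)
  case 0
  then show ?case using assms by (simp add: inner_scale)
next
  case (Suc k)
  then show ?case using assms by (simp add: inner_add inner_scale lincomb_section section_scale)
qed

lemma section_eqI:
  assumes "s \<in> sections" "t \<in> sections" "\<And>U \<tau> x. (U, \<tau>) \<in> trivs L \<Longrightarrow> x \<in> U \<Longrightarrow> \<tau> (s x) = \<tau> (t x)"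
  shows "s = t"
proof
  fix x
  obtain U \<tau> where \<tau>: "(U, \<tau>) \<in> trivs L" "x \<in> U" by (rule triv_at)
  show "s x = t x" by (rule triv_inj[OF \<tau>(1)]) (use assms \<tau> in \<open>auto simp: section_proj\<close>)
qed

text \<open>The Riesz representation in a basis of sections: the conjugated coefficients of
  \<open>e\<close> solve the Gram system with right-hand sides \<open>qhat L q (s j)\<close>. A null
  vector of a leading block would give a section of norm zero, which vanishes by
  definiteness.\<close>

lemma coherent_exists:
  assumes q: "q \<in> nonzero_vectors L"
  shows "\<exists>e\<in>sections. \<forall>s\<in>sections. inner_sec e s = qhat L q s"
proof -
  obtain N s where basis: "section_basis A L N s" using ample unfolding very_ample_def by blast
  note b = basis[unfolded section_basis_def]
  have s: "s i \<in> sections" if "i \<le> N" for i using b[THEN conjunct1] that by simp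
  have span: "\<exists>a. t = lincomb L a s N" if "t \<in> sections" for t
    using b[THEN conjunct2, THEN conjunct1] that by simp
  have indep: "a i = a' i" if "lincomb L a s N = lincomb L a' s N" "i \<le> N" for a a' i
    using b[THEN conjunct2, THEN conjunct2] that by blast
  have lsec: "lincomb L a s N \<in> sections" for a by (rule lincomb_section) (rule s)
  have lin: "inner_sec e (lincomb L a s N) = (\<Sum>i\<le>N. a i * inner_sec e (s i))" if "e \<in> sections" for e a
    by (rule inner_lincomb[OF that]) (rule s)
  have ltriv: "\<tau> (lincomb L a s N x) = (\<Sum>i\<le>N. a i * \<tau> (s i x))" if "(U, \<tau>) \<in> trivs L" "x \<in> U" for U \<tau> x a
    by (rule lincomb_triv[OF that]) (rule s)
  have left: "inner_sec (lincomb L a s N) (s j) = (\<Sum>i\<le>N. cnj (a i) * inner_sec (s i) (s j))" if "j \<le> N" for a j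
  proof -
    have "inner_sec (lincomb L a s N) (s j) = cnj (inner_sec (s j) (lincomb L a s N))"
      by (rule inner_cnj[OF s[OF that] lsec])
    also have "\<dots> = (\<Sum>i\<le>N. cnj (a i) * cnj (inner_sec (s j) (s i)))"
      unfolding lin[OF s[OF that]] by simp
    also have "\<dots> = (\<Sum>i\<le>N. cnj (a i) * inner_sec (s i) (s j))"
      by (rule sum.cong) (use inner_cnj[OF s[OF that] s] in auto)
    finally show ?thesis .
  qed
  obtain U \<tau> where \<tau>: "(U, \<tau>) \<in> trivs L" "proj L q \<in> U" by (rule triv_at)
  have "\<exists>b. \<forall>j<Suc N. (\<Sum>i<Suc N. b i * inner_sec (s i) (s j)) = qhat L q (s j)"
  proof (rule gram_system_solvable)
    fix k w assume k: "k < Suc N" and w: "\<forall>j\<le>k. (\<Sum>i\<le>k. w i * inner_sec (s i) (s j)) = 0"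
    \<comment> \<open>The null vector of the block is extended by 0 to the whole basis. The
      conjugation compensates for the conjugate linearity of the scalar product in its first
      argument.\<close>
    define a where "a = (\<lambda>i. if i \<le> k then cnj (w i) else 0)"
    let ?e = "lincomb L a s N"
    have e: "?e \<in> sections" by (rule lsec)
    have "inner_sec ?e (s j) = 0" if "j \<le> k" for j
    proof -
      have "inner_sec ?e (s j) = (\<Sum>i\<le>N. cnj (a i) * inner_sec (s i) (s j))" using left that k by simp
      also have "\<dots> = (\<Sum>i\<le>k. w i * inner_sec (s i) (s j))"
        using k by (intro sum.mono_neutral_cong_right) (auto simp: a_def)
      finally show ?thesis using w that by simp
    qed
    then have "inner_sec ?e ?e = 0"
      unfolding lin[OF e] by (intro sum.neutral) (auto simp: a_def)
    then have z: "?e x \<notin> nonzero_vectors L" for x by (rule inner_self_zero[OF e])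
    have "?e = lincomb L (\<lambda>i. 0) s N"
    proof (rule section_eqI[OF e lsec])
      fix U \<tau> x assume \<tau>: "(U, \<tau>) \<in> trivs L" "x \<in> U"
      have "\<tau> (?e x) = 0" using z[of x] nonzero_iff[OF \<tau>(1), of "?e x"] \<tau>(2) e by (simp add: section_proj)
      then show "\<tau> (?e x) = \<tau> (lincomb L (\<lambda>i. 0) s N x)" unfolding ltriv[OF \<tau>] by simp
    qed
    then have "a k = 0" using indep[of a "\<lambda>i. 0" k] k by simp
    then show "w k \<noteq> 1" by (auto simp: a_def)
  qed
  then obtain b where b: "\<And>j. j \<le> N \<Longrightarrow> (\<Sum>i\<le>N. b i * inner_sec (s i) (s j)) = qhat L q (s j)"
    by (auto simp: less_Suc_eq_le lessThan_Suc_atMost)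
  let ?e = "lincomb L (\<lambda>i. cnj (b i)) s N"
  have e: "?e \<in> sections" by (rule lsec)
  have "inner_sec ?e t = qhat L q t" if t: "t \<in> sections" for t
  proof -
    obtain a where a: "t = lincomb L a s N" using span[OF t] by blast
    have "inner_sec ?e t = (\<Sum>j\<le>N. a j * qhat L q (s j))"
      unfolding a lin[OF e] by (rule sum.cong) (use left b in auto)
    also have "\<dots> = (\<Sum>j\<le>N. a j * \<tau> (s j (proj L q))) / \<tau> q"
      unfolding sum_divide_distrib by (rule sum.cong) (use qhat_eq[OF q s \<tau>] in auto)
    also have "(\<Sum>j\<le>N. a j * \<tau> (s j (proj L q))) = \<tau> (t (proj L q))"
      unfolding a by (rule ltriv[OF \<tau>, symmetric])
    finally show ?thesis unfolding qhat_eq[OF q t \<tau>] .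
  qed
  then show ?thesis using e by blast
qed

lemma inner_determines:
  assumes e: "e \<in> sections" "e' \<in> sections" and eq: "\<And>s. s \<in> sections \<Longrightarrow> inner_sec e s = inner_sec e' s"
  shows "e = e'"
proof -
  let ?d = "\<lambda>x. fadd L (e x) (fscale L (-1) (e' x))"
  have d: "?d \<in> sections" by (intro section_add section_scale e)
  have "inner_sec ?d ?d = inner_sec ?d e + (- 1) * inner_sec ?d e'"
    using inner_add[OF d e(1) section_scale[OF e(2)]] inner_scale[OF d e(2)] by simp
  also have "\<dots> = cnj (inner_sec e ?d - inner_sec e' ?d)" using inner_cnj[OF e(1) d] inner_cnj[OF e(2) d] by simp
  also have "\<dots> = 0" using eq[OF d] by simp
  finally have z: "?d x \<notin> nonzero_vectors L" for x by (rule inner_self_zero[OF d])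
  show ?thesis
  proof (rule section_eqI[OF e])
    fix U \<tau> x assume \<tau>: "(U, \<tau>) \<in> trivs L" "x \<in> U"
    have "\<tau> (?d x) = 0" using z[of x] nonzero_iff[OF \<tau>(1), of "?d x"] \<tau>(2) section_proj[OF d, of x] by simp
    then show "\<tau> (e x) = \<tau> (e' x)"
      using e \<tau> by (simp add: triv_props(3,4)[OF \<tau>(1)] section_proj proj_fscale)
  qed
qed

abbreviation coh where "coh \<equiv> coherent_vector A \<omega> L h"

lemma coh_props:
  assumes q: "q \<in> nonzero_vectors L"
  shows "coh q \<in> sections" "\<And>s. s \<in> sections \<Longrightarrow> inner_sec (coh q) s = qhat L q s"
proof -
  let ?P = "\<lambda>e. e \<in> sections \<and> (\<forall>s\<in>sections. inner_sec e s = qhat L q s)"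
  obtain e where e: "?P e" using coherent_exists[OF q] by blast
  have "?P (THE e. ?P e)"
  proof (rule theI[of ?P, OF e])
    fix e' assume "?P e'"
    then show "e' = e" using e by (intro inner_determines) auto
  qed
  then show "coh q \<in> sections" "\<And>s. s \<in> sections \<Longrightarrow> inner_sec (coh q) s = qhat L q s"
    unfolding coherent_vector_def by auto
qed

text \<open>By very ampleness some section does not vanish at \<open>proj L q\<close>; its scalar
  product with the coherent vector is its nonzero coefficient there.\<close>

lemma coh_not_zero:
  assumes q: "q \<in> nonzero_vectors L" shows "\<exists>x. coh q x \<in> nonzero_vectors L"
proof (rule ccontr)
  assume no: "\<not> ?thesis"
  obtain N s where basis: "section_basis A L N s" and emb: "embeds_by_sections A L N s"
    using ample unfolding very_ample_def by blast
  obtain i where i: "i \<le> N" "s i (proj L q) \<in> nonzero_vectors L"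
    using emb[unfolded embeds_by_sections_def, THEN conjunct1] by blast
  have s: "s i \<in> sections" using basis[unfolded section_basis_def, THEN conjunct1] i(1) by simp
  obtain U \<tau> where \<tau>: "(U, \<tau>) \<in> trivs L" "proj L q \<in> U" by (rule triv_at)
  have "qhat L q (s i) \<noteq> 0"
    unfolding qhat_eq[OF q s \<tau>] using nonzero_iff[OF \<tau>(1), of "s i (proj L q)"] nonzero_iff[OF \<tau>] i q \<tau> s
    by (simp add: section_proj)
  moreover have "(\<lambda>x. fscale L 0 (coh q x)) = coh q" using no by (simp add: nonzero_vectors_def fun_eq_iff)
  then have "inner_sec (s i) (coh q) = 0" using inner_scale[OF s coh_props(1)[OF q], of 0] by simp
  then have "inner_sec (coh q) (s i) = 0" using inner_cnj[OF s coh_props(1)[OF q]] by simp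
  ultimately show False using coh_props(2)[OF q s] by simp
qed

text \<open>If \<open>q'\<close> is \<open>c\<close> times \<open>q\<close>, then
  \<open>qhat L q'\<close> is \<open>1/c\<close> times \<open>qhat L q\<close>, and the factor
  becomes \<open>1 / cnj c\<close> on the coherent vector, which stands in the conjugate linear
  argument.\<close>

lemma coh_rescale:
  assumes q: "q \<in> nonzero_vectors L" "q' \<in> nonzero_vectors L" and pr: "proj L q' = proj L q"
  obtains a where "a \<noteq> 0" "coh q' = (\<lambda>x. fscale L a (coh q x))"
proof -
  obtain U \<tau> where \<tau>: "(U, \<tau>) \<in> trivs L" "proj L q \<in> U" by (rule triv_at)
  define c where "c = \<tau> q' / \<tau> q"
  have nz: "\<tau> q \<noteq> 0" "\<tau> q' \<noteq> 0" using nonzero_iff[OF \<tau>(1)] q pr \<tau> by auto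
  define a where "a = 1 / cnj c"
  let ?e = "\<lambda>x. fscale L a (coh q x)"
  have e: "?e \<in> sections" by (rule section_scale[OF coh_props(1)[OF q(1)]])
  have "coh q' = ?e"
  proof (rule inner_determines[OF coh_props(1)[OF q(2)] e])
    fix s assume s: "s \<in> sections"
    have "inner_sec ?e s = cnj (inner_sec s ?e)" by (rule inner_cnj[OF s e])
    also have "\<dots> = cnj (a * inner_sec s (coh q))" by (simp add: inner_scale[OF s coh_props(1)[OF q(1)]])
    also have "\<dots> = 1 / c * inner_sec (coh q) s" using inner_cnj[OF s coh_props(1)[OF q(1)]] by (simp add: a_def)
    also have "\<dots> = 1 / c * (\<tau> (s (proj L q)) / \<tau> q)" using coh_props(2)[OF q(1) s] qhat_eq[OF q(1) s \<tau>] by simp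
    also have "\<dots> = \<tau> (s (proj L q')) / \<tau> q'" using nz pr by (simp add: c_def)
    also have "\<dots> = inner_sec (coh q') s" using coh_props(2)[OF q(2) s] qhat_eq[OF q(2) s \<tau>(1)] pr \<tau>(2) by simp
    finally show "inner_sec (coh q') s = inner_sec ?e s" ..
  qed
  moreover have "a \<noteq> 0" using nz by (simp add: a_def c_def)
  ultimately show ?thesis using that by blast
qed

end

section \<open>Local defining functions\<close>

context complex_mfd
begin

lemma germ_dvdI: "open W \<Longrightarrow> p \<in> W \<Longrightarrow> holo_on A W k \<Longrightarrow> (\<And>x. x \<in> W \<Longrightarrow> g x = f x * k x) \<Longrightarrow> germ_dvd A p f g"
  unfolding germ_dvd_def by blast

lemma germ_dvdE:
  assumes "germ_dvd A p f g"
  obtains W k where "open W" "p \<in> W" "holo_on A W k" "\<And>x. x \<in> W \<Longrightarrow> g x = f x * k x"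
  using assms unfolding germ_dvd_def by blast

lemma germ_dvd_trans: assumes "germ_dvd A p f g" "germ_dvd A p g h" shows "germ_dvd A p f h"
proof -
  obtain W k where W: "open W" "p \<in> W" "holo_on A W k" "\<And>x. x \<in> W \<Longrightarrow> g x = f x * k x"
    using assms(1) by (rule germ_dvdE) (rule that)
  obtain W' k' where W': "open W'" "p \<in> W'" "holo_on A W' k'" "\<And>x. x \<in> W' \<Longrightarrow> h x = g x * k' x"
    using assms(2) by (rule germ_dvdE) (rule that)
  show ?thesis
  proof (rule germ_dvdI[of "W \<inter> W'" _ "\<lambda>x. k x * k' x"])
    show "open (W \<inter> W')" using W(1) W'(1) by (rule open_Int)
    show "holo_on A (W \<inter> W') (\<lambda>x. k x * k' x)"
      by (rule holo_on_mult[OF holo_on_subset[OF W(3)] holo_on_subset[OF W'(3)]]) auto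
  qed (use W W' in auto)
qed

lemma germ_dvd_power: assumes "germ_dvd A p f g" shows "germ_dvd A p (\<lambda>x. f x ^ a) (\<lambda>x. g x ^ a)"
proof -
  obtain W k where W: "open W" "p \<in> W" "holo_on A W k" "\<And>x. x \<in> W \<Longrightarrow> g x = f x * k x"
    using assms by (rule germ_dvdE) (rule that)
  show ?thesis
    by (rule germ_dvdI[OF W(1,2) holo_on_power[OF W(3), of a]]) (simp add: W(4) power_mult_distrib)
qed

lemma defining_functionE:
  assumes "local_defining_function A Y p f"
  obtains U where "open U" "p \<in> U" "holo_on A U f" "\<And>x. x \<in> Y \<Longrightarrow> x \<in> U \<Longrightarrow> f x = 0"
  using assms unfolding local_defining_function_def by blast

lemma defining_function_dvd:
  assumes "local_defining_function A Y p f" "open V" "p \<in> V" "holo_on A V g" "\<And>x. x \<in> Y \<Longrightarrow> x \<in> V \<Longrightarrow> g x = 0"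
  shows "germ_dvd A p f g"
  using assms(1)[unfolded local_defining_function_def, THEN conjunct2] assms(2-5) by blast

lemma defining_functions_dvd:
  assumes "local_defining_function A Y p f" "local_defining_function A Y p f'" shows "germ_dvd A p f f'"
proof -
  obtain U where U: "open U" "p \<in> U" "holo_on A U f'" "\<And>x. x \<in> Y \<Longrightarrow> x \<in> U \<Longrightarrow> f' x = 0"
    using defining_functionE[OF assms(2)] by blast
  show ?thesis using defining_function_dvd[OF assms(1) U] by blast
qed

text \<open>The definition only says that \<open>f\<close> vanishes on \<open>Y\<close>. Conversely,
  the finitely many functions that cut out \<open>Y\<close> near \<open>p\<close> vanish on
  \<open>Y\<close>, hence are divisible by \<open>f\<close>, so they vanish wherever
  \<open>f\<close> does on a common neighbourhood.\<close>

lemma defining_function_zero_set: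
  assumes Y: "analytic_subset A Y" and f: "local_defining_function A Y p f"
  obtains W where "open W" "p \<in> W" "holo_on A W f" "\<And>x. x \<in> W \<Longrightarrow> f x = 0 \<longleftrightarrow> x \<in> Y"
proof -
  obtain U0 where U0: "open U0" "p \<in> U0" "holo_on A U0 f" "\<And>x. x \<in> Y \<Longrightarrow> x \<in> U0 \<Longrightarrow> f x = 0"
    using defining_functionE[OF f] by blast
  from Y have "\<exists>U F. open U \<and> p \<in> U \<and> finite F \<and> (\<forall>f\<in>F. holo_on A U f) \<and> Y \<inter> U = {x\<in>U. \<forall>f\<in>F. f x = 0}"
    unfolding analytic_subset_def by (rule spec)
  then obtain U F where U: "open U" "p \<in> U" "finite F" "\<And>g. g \<in> F \<Longrightarrow> holo_on A U g"
    and YU: "Y \<inter> U = {x\<in>U. \<forall>f\<in>F. f x = 0}" by (elim exE conjE) blast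
  have "\<exists>W. open W \<and> p \<in> W \<and> (\<forall>x\<in>W. f x = 0 \<longrightarrow> g x = 0)" if g: "g \<in> F" for g
  proof -
    have "germ_dvd A p f g"
      by (rule defining_function_dvd[OF f U(1,2) U(4)[OF g]]) (use YU g in blast)
    then obtain W k where W: "open W" "p \<in> W" "holo_on A W k" "\<And>x. x \<in> W \<Longrightarrow> g x = f x * k x"
      by (rule germ_dvdE) (rule that)
    then show ?thesis by (intro exI[of _ W]) simp
  qed
  then have "\<forall>g\<in>F. \<exists>W. open W \<and> p \<in> W \<and> (\<forall>x\<in>W. f x = 0 \<longrightarrow> g x = 0)" by (intro ballI)
  from bchoice[OF this] obtain W where Wall: "\<forall>g\<in>F. open (W g) \<and> p \<in> W g \<and> (\<forall>x\<in>W g. f x = 0 \<longrightarrow> g x = 0)"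
    by (elim exE)
  have W: "open (W g)" "p \<in> W g" "x \<in> W g \<Longrightarrow> f x = 0 \<Longrightarrow> g x = 0" if "g \<in> F" for g x
    using bspec[OF Wall that] by simp_all
  let ?W = "U0 \<inter> U \<inter> (\<Inter>g\<in>F. W g)"
  show ?thesis
  proof
    show "open ?W" using U0(1) U(1,3) W(1) by (intro open_Int open_INT) auto
    show "p \<in> ?W" using U0 U W by auto
    show "holo_on A ?W f" by (rule holo_on_subset[OF U0(3)]) auto
    show "f x = 0 \<longleftrightarrow> x \<in> Y" if x: "x \<in> ?W" for x
    proof
      assume "f x = 0"
      then have "\<forall>g\<in>F. g x = 0" using W(3) x by blast
      then show "x \<in> Y" using YU x by blast
    qed (use U0(4) x in blast)
  qed
qed

text \<open>Puts the generator property into the form of the hypothesis \<open>gen\<close> of the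
  results in coordinate space; a function of the coordinates is pulled back to the manifold and
  divided there.\<close>

lemma defining_function_in_chart:
  assumes f: "local_defining_function A Y p f" and c: "c \<in> A" "p \<in> fst c"
    and V: "open V" "snd c p \<in> V" "holomorphic_cn g V" "\<forall>z\<in>snd c ` (Y \<inter> fst c) \<inter> V. g z = 0"
  shows "\<exists>W k. open W \<and> snd c p \<in> W \<and> holomorphic_cn k W \<and> (\<forall>z\<in>W. g z = f (unchart c z) * k z)"
proof -
  let ?V = "{x \<in> fst c. snd c x \<in> V}"
  have oV: "open ?V" by (rule open_chart_preimage[OF c(1) V(1)])
  have "germ_dvd A p f (\<lambda>x. g (snd c x))"
    by (rule defining_function_dvd[OF f oV _ holo_on_pullback[OF c(1) V(3)]]) (use c V in auto)
  then obtain W k where W: "open W" "p \<in> W" "holo_on A W k" "\<And>x. x \<in> W \<Longrightarrow> g (snd c x) = f x * k x"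
    by (rule germ_dvdE) (rule that)
  have "g z = f (unchart c z) * k (unchart c z)" if "z \<in> snd c ` (fst c \<inter> W)" for z
    using that W(4) unchart_chart[OF c(1)] by auto
  then show ?thesis
    by (intro exI[of _ "snd c ` (fst c \<inter> W)"] exI[of _ "\<lambda>z. k (unchart c z)"] conjI ballI
        open_chart_image[OF c(1) W(1)] holo_on_chart[OF W(3) c(1)] imageI IntI c(2) W(2))
qed

lemma not_vanishing_in_chart:
  assumes c: "c \<in> A" "p \<in> fst c" and nz: "\<And>W. open W \<Longrightarrow> p \<in> W \<Longrightarrow> \<exists>x\<in>W. f x \<noteq> 0"
    and W: "open W" "snd c p \<in> W"
  shows "\<exists>z\<in>W. f (unchart c z) \<noteq> 0"
proof -
  obtain x where "x \<in> {x \<in> fst c. snd c x \<in> W}" "f x \<noteq> 0"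
    using nz[OF open_chart_preimage[OF c(1) W(1)]] c W by blast
  then show ?thesis using unchart_chart[OF c(1)] by (intro bexI[of _ "snd c x"]) auto
qed

lemma zero_set_in_chart:
  assumes c: "c \<in> A" and W: "\<And>x. x \<in> W \<Longrightarrow> f x = 0 \<longleftrightarrow> x \<in> Y" and z: "z \<in> snd c ` (fst c \<inter> W)"
  shows "f (unchart c z) = 0 \<longleftrightarrow> z \<in> snd c ` (Y \<inter> fst c)"
proof -
  obtain x where x: "x \<in> fst c" "x \<in> W" "z = snd c x" using z by blast
  have "x \<in> Y" if "z \<in> snd c ` (Y \<inter> fst c)"
  proof -
    obtain y where y: "y \<in> Y" "y \<in> fst c" "z = snd c y" using \<open>z \<in> snd c ` (Y \<inter> fst c)\<close> by blast
    have "x = y" using unchart_chart[OF c x(1)] unchart_chart[OF c y(2)] x(3) y(3) by simp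
    then show ?thesis using y by simp
  qed
  then show ?thesis using x W[OF x(2)] unchart_chart[OF c x(1)] by auto
qed

lemma smooth_point_exists:
  assumes Y: "analytic_subset A Y" and p: "p \<in> Y" and f: "local_defining_function A Y p f"
    and nz: "\<And>W. open W \<Longrightarrow> p \<in> W \<Longrightarrow> \<exists>x\<in>W. f x \<noteq> 0"
  shows "\<exists>p. smooth_hypersurface_at A Y p"
proof -
  obtain W where W: "open W" "p \<in> W" "holo_on A W f" "\<And>x. x \<in> W \<Longrightarrow> f x = 0 \<longleftrightarrow> x \<in> Y"
    using defining_function_zero_set[OF Y f] by blast
  obtain c where c: "c \<in> A" "p \<in> fst c" by (rule chart_at)
  let ?S = "snd c ` (fst c \<inter> W)"
  have "\<exists>z\<in>?S. z \<in> snd c ` (Y \<inter> fst c) \<and> (\<exists>u. frechet_derivative (\<lambda>z. f (unchart c z)) (at z) u \<noteq> 0)"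
  proof (rule generator_smooth_nearby[where p = "snd c p"])
    show "open ?S" by (rule open_chart_image[OF c(1) W(1)])
    show "holomorphic_cn (\<lambda>z. f (unchart c z)) ?S" by (rule holo_on_chart[OF W(3) c(1)])
    show "snd c p \<in> ?S" using c W by blast
    show "f (unchart c (snd c p)) = 0" using unchart_chart[OF c] W(4)[OF W(2)] p by simp
    show "f (unchart c z) = 0 \<longleftrightarrow> z \<in> snd c ` (Y \<inter> fst c)" if "z \<in> ?S" for z
      by (rule zero_set_in_chart[OF c(1) W(4) that])
  qed (rule defining_function_in_chart[OF f c], assumption+, rule not_vanishing_in_chart[OF c nz], assumption+)
  then obtain z u where z: "z \<in> ?S" "z \<in> snd c ` (Y \<inter> fst c)"
    and u: "frechet_derivative (\<lambda>z. f (unchart c z)) (at z) u \<noteq> 0" by blast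
  obtain p' where p': "p' \<in> fst c" "p' \<in> W" "z = snd c p'" using z(1) by blast
  have "f p' = 0" using zero_set_in_chart[OF c(1) W(4) z(1)] z(2) unchart_chart[OF c(1) p'(1)] p'(3) by simp
  then have p'Y: "p' \<in> Y" using W(4)[OF p'(2)] by simp
  have "smooth_hypersurface_at A Y p'"
    unfolding smooth_hypersurface_at_def
  proof (intro conjI p'Y exI[of _ W] exI[of _ f] W(1,3) p'(2) ballI impI)
    show "Y \<inter> W = {x \<in> W. f x = 0}" using W(4) by blast
    show "\<exists>v. frechet_derivative (\<lambda>z. f (unchart d z)) (at (snd d p')) v \<noteq> 0" if "d \<in> A" "p' \<in> fst d" for d
      by (rule differential_nonzero_chart_change[OF c(1) p'(1) that W(1) p'(2) W(3) u[unfolded p'(3)]])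
  qed
  then show ?thesis by blast
qed

text \<open>A generator \<open>f'\<close> at \<open>y\<close> exists by \<open>ex\<close> and
  divides \<open>f\<close>. By \<open>generator_reduced_nearby\<close> the quotient \<open>w\<close>
  does not vanish at \<open>y\<close> if \<open>y\<close> is close to \<open>p\<close>, so it is a
  unit and \<open>f\<close> divides \<open>f'\<close>, and thereby every germ at \<open>y\<close>
  vanishing on \<open>Y\<close>.\<close>

lemma defining_function_nearby:
  assumes Y: "analytic_subset A Y" and p: "p \<in> Y" and f: "local_defining_function A Y p f"
    and nz: "\<And>W. open W \<Longrightarrow> p \<in> W \<Longrightarrow> \<exists>x\<in>W. f x \<noteq> 0"
    and ex: "\<And>y. y \<in> Y \<Longrightarrow> \<exists>f. local_defining_function A Y y f"
  obtains T where "open T" "p \<in> T" "\<And>y. y \<in> T \<Longrightarrow> f y = 0 \<longleftrightarrow> y \<in> Y"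
    "\<And>y. y \<in> T \<Longrightarrow> y \<in> Y \<Longrightarrow> local_defining_function A Y y f"
proof -
  obtain W where W: "open W" "p \<in> W" "holo_on A W f" "\<And>x. x \<in> W \<Longrightarrow> f x = 0 \<longleftrightarrow> x \<in> Y"
    using defining_function_zero_set[OF Y f] by blast
  obtain c where c: "c \<in> A" "p \<in> fst c" by (rule chart_at)
  let ?S = "snd c ` (fst c \<inter> W)" and ?F = "\<lambda>z. f (unchart c z)" and ?Y = "snd c ` (Y \<inter> fst c)"
  have "\<exists>\<delta>>0. \<forall>x\<in>ball (snd c p) \<delta>. \<forall>U f' w. open U \<longrightarrow> x \<in> U \<longrightarrow> holomorphic_cn f' U \<longrightarrow> holomorphic_cn w U \<longrightarrow>
      (\<forall>z\<in>U. ?F z = f' z * w z) \<longrightarrow> (\<forall>z\<in>?Y \<inter> U. f' z = 0) \<longrightarrow> ?F x = 0 \<longrightarrow> w x \<noteq> 0"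
  proof (rule generator_reduced_nearby[where p = "snd c p"])
    show "open ?S" by (rule open_chart_image[OF c(1) W(1)])
    show "holomorphic_cn (\<lambda>z. f (unchart c z)) ?S" by (rule holo_on_chart[OF W(3) c(1)])
    show "snd c p \<in> ?S" using c W by blast
    show "f (unchart c z) = 0 \<longleftrightarrow> z \<in> snd c ` (Y \<inter> fst c)" if "z \<in> ?S" for z
      by (rule zero_set_in_chart[OF c(1) W(4) that])
  qed (rule defining_function_in_chart[OF f c], assumption+, rule not_vanishing_in_chart[OF c nz], assumption+)
  then obtain \<delta> where \<delta>: "\<delta> > 0" and red: "\<And>x U f' w. x \<in> ball (snd c p) \<delta> \<Longrightarrow> open U \<Longrightarrow> x \<in> U \<Longrightarrow>
      holomorphic_cn f' U \<Longrightarrow> holomorphic_cn w U \<Longrightarrow> (\<forall>z\<in>U. ?F z = f' z * w z) \<Longrightarrow> (\<forall>z\<in>?Y \<inter> U. f' z = 0) \<Longrightarrow>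
      ?F x = 0 \<Longrightarrow> w x \<noteq> 0" by (elim exE conjE) simp
  let ?T = "{y \<in> fst c. snd c y \<in> ball (snd c p) \<delta>} \<inter> W"
  show ?thesis
  proof
    show "open ?T" by (intro open_Int open_chart_preimage c W open_ball)
    show "p \<in> ?T" using c W \<delta> by simp
    show "f y = 0 \<longleftrightarrow> y \<in> Y" if "y \<in> ?T" for y using W(4) that by blast
    fix y assume yT: "y \<in> ?T" and yY: "y \<in> Y"
    obtain f' where f': "local_defining_function A Y y f'" using ex[OF yY] by blast
    obtain U1 where U1: "open U1" "y \<in> U1" "holo_on A U1 f'" "\<And>x. x \<in> Y \<Longrightarrow> x \<in> U1 \<Longrightarrow> f' x = 0"
      using defining_functionE[OF f'] by blast
    have yW: "y \<in> W" "y \<in> fst c" using yT by auto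
    have "germ_dvd A y f' f" by (rule defining_function_dvd[OF f' W(1) yW(1) W(3)]) (use W(4) in blast)
    then obtain W1 w where W1: "open W1" "y \<in> W1" "holo_on A W1 w" "\<And>x. x \<in> W1 \<Longrightarrow> f x = f' x * w x"
      by (rule germ_dvdE) (rule that)
    let ?U = "U1 \<inter> W1"
    have oU: "open ?U" using U1(1) W1(1) by (rule open_Int)
    let ?V = "snd c ` (fst c \<inter> ?U)"
    have "w (unchart c (snd c y)) \<noteq> 0"
    proof (rule red[of "snd c y" ?V "\<lambda>z. f' (unchart c z)" "\<lambda>z. w (unchart c z)"])
      show "snd c y \<in> ball (snd c p) \<delta>" using yT by simp
      show "open ?V" by (rule open_chart_image[OF c(1) oU])
      show "snd c y \<in> ?V" using yW U1 W1 by blast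
      show "holomorphic_cn (\<lambda>z. f' (unchart c z)) ?V"
        by (rule holo_on_chart[OF holo_on_subset[OF U1(3)] c(1)]) simp
      show "holomorphic_cn (\<lambda>z. w (unchart c z)) ?V"
        by (rule holo_on_chart[OF holo_on_subset[OF W1(3)] c(1)]) simp
      show "\<forall>z\<in>?V. f (unchart c z) = f' (unchart c z) * w (unchart c z)"
        using W1(4) unchart_chart[OF c(1)] by auto
      show "\<forall>z\<in>?Y \<inter> ?V. f' (unchart c z) = 0"
      proof
        fix z assume z: "z \<in> ?Y \<inter> ?V"
        then obtain x where x: "x \<in> Y" "x \<in> fst c" "z = snd c x" by blast
        from z obtain x' where x': "x' \<in> fst c" "x' \<in> U1" "z = snd c x'" by blast
        have "x = x'" using unchart_chart[OF c(1) x(2)] unchart_chart[OF c(1) x'(1)] x(3) x'(3) by simp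
        then show "f' (unchart c z) = 0" using U1(4)[OF x(1)] x x' unchart_chart[OF c(1) x(2)] by simp
      qed
      show "f (unchart c (snd c y)) = 0" using unchart_chart[OF c(1) yW(2)] W(4)[OF yW(1)] yY by simp
    qed
    then have wy: "w y \<noteq> 0" using unchart_chart[OF c(1) yW(2)] by simp
    let ?X = "W1 \<inter> w -` (- {0})"
    have oX: "open ?X" by (rule continuous_open_preimage[OF holo_on_continuous[OF W1(1,3)] W1(1)]) auto
    have "germ_dvd A y f f'"
    proof (rule germ_dvdI[OF oX])
      show "holo_on A ?X (\<lambda>x. inverse (w x))"
        by (rule holo_on_inverse[OF holo_on_subset[OF W1(3)]]) auto
    qed (use wy W1 in auto)
    then have "germ_dvd A y f g" if "open V" "y \<in> V" "holo_on A V g" "\<And>x. x \<in> Y \<Longrightarrow> x \<in> V \<Longrightarrow> g x = 0" for V g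
      using defining_function_dvd[OF f' that] by (rule germ_dvd_trans)
    then show "local_defining_function A Y y f"
      unfolding local_defining_function_def using W yW by blast
  qed
qed

end

section \<open>The polar divisor\<close>

text \<open>If \<open>h\<close> had a zero of finite order \<open>n\<close>, it would be
  \<open>g * t^n\<close> with \<open>g 0\<close> nonzero. Divisibility by the power
  \<open>Suc n\<close> of \<open>\<phi>\<close>, which vanishes at 0, makes \<open>h / t^n\<close>
  tend to 0. Continuity of the cofactor at 0 is enough for this.\<close>

lemma zero_if_high_powers_divide:
  fixes h \<phi> :: "complex \<Rightarrow> complex"
  assumes h: "h holomorphic_on S" and S: "open S" "connected S" "0 \<in> S"
    and \<phi>: "\<phi> field_differentiable (at 0)" "\<phi> 0 = 0"
    and dv: "\<And>a. \<exists>\<kappa>. isCont \<kappa> 0 \<and> (\<forall>\<^sub>F t in at 0. h t = \<phi> t ^ a * \<kappa> t)"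
    and t: "t \<in> S"
  shows "h t = 0"
proof (rule ccontr)
  assume "h t \<noteq> 0"
  then have "\<exists>w\<in>S. h w \<noteq> 0" using t by blast
  from zorder_exist_zero[OF h S this] obtain r where r: "r > 0" "zor_poly h 0 holomorphic_on cball 0 r"
    "\<And>w. w \<in> cball 0 r \<Longrightarrow> h w = zor_poly h 0 w * (w - 0) ^ nat (zorder h 0) \<and> zor_poly h 0 w \<noteq> 0" by blast
  define n where "n = nat (zorder h 0)"
  define g where "g = zor_poly h 0"
  have "continuous_on (ball 0 r) g" using r(2) holomorphic_on_imp_continuous_on unfolding g_def
    by (meson ball_subset_cball continuous_on_subset)
  then have "isCont g 0" using r(1) by (simp add: continuous_on_eq_continuous_at)
  then have g0: "(g \<longlongrightarrow> g 0) (at 0)" by (simp add: isCont_def)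
  obtain \<kappa> where \<kappa>: "isCont \<kappa> 0" "\<forall>\<^sub>F t in at 0. h t = \<phi> t ^ Suc n * \<kappa> t" using dv by blast
  obtain \<phi>' where "(\<phi> has_field_derivative \<phi>') (at 0)" using \<phi>(1) unfolding field_differentiable_def by blast
  then have q: "((\<lambda>w. \<phi> w / w) \<longlongrightarrow> \<phi>') (at 0)" using \<phi>(2) by (simp add: DERIV_def)
  have p0: "(\<phi> \<longlongrightarrow> 0) (at 0)"
    using field_differentiable_imp_continuous_at[OF \<phi>(1)] \<phi>(2) by (simp add: isCont_def)
  have k0: "(\<kappa> \<longlongrightarrow> \<kappa> 0) (at 0)" using \<kappa>(1) by (simp add: isCont_def)
  have "((\<lambda>w. (\<phi> w / w) ^ n * \<phi> w * \<kappa> w) \<longlongrightarrow> \<phi>' ^ n * 0 * \<kappa> 0) (at 0)"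
    by (intro tendsto_mult tendsto_power q p0 k0)
  moreover have "\<forall>\<^sub>F w in at 0. (\<phi> w / w) ^ n * \<phi> w * \<kappa> w = g w"
  proof -
    have "\<forall>\<^sub>F w in at 0. w \<in> cball 0 r \<and> w \<noteq> 0"
      using r(1) by (auto simp: eventually_at dist_commute intro!: exI[of _ r])
    with \<kappa>(2) show ?thesis
    proof eventually_elim
      case (elim w)
      then have "\<phi> w ^ Suc n * \<kappa> w = g w * w ^ n" using r(3)[of w] by (simp add: g_def n_def)
      then show ?case using elim by (simp add: power_divide field_simps)
    qed
  qed
  ultimately have "(g \<longlongrightarrow> \<phi>' ^ n * 0 * \<kappa> 0) (at 0)" by (rule Lim_transform_eventually)
  from tendsto_unique[OF _ g0 this] have "g 0 = 0" by simp
  then show False using r(3)[of 0] r(1) by (simp add: g_def)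
qed

context quantized
begin

lemma triv_germ_dvd:
  assumes e: "e \<in> sections" and \<tau>: "(U, \<tau>) \<in> trivs L" "p \<in> U" and \<tau>': "(U', \<tau>') \<in> trivs L" "p \<in> U'"
  shows "germ_dvd A p (\<lambda>x. \<tau> (e x)) (\<lambda>x. \<tau>' (e x))"
proof -
  obtain g where g: "holo_on A (U \<inter> U') g"
    "\<And>q. proj L q \<in> U \<Longrightarrow> proj L q \<in> U' \<Longrightarrow> g (proj L q) \<noteq> 0 \<and> \<tau>' q = g (proj L q) * \<tau> q"
    using triv_transition[OF \<tau>(1) \<tau>'(1)] by blast
  show ?thesis
  proof (rule germ_dvdI[OF _ _ g(1)])
    show "open (U \<inter> U')" by (rule open_Int[OF triv_props(1)[OF \<tau>(1)] triv_props(1)[OF \<tau>'(1)]])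
    show "\<tau>' (e x) = \<tau> (e x) * g x" if "x \<in> U \<inter> U'" for x
      using g(2)[of "e x"] that by (simp add: section_proj[OF e])
  qed (use \<tau> \<tau>' in auto)
qed

text \<open>The exponents whose supremum is the vanishing order at \<open>p\<close>. Comparing the
  sets themselves gives equal suprema whether or not these are attained.\<close>

definition section_orders :: "('m \<Rightarrow> 'l) \<Rightarrow> 'm set \<Rightarrow> 'm \<Rightarrow> nat set" where
  "section_orders e Y p = {a. \<exists>U \<tau> f. (U, \<tau>) \<in> trivs L \<and> p \<in> U \<and> local_defining_function A Y p f \<and>
     germ_dvd A p (\<lambda>x. f x ^ a) (\<lambda>x. \<tau> (e x))}"

text \<open>Two generators at \<open>p\<close> divide each other, and two trivializations differ by
  a holomorphic factor, so membership may be tested with any choice of both.\<close>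

lemma section_orders_iff:
  assumes e: "e \<in> sections" and \<tau>: "(U, \<tau>) \<in> trivs L" "p \<in> U" and f: "local_defining_function A Y p f"
  shows "a \<in> section_orders e Y p \<longleftrightarrow> germ_dvd A p (\<lambda>x. f x ^ a) (\<lambda>x. \<tau> (e x))"
proof
  assume "a \<in> section_orders e Y p"
  then obtain U' \<tau>' f' where \<tau>': "(U', \<tau>') \<in> trivs L" "p \<in> U'" and f': "local_defining_function A Y p f'"
    and dv: "germ_dvd A p (\<lambda>x. f' x ^ a) (\<lambda>x. \<tau>' (e x))" unfolding section_orders_def by blast
  have "germ_dvd A p (\<lambda>x. f x ^ a) (\<lambda>x. f' x ^ a)" by (rule germ_dvd_power[OF defining_functions_dvd[OF f f']])
  from germ_dvd_trans[OF germ_dvd_trans[OF this dv] triv_germ_dvd[OF e \<tau>' \<tau>]]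
  show "germ_dvd A p (\<lambda>x. f x ^ a) (\<lambda>x. \<tau> (e x))" .
next
  assume "germ_dvd A p (\<lambda>x. f x ^ a) (\<lambda>x. \<tau> (e x))"
  then show "a \<in> section_orders e Y p" unfolding section_orders_def using \<tau> f by blast
qed

lemma zero_set_iff: "e \<in> sections \<Longrightarrow> (U, \<tau>) \<in> trivs L \<Longrightarrow> x \<in> U \<Longrightarrow> e x \<in> nonzero_vectors L \<longleftrightarrow> \<tau> (e x) \<noteq> 0"
  by (rule nonzero_iff) (simp_all add: section_proj)

lemma chart_triv_ball:
  obtains c U \<tau> \<rho> where "c \<in> A" "x \<in> fst c" "(U, \<tau>) \<in> trivs L" "x \<in> U" "\<rho> > 0" "ball (snd c x) \<rho> \<subseteq> snd c ` (fst c \<inter> U)"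
proof -
  obtain c where c: "c \<in> A" "x \<in> fst c" by (rule chart_at)
  obtain U \<tau> where \<tau>: "(U, \<tau>) \<in> trivs L" "x \<in> U" by (rule triv_at)
  have "snd c x \<in> snd c ` (fst c \<inter> U)" using c \<tau> by blast
  then obtain \<rho> where "\<rho> > 0" "ball (snd c x) \<rho> \<subseteq> snd c ` (fst c \<inter> U)"
    using open_chart_image[OF c(1) triv_props(1)[OF \<tau>(1)]] openE by blast
  then show ?thesis using that c \<tau> by blast
qed

text \<open>The interior \<open>Z\<close> of the zero set is also closed: a coordinate ball around
  \<open>x\<close> inside a trivialization that meets \<open>Z\<close> lies entirely in the zero set
  by the identity theorem, so \<open>x\<close> belongs to \<open>Z\<close>. The manifold is
  connected.\<close>

lemma section_identity:
  assumes e: "e \<in> sections" and W: "open W" "W \<noteq> {}" "\<And>x. x \<in> W \<Longrightarrow> e x \<notin> nonzero_vectors L"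
  shows "e y \<notin> nonzero_vectors L"
proof -
  define Z where "Z = {x. \<exists>W. open W \<and> x \<in> W \<and> (\<forall>y\<in>W. e y \<notin> nonzero_vectors L)}"
  have "open Z" unfolding Z_def by (subst open_subopen) blast
  have "\<exists>T. open T \<and> x \<in> T \<and> T \<subseteq> - Z" if x: "x \<notin> Z" for x
  proof -
    obtain c U \<tau> \<rho> where c: "c \<in> A" "x \<in> fst c" and \<tau>: "(U, \<tau>) \<in> trivs L" "x \<in> U"
      and \<rho>: "\<rho> > 0" "ball (snd c x) \<rho> \<subseteq> snd c ` (fst c \<inter> U)" by (rule chart_triv_ball)
    let ?T = "{y \<in> fst c. snd c y \<in> ball (snd c x) \<rho>}"
    let ?G = "\<lambda>z. \<tau> (e (unchart c z))"
    have oT: "open ?T" by (rule open_chart_preimage[OF c(1) open_ball])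
    have TU: "y \<in> U" if y: "y \<in> ?T" for y
    proof -
      have "snd c y \<in> snd c ` (fst c \<inter> U)" using \<rho>(2) y by blast
      then obtain y' where "y' \<in> fst c" "y' \<in> U" "snd c y = snd c y'" by blast
      then show ?thesis using unchart_chart[OF c(1), of y] unchart_chart[OF c(1), of y'] y by simp
    qed
    have hol: "holomorphic_cn ?G (ball (snd c x) \<rho>)"
      by (rule holomorphic_cn_subset[OF holo_on_chart[OF section_holo[OF e \<tau>(1)] c(1)] \<rho>(2)])
    have "?T \<inter> Z = {}"
    proof (rule ccontr)
      assume "?T \<inter> Z \<noteq> {}"
      then obtain y where y: "y \<in> ?T" "y \<in> Z" by blast
      let ?V = "snd c ` (fst c \<inter> (?T \<inter> Z))"
      have oV: "open ?V" by (rule open_chart_image[OF c(1) open_Int[OF oT \<open>open Z\<close>]])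
      have G0: "?G z = 0" if z: "z \<in> ball (snd c x) \<rho>" for z
      proof (rule holomorphic_cn_identity_convex[OF hol open_ball convex_ball oV _ _ _ z])
        show "?V \<subseteq> ball (snd c x) \<rho>" by auto
        show "snd c y \<in> ?V" using y by blast
        fix z assume "z \<in> ?V"
        then obtain y' where y': "y' \<in> fst c" "y' \<in> ?T" "y' \<in> Z" "z = snd c y'" by blast
        have "e y' \<notin> nonzero_vectors L" using y'(3) unfolding Z_def by blast
        then show "?G z = 0" using zero_set_iff[OF e \<tau>(1) TU[OF y'(2)]] unchart_chart[OF c(1) y'(1)] y'(4) by simp
      qed
      have "e y' \<notin> nonzero_vectors L" if y': "y' \<in> ?T" for y'
        using G0[of "snd c y'"] y' zero_set_iff[OF e \<tau>(1) TU[OF y']] unchart_chart[OF c(1), of y'] by simp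
      moreover have "x \<in> ?T" using c \<rho> by simp
      ultimately have "x \<in> Z" unfolding Z_def using oT by blast
      then show False using x by simp
    qed
    then show ?thesis using oT c \<rho> by (intro exI[of _ ?T]) auto
  qed
  then have "open (- Z)" by (subst open_subopen) blast
  moreover have "Z \<noteq> {}" using W unfolding Z_def by blast
  ultimately have "Z = UNIV"
    using connected_space \<open>open Z\<close> unfolding connected_clopen by (auto simp: closed_def)
  then show ?thesis unfolding Z_def by blast
qed

section \<open>Irreducible subvarieties along which a section has positive order\<close>

context
  fixes e :: "'m \<Rightarrow> 'l" and Y :: "'m set" and y0 :: 'm
  assumes e: "e \<in> sections" and y0: "e y0 \<in> nonzero_vectors L"
    and irr: "irreducible_subvariety A Y"
    and ord: "\<And>p. p \<in> Y \<Longrightarrow> \<exists>a\<in>section_orders e Y p. a \<ge> 1"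
begin

private lemma Y: "analytic_subset A Y" "Y \<noteq> {}"
  using irr unfolding irreducible_subvariety_def by blast+

private lemma not_zero_open: "open W \<Longrightarrow> x \<in> W \<Longrightarrow> \<exists>y\<in>W. e y \<in> nonzero_vectors L"
  using section_identity[OF e, of W y0] y0 by blast

private lemma defining_exists: "p \<in> Y \<Longrightarrow> \<exists>f. local_defining_function A Y p f"
  using ord unfolding section_orders_def by blast

private lemma Y_zero: assumes p: "p \<in> Y" shows "e p \<notin> nonzero_vectors L"
proof -
  obtain a where a: "a \<in> section_orders e Y p" "a \<ge> 1" using ord[OF p] by blast
  obtain f where f: "local_defining_function A Y p f" using defining_exists[OF p] by blast
  obtain U \<tau> where \<tau>: "(U, \<tau>) \<in> trivs L" "p \<in> U" by (rule triv_at)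
  have "germ_dvd A p (\<lambda>x. f x ^ a) (\<lambda>x. \<tau> (e x))" using a(1) section_orders_iff[OF e \<tau> f] by blast
  then obtain W k where W: "p \<in> W" "\<And>x. x \<in> W \<Longrightarrow> \<tau> (e x) = f x ^ a * k x" by (rule germ_dvdE) (rule that)
  obtain V where V: "p \<in> V" "\<And>x. x \<in> Y \<Longrightarrow> x \<in> V \<Longrightarrow> f x = 0" using defining_functionE[OF f] by blast
  have "f p = 0" by (rule V(2)[OF p V(1)])
  then have "\<tau> (e p) = 0" using W(2)[OF W(1)] a(2) by simp
  then show ?thesis unfolding zero_set_iff[OF e \<tau>] by simp
qed

text \<open>Otherwise \<open>Y\<close> would contain a neighbourhood of \<open>p\<close>, and the
  section, which vanishes on \<open>Y\<close>, would vanish on an open set.\<close>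

private lemma defining_not_zero:
  assumes p: "p \<in> Y" and f: "local_defining_function A Y p f" and W: "open W" "p \<in> W"
  shows "\<exists>x\<in>W. f x \<noteq> 0"
proof (rule ccontr)
  assume no: "\<not> ?thesis"
  obtain W' where W': "open W'" "p \<in> W'" "holo_on A W' f" "\<And>x. x \<in> W' \<Longrightarrow> f x = 0 \<longleftrightarrow> x \<in> Y"
    by (rule defining_function_zero_set[OF Y(1) f]) (rule that)
  have "p \<in> W \<inter> W'" using W(2) W'(2) by simp
  from not_zero_open[OF open_Int[OF W(1) W'(1)] this]
  obtain y where y: "y \<in> W" "y \<in> W'" "e y \<in> nonzero_vectors L" by blast
  have "f y = 0" using no y(1) by simp
  then show False using W'(4)[OF y(2)] Y_zero y(3) by simp
qed

private lemma hypersurface: "irreducible_hypersurface A Y"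
proof -
  obtain p where p: "p \<in> Y" using Y(2) by blast
  obtain f where f: "local_defining_function A Y p f" using defining_exists[OF p] by blast
  have "\<exists>p. smooth_hypersurface_at A Y p"
    by (rule smooth_point_exists[OF Y(1) p f defining_not_zero[OF p f]])
  then show ?thesis using irr unfolding irreducible_hypersurface_def by blast
qed

text \<open>If all powers of the generator divided the section at \<open>p\<close>, the section
  would vanish on every line through \<open>p\<close> inside a coordinate ball, hence on an open
  set.\<close>

private lemma orders_bounded: assumes p: "p \<in> Y" shows "\<exists>a. a \<notin> section_orders e Y p"
proof (rule ccontr)
  assume all: "\<not> ?thesis"
  obtain f where f: "local_defining_function A Y p f" using defining_exists[OF p] by blast
  obtain W where W: "open W" "p \<in> W" "holo_on A W f" "\<And>x. x \<in> Y \<Longrightarrow> x \<in> W \<Longrightarrow> f x = 0"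
    using defining_functionE[OF f] by blast
  obtain c U \<tau> \<rho> where c: "c \<in> A" "p \<in> fst c" and \<tau>: "(U, \<tau>) \<in> trivs L" "p \<in> U"
    and \<rho>: "\<rho> > 0" "ball (snd c p) \<rho> \<subseteq> snd c ` (fst c \<inter> U)" by (rule chart_triv_ball)
  let ?G = "\<lambda>z. \<tau> (e (unchart c z))" and ?F = "\<lambda>z. f (unchart c z)" and ?P = "snd c p"
  have hol: "holomorphic_cn ?G (ball ?P \<rho>)"
    by (rule holomorphic_cn_subset[OF holo_on_chart[OF section_holo[OF e \<tau>(1)] c(1)] \<rho>(2)])
  have up: "unchart c ?P = p" by (rule unchart_chart[OF c])
  have G0: "?G z = 0" if z: "z \<in> ball ?P \<rho>" for z
  proof -
    let ?u = "z - ?P" and ?S = "{t. ?P + t *s (z - ?P) \<in> ball ?P \<rho>}"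
    have "?G (?P + 1 *s ?u) = 0"
    proof (rule zero_if_high_powers_divide[where S = ?S and h = "\<lambda>t. ?G (?P + t *s ?u)" and \<phi> = "\<lambda>t. ?F (?P + t *s ?u)" and t = 1])
      show "(\<lambda>t. ?G (?P + t *s ?u)) holomorphic_on ?S" by (rule holomorphic_cn_line[OF hol])
      show "open ?S" by (rule open_line_preimage[OF open_ball])
      show "connected ?S" by (rule convex_connected[OF convex_line_preimage[OF convex_ball]])
      show "0 \<in> ?S" "1 \<in> ?S" using \<rho>(1) z by simp_all
      have "?P + 0 *s ?u \<in> snd c ` (fst c \<inter> W)" using c W by simp
      from holomorphic_cn_line_derivative[OF holo_on_chart[OF W(3) c(1)] this]
      show "(\<lambda>t. ?F (?P + t *s ?u)) field_differentiable at 0" unfolding field_differentiable_def by blast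
      show "?F (?P + 0 *s ?u) = 0" using W(4)[OF p W(2)] by (simp add: up)
      fix a
      have "a \<in> section_orders e Y p" using all by blast
      then have "germ_dvd A p (\<lambda>x. f x ^ a) (\<lambda>x. \<tau> (e x))" using section_orders_iff[OF e \<tau> f] by blast
      then obtain V k where V: "open V" "p \<in> V" "holo_on A V k" "\<And>x. x \<in> V \<Longrightarrow> \<tau> (e x) = f x ^ a * k x"
        by (rule germ_dvdE) (rule that)
      let ?V = "snd c ` (fst c \<inter> V)"
      have V0: "?P + 0 *s ?u \<in> ?V" using c V by simp
      have "isCont (\<lambda>t. k (unchart c (?P + t *s ?u))) 0"
        by (rule DERIV_isCont[OF holomorphic_cn_line_derivative[OF holo_on_chart[OF V(3) c(1)] V0]])
      moreover have "\<forall>\<^sub>F t in at 0. ?P + t *s ?u \<in> ?V"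
        using eventually_at_in_open'[OF open_line_preimage[OF open_chart_image[OF c(1) V(1)], of ?P ?u], of 0] V0
        by simp
      then have "\<forall>\<^sub>F t in at 0. ?G (?P + t *s ?u) = ?F (?P + t *s ?u) ^ a * k (unchart c (?P + t *s ?u))"
      proof eventually_elim
        case (elim t)
        then show ?case using V(4) unchart_chart[OF c(1)] by auto
      qed
      ultimately show "\<exists>\<kappa>. isCont \<kappa> 0 \<and> (\<forall>\<^sub>F t in at 0. ?G (?P + t *s ?u) = ?F (?P + t *s ?u) ^ a * \<kappa> t)"
        by (intro exI[of _ "\<lambda>t. k (unchart c (?P + t *s ?u))"] conjI)
    qed
    then show ?thesis by simp
  qed
  let ?T = "{y \<in> fst c. snd c y \<in> ball ?P \<rho>} \<inter> U"
  have "open ?T" by (intro open_Int open_chart_preimage c open_ball triv_props(1)[OF \<tau>(1)])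
  moreover have "p \<in> ?T" using c \<tau> \<rho> by simp
  ultimately obtain y where y: "y \<in> ?T" "e y \<in> nonzero_vectors L" using not_zero_open by blast
  then show False using G0[of "snd c y"] zero_set_iff[OF e \<tau>(1), of y] unchart_chart[OF c(1), of y] by simp
qed

text \<open>Exponent 0 is always admissible. If admissibility of \<open>n\<close> at all points
  always implied that of \<open>Suc n\<close>, every exponent would be admissible everywhere,
  against \<open>orders_bounded\<close>.\<close>

private lemma generic_order:
  obtains n p where "\<And>p. p \<in> Y \<Longrightarrow> n \<in> section_orders e Y p" "p \<in> Y" "Suc n \<notin> section_orders e Y p"
proof -
  have "\<exists>n. (\<forall>p\<in>Y. n \<in> section_orders e Y p) \<and> \<not> (\<forall>p\<in>Y. Suc n \<in> section_orders e Y p)"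
  proof (rule ccontr)
    assume no: "\<not> ?thesis"
    have "\<forall>p\<in>Y. n \<in> section_orders e Y p" for n
    proof (induction n)
      case 0
      show ?case
      proof
        fix p assume p: "p \<in> Y"
        obtain f where f: "local_defining_function A Y p f" using defining_exists[OF p] by blast
        obtain U \<tau> where \<tau>: "(U, \<tau>) \<in> trivs L" "p \<in> U" by (rule triv_at)
        have "germ_dvd A p (\<lambda>x. f x ^ 0) (\<lambda>x. \<tau> (e x))"
          by (rule germ_dvdI[OF triv_props(1)[OF \<tau>(1)] \<tau>(2) section_holo[OF e \<tau>(1)]]) simp
        then show "0 \<in> section_orders e Y p" using section_orders_iff[OF e \<tau> f] by blast
      qed
    qed (use no in blast)
    then show False using orders_bounded Y(2) by blast
  qed
  then show ?thesis using that by blast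
qed

text \<open>Dividing the section by the power of the defining functions that it contains generically
  leaves an analytic set which covers the rest of the zero set and does not contain \<open>Y\<close>.\<close>

private definition residual :: "nat \<Rightarrow> 'm set" where
  "residual n = {y. e y \<notin> nonzero_vectors L \<and> (y \<in> Y \<longrightarrow> (\<exists>U \<tau> f W k. (U, \<tau>) \<in> trivs L \<and> y \<in> U \<and>
     local_defining_function A Y y f \<and> open W \<and> y \<in> W \<and> holo_on A W k \<and> (\<forall>x\<in>W. \<tau> (e x) = f x ^ n * k x) \<and> k y = 0))}"

text \<open>The condition in \<open>residual\<close> leaves the trivialization, the generator and
  the quotient free. With \<open>c\<close> and \<open>g\<close> relating the two choices,
  \<open>k'\<close> equals \<open>c^n * k * g\<close> wherever \<open>f'\<close> does not vanish. If
  \<open>k' y\<close> were nonzero, the difference would be nonzero on a neighbourhood of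
  \<open>y\<close>, and this contains points where \<open>f'\<close> does not vanish.\<close>

private lemma quotient_zero_unique:
  assumes y: "y \<in> Y" and \<tau>: "(U, \<tau>) \<in> trivs L" "y \<in> U" and \<tau>': "(U', \<tau>') \<in> trivs L" "y \<in> U'"
    and f: "local_defining_function A Y y f" and f': "local_defining_function A Y y f'"
    and W: "open W" "y \<in> W" "holo_on A W k" "\<forall>x\<in>W. \<tau> (e x) = f x ^ n * k x" "k y = 0"
    and W': "open W'" "y \<in> W'" "holo_on A W' k'" "\<forall>x\<in>W'. \<tau>' (e x) = f' x ^ n * k' x"
  shows "k' y = 0"
proof (rule ccontr)
  assume k': "k' y \<noteq> 0"
  obtain V1 c where V1: "open V1" "y \<in> V1" "holo_on A V1 c" "\<And>x. x \<in> V1 \<Longrightarrow> f x = f' x * c x"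
    using defining_functions_dvd[OF f' f] by (rule germ_dvdE) (rule that)
  obtain V2 g where V2: "open V2" "y \<in> V2" "holo_on A V2 g" "\<And>x. x \<in> V2 \<Longrightarrow> \<tau>' (e x) = \<tau> (e x) * g x"
    using triv_germ_dvd[OF e \<tau> \<tau>'] by (rule germ_dvdE) (rule that)
  let ?D = "\<lambda>x. k' x + (-1) * (c x ^ n * k x * g x)"
  let ?V = "W \<inter> W' \<inter> V1 \<inter> V2"
  have oV: "open ?V" by (intro open_Int W(1) W'(1) V1(1) V2(1))
  have "holo_on A ?V ?D"
    by (intro holo_on_add holo_on_mult holo_on_const holo_on_power holo_on_subset[OF W(3)] holo_on_subset[OF W'(3)]
        holo_on_subset[OF V1(3)] holo_on_subset[OF V2(3)]) auto
  then have "open (?V \<inter> ?D -` (- {0}))"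
    by (intro continuous_open_preimage holo_on_continuous oV) auto
  moreover have "y \<in> ?V \<inter> ?D -` (- {0})" using W(2,5) W'(2) V1(2) V2(2) k' by simp
  ultimately obtain x where x: "x \<in> ?V" "?D x \<noteq> 0" "f' x \<noteq> 0"
    using defining_not_zero[OF y f'] by blast
  have "f' x ^ n * k' x = \<tau>' (e x)" using W'(4) x(1) by simp
  also have "\<dots> = f x ^ n * k x * g x" using V2(4) W(4) x(1) by simp
  also have "\<dots> = f' x ^ n * (c x ^ n * k x * g x)" using V1(4) x(1) by (simp add: power_mult_distrib mult.assoc)
  finally have "k' x = c x ^ n * k x * g x" using x(3) by simp
  then show False using x(2) by simp
qed

text \<open>As \<open>f\<close> generates the ideal at all points of \<open>Y\<close> near
  \<open>p\<close>, one quotient \<open>k\<close> can be used for all of them. Off \<open>Y\<close>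
  the factor \<open>f ^ n\<close> is nonzero, so \<open>k\<close> and the section have the same
  zeros.\<close>

private lemma residual_local:
  assumes n: "\<And>p. p \<in> Y \<Longrightarrow> n \<in> section_orders e Y p" and p: "p \<in> Y"
    and f: "local_defining_function A Y p f" and \<tau>: "(U, \<tau>) \<in> trivs L" "p \<in> U"
  obtains W k where "open W" "p \<in> W" "holo_on A W k" "\<And>x. x \<in> W \<Longrightarrow> \<tau> (e x) = f x ^ n * k x"
    "residual n \<inter> W = {x \<in> W. k x = 0}"
proof -
  obtain T where T: "open T" "p \<in> T" "\<And>y. y \<in> T \<Longrightarrow> f y = 0 \<longleftrightarrow> y \<in> Y"
    "\<And>y. y \<in> T \<Longrightarrow> y \<in> Y \<Longrightarrow> local_defining_function A Y y f"
    by (rule defining_function_nearby[OF Y(1) p f defining_not_zero[OF p f] defining_exists]) (assumption | rule that)+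
  have "germ_dvd A p (\<lambda>x. f x ^ n) (\<lambda>x. \<tau> (e x))" using n[OF p] section_orders_iff[OF e \<tau> f] by blast
  then obtain V k where V: "open V" "p \<in> V" "holo_on A V k" "\<And>x. x \<in> V \<Longrightarrow> \<tau> (e x) = f x ^ n * k x"
    by (rule germ_dvdE) (rule that)
  let ?W = "T \<inter> V \<inter> U"
  have oW: "open ?W" by (intro open_Int T(1) V(1) triv_props(1)[OF \<tau>(1)])
  have hW: "holo_on A ?W k" by (rule holo_on_subset[OF V(3)]) auto
  have "y \<in> residual n \<longleftrightarrow> k y = 0" if y: "y \<in> ?W" for y
  proof (cases "y \<in> Y")
    case False
    then have "f y \<noteq> 0" using T(3) y by blast
    then have "\<tau> (e y) = 0 \<longleftrightarrow> k y = 0" using V(4) y by simp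
    then show ?thesis using False zero_set_iff[OF e \<tau>(1), of y] y unfolding residual_def by simp
  next
    case True
    have fy: "local_defining_function A Y y f" using T(4) y True by blast
    have eq: "\<forall>x\<in>?W. \<tau> (e x) = f x ^ n * k x" using V(4) by blast
    show ?thesis
    proof
      assume "y \<in> residual n"
      then obtain U' \<tau>' f' W' k' where *: "(U', \<tau>') \<in> trivs L" "y \<in> U'" "local_defining_function A Y y f'"
        "open W'" "y \<in> W'" "holo_on A W' k'" "\<forall>x\<in>W'. \<tau>' (e x) = f' x ^ n * k' x" "k' y = 0"
        using True unfolding residual_def by blast
      show "k y = 0"
        by (rule quotient_zero_unique[OF True *(1,2) \<tau>(1) _ *(3) fy *(4-8) oW y hW eq]) (use y in blast)
    next
      assume "k y = 0"
      then show "y \<in> residual n"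
        unfolding residual_def using Y_zero[OF True] \<tau>(1) fy oW y hW eq by blast
    qed
  qed
  then have "residual n \<inter> ?W = {x \<in> ?W. k x = 0}" by blast
  then show ?thesis using that[OF oW _ hW] T(2) V(2,4) \<tau>(2) by blast
qed

private lemma residual_analytic:
  assumes n: "\<And>p. p \<in> Y \<Longrightarrow> n \<in> section_orders e Y p" shows "analytic_subset A (residual n)"
  unfolding analytic_subset_def
proof
  fix p
  obtain U \<tau> where \<tau>: "(U, \<tau>) \<in> trivs L" "p \<in> U" by (rule triv_at)
  show "\<exists>U F. open U \<and> p \<in> U \<and> finite F \<and> (\<forall>f\<in>F. holo_on A U f) \<and> residual n \<inter> U = {x\<in>U. \<forall>f\<in>F. f x = 0}"
  proof (cases "p \<in> Y")
    case True
    obtain f where f: "local_defining_function A Y p f" using defining_exists[OF True] by blast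
    obtain W k where "open W" "p \<in> W" "holo_on A W k" "\<And>x. x \<in> W \<Longrightarrow> \<tau> (e x) = f x ^ n * k x"
      "residual n \<inter> W = {x \<in> W. k x = 0}"
      by (rule residual_local[OF n True f \<tau>]) (assumption | rule that)+
    then show ?thesis by (intro exI[of _ W] exI[of _ "{k}"]) simp
  next
    case False
    let ?W = "U \<inter> - Y"
    have "open ?W" using closed_analytic_subset[OF Y(1)] triv_props(1)[OF \<tau>(1)] by (intro open_Int) auto
    moreover have "residual n \<inter> ?W = {x \<in> ?W. \<tau> (e x) = 0}"
      using zero_set_iff[OF e \<tau>(1)] unfolding residual_def by blast
    moreover have "holo_on A ?W (\<lambda>x. \<tau> (e x))" by (rule holo_on_subset[OF section_holo[OF e \<tau>(1)]]) simp
    ultimately show ?thesis using False \<tau> by (intro exI[of _ ?W] exI[of _ "{\<lambda>x. \<tau> (e x)}"]) simp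
  qed
qed

text \<open>If the quotient \<open>k\<close> at \<open>p\<close> vanished along \<open>Y\<close>,
  the generator would divide it, and \<open>Suc n\<close> would be an admissible exponent at
  \<open>p\<close>.\<close>

private lemma residual_not_superset:
  assumes n: "\<And>p. p \<in> Y \<Longrightarrow> n \<in> section_orders e Y p" and p: "p \<in> Y" "Suc n \<notin> section_orders e Y p"
  shows "\<not> Y \<subseteq> residual n"
proof
  assume sub: "Y \<subseteq> residual n"
  obtain U \<tau> where \<tau>: "(U, \<tau>) \<in> trivs L" "p \<in> U" by (rule triv_at)
  obtain f where f: "local_defining_function A Y p f" using defining_exists[OF p(1)] by blast
  obtain W k where W: "open W" "p \<in> W" "holo_on A W k" "\<And>x. x \<in> W \<Longrightarrow> \<tau> (e x) = f x ^ n * k x"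
    "residual n \<inter> W = {x \<in> W. k x = 0}"
    by (rule residual_local[OF n p(1) f \<tau>]) (assumption | rule that)+
  have "germ_dvd A p f k" by (rule defining_function_dvd[OF f W(1-3)]) (use W(5) sub in blast)
  then obtain V m where V: "open V" "p \<in> V" "holo_on A V m" "\<And>x. x \<in> V \<Longrightarrow> k x = f x * m x"
    by (rule germ_dvdE) (rule that)
  have "germ_dvd A p (\<lambda>x. f x ^ Suc n) (\<lambda>x. \<tau> (e x))"
  proof (rule germ_dvdI[of "W \<inter> V"])
    show "holo_on A (W \<inter> V) m" by (rule holo_on_subset[OF V(3)]) simp
    show "\<tau> (e x) = f x ^ Suc n * m x" if "x \<in> W \<inter> V" for x using W(4) V(4) that by simp
  qed (use W(1,2) V(1,2) in \<open>auto intro: open_Int\<close>)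
  then show False using p(2) section_orders_iff[OF e \<tau> f] by blast
qed

private lemma component: "irreducible_component A {x. e x \<notin> nonzero_vectors L} Y"
  unfolding irreducible_component_def
proof (intro conjI allI impI irr)
  show "Y \<subseteq> {x. e x \<notin> nonzero_vectors L}" using Y_zero by blast
  fix Z assume Z: "irreducible_subvariety A Z" "Y \<subseteq> Z" "Z \<subseteq> {x. e x \<notin> nonzero_vectors L}"
  obtain n p where n: "\<And>p. p \<in> Y \<Longrightarrow> n \<in> section_orders e Y p" and p: "p \<in> Y" "Suc n \<notin> section_orders e Y p"
    using generic_order by blast
  have aZ: "analytic_subset A Z" using Z(1) unfolding irreducible_subvariety_def by blast
  \<comment> \<open>Off \<open>Y\<close> the residual set is the whole remaining zero set, and
    \<open>Z\<close> consists of zeros.\<close>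
  have "Z = Y \<union> (Z \<inter> residual n)" using Z(2,3) unfolding residual_def by blast
  moreover have "analytic_subset A (Z \<inter> residual n)" by (rule analytic_subset_Int[OF aZ residual_analytic[OF n]])
  ultimately have "Z = Y \<or> Z = Z \<inter> residual n"
    using Z(1) Y(1) unfolding irreducible_subvariety_def by blast
  then show "Z = Y" using residual_not_superset[OF n p] Z(2) by blast
qed

lemmas positive_order_component = hypersurface component

end

end

section \<open>Comparison of the two divisors\<close>

context quantized
begin

lemma vanishing_order_at_section:
  "vanishing_order_at A {(U, \<lambda>x. \<tau> (e x)) | U \<tau>. (U, \<tau>) \<in> trivs L} Y p = Sup (section_orders e Y p)"
proof -
  have "{a. \<exists>(U, g)\<in>{(U, \<lambda>x. \<tau> (e x)) | U \<tau>. (U, \<tau>) \<in> trivs L}. \<exists>f. p \<in> U \<and> local_defining_function A Y p f \<and>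
      germ_dvd A p (\<lambda>x. f x ^ a) g} = section_orders e Y p"
    unfolding section_orders_def by blast
  then show ?thesis unfolding vanishing_order_at_def by simp
qed

lemma polar_function_value:
  assumes \<sigma>: "local_frame A L U \<sigma>" and q: "q \<in> nonzero_vectors L" and \<tau>: "(V, \<tau>) \<in> trivs L" and y: "y \<in> U" "y \<in> V"
  shows "section_inner A \<omega> h (coh (\<sigma> y)) (coh q) = \<tau> (coh q y) / \<tau> (\<sigma> y)" "\<tau> (\<sigma> y) \<noteq> 0"
proof -
  have nz: "\<sigma> y \<in> nonzero_vectors L" and pr: "proj L (\<sigma> y) = y"
    using \<sigma> y(1) unfolding local_frame_def holo_section_on_def by simp_all
  show "section_inner A \<omega> h (coh (\<sigma> y)) (coh q) = \<tau> (coh q y) / \<tau> (\<sigma> y)"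
    using coh_props(2)[OF nz coh_props(1)[OF q]] qhat_eq[OF nz coh_props(1)[OF q] \<tau>] y(2) by (simp add: pr)
  show "\<tau> (\<sigma> y) \<noteq> 0" using nonzero_iff[OF \<tau>, of "\<sigma> y"] nz y(2) by (simp add: pr)
qed

lemma local_frame_triv: assumes \<tau>: "(U, \<tau>) \<in> trivs L" shows "local_frame A L U (triv_frame L \<tau>)"
  unfolding local_frame_def holo_section_on_def
proof (intro conjI ballI)
  show "proj L (triv_frame L \<tau> x) = x" if "x \<in> U" for x using triv_frame_props(1)[OF \<tau> that] .
  show "triv_frame L \<tau> x \<in> nonzero_vectors L" if "x \<in> U" for x
    using nonzero_iff[OF \<tau>, of "triv_frame L \<tau> x"] triv_frame_props[OF \<tau> that] that by simp
  fix t assume t: "t \<in> trivs L"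
  obtain U' \<tau>' where t_eq: "t = (U', \<tau>')" by (cases t)
  obtain g where g: "holo_on A (U \<inter> U') g"
    "\<And>q. proj L q \<in> U \<Longrightarrow> proj L q \<in> U' \<Longrightarrow> g (proj L q) \<noteq> 0 \<and> \<tau>' q = g (proj L q) * \<tau> q"
    using triv_transition[OF \<tau>] t unfolding t_eq by blast
  have "holo_on A (U \<inter> U') (\<lambda>x. \<tau>' (triv_frame L \<tau> x))"
  proof (rule holo_on_cong[OF _ _ g(1)])
    show "open (U \<inter> U')" using t unfolding t_eq by (intro open_Int triv_props(1)[OF \<tau>] triv_props(1))
    show "g x = \<tau>' (triv_frame L \<tau> x)" if "x \<in> U \<inter> U'" for x
      using g(2)[of "triv_frame L \<tau> x"] triv_frame_props[OF \<tau>, of x] that by simp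
  qed
  then show "case t of (U', \<tau>') \<Rightarrow> holo_on A (U' \<inter> U) (\<lambda>x. \<tau>' (triv_frame L \<tau> x))"
    by (simp add: t_eq Int_commute)
qed

lemma vanishing_order_at_polar:
  assumes q: "q \<in> nonzero_vectors L" "proj L q = x" and k: "k \<noteq> 0"
  defines "e \<equiv> \<lambda>y. fscale L k (coh q y)"
  shows "vanishing_order_at A (polar_functions A \<omega> L h x) Y p = Sup (section_orders e Y p)"
proof -
  have e: "e \<in> sections" unfolding e_def by (rule section_scale[OF coh_props(1)[OF q(1)]])
  have \<tau>e: "\<tau> (e y) = k * \<tau> (coh q y)" if "(U, \<tau>) \<in> trivs L" "y \<in> U" for U \<tau> y
    using triv_props(4)[OF that(1), of "coh q y" k] that(2) section_proj[OF coh_props(1)[OF q(1)]] by (simp add: e_def)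
  have "(\<exists>(U, g)\<in>polar_functions A \<omega> L h x. \<exists>f. p \<in> U \<and> local_defining_function A Y p f \<and>
      germ_dvd A p (\<lambda>x. f x ^ a) g) \<longleftrightarrow> a \<in> section_orders e Y p" (is "?P \<longleftrightarrow> _") for a
  proof
    assume ?P
    then obtain U \<sigma> q' f where \<sigma>: "open U" "local_frame A L U \<sigma>" and q': "q' \<in> nonzero_vectors L" "proj L q' = x"
      and p: "p \<in> U" and f: "local_defining_function A Y p f"
      and dv: "germ_dvd A p (\<lambda>x. f x ^ a) (\<lambda>x'. section_inner A \<omega> h (coh (\<sigma> x')) (coh q'))"
      unfolding polar_functions_def by blast
    obtain V \<tau> where \<tau>: "(V, \<tau>) \<in> trivs L" "p \<in> V" by (rule triv_at)
    obtain c where c: "c \<noteq> 0" "coh q' = (\<lambda>y. fscale L c (coh q y))"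
      by (rule coh_rescale[OF q(1) q'(1)]) (use q q' in simp, rule that)
    have "holo_on A (V \<inter> U) (\<lambda>y. \<tau> (\<sigma> y))"
      using \<sigma>(2) \<tau>(1) unfolding local_frame_def holo_section_on_def by auto
    then have hol: "holo_on A (V \<inter> U) (\<lambda>y. k / c * \<tau> (\<sigma> y))" by (rule holo_on_mult[OF holo_on_const])
    \<comment> \<open>The cofactor combines the coefficient of the frame, the scalar
      \<open>k\<close> of the chosen representative \<open>e\<close> and the scalar \<open>c\<close>
      between the coherent vectors of \<open>q\<close> and \<open>q'\<close>, which lie in the same
      fibre.\<close>
    have "germ_dvd A p (\<lambda>x'. section_inner A \<omega> h (coh (\<sigma> x')) (coh q')) (\<lambda>y. \<tau> (e y))"
    proof (rule germ_dvdI[OF _ _ hol])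
      show "open (V \<inter> U)" by (intro open_Int triv_props(1)[OF \<tau>(1)] \<sigma>(1))
      fix y assume y: "y \<in> V \<inter> U"
      have "\<tau> (coh q' y) = c * \<tau> (coh q y)"
        using triv_props(4)[OF \<tau>(1), of "coh q y" c] y section_proj[OF coh_props(1)[OF q(1)]] by (simp add: c)
      then show "\<tau> (e y) = section_inner A \<omega> h (coh (\<sigma> y)) (coh q') * (k / c * \<tau> (\<sigma> y))"
        using polar_function_value[OF \<sigma>(2) q'(1) \<tau>(1), of y] \<tau>e[OF \<tau>(1), of y] y c(1) by simp
    qed (use \<tau> p in simp)
    from germ_dvd_trans[OF dv this] show "a \<in> section_orders e Y p"
      using section_orders_iff[OF e \<tau> f] by blast
  next
    assume "a \<in> section_orders e Y p"
    then obtain U \<tau> f where \<tau>: "(U, \<tau>) \<in> trivs L" "p \<in> U" and f: "local_defining_function A Y p f"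
      and dv: "germ_dvd A p (\<lambda>x. f x ^ a) (\<lambda>x. \<tau> (e x))" unfolding section_orders_def by blast
    let ?g = "\<lambda>x'. section_inner A \<omega> h (coh (triv_frame L \<tau> x')) (coh q)"
    have "(U, ?g) \<in> polar_functions A \<omega> L h x"
      unfolding polar_functions_def using triv_props(1)[OF \<tau>(1)] local_frame_triv[OF \<tau>(1)] q by blast
    moreover have "germ_dvd A p (\<lambda>x. \<tau> (e x)) ?g"
    proof (rule germ_dvdI[OF triv_props(1)[OF \<tau>(1)] \<tau>(2) holo_on_const[of U "1 / k"]])
      show "?g y = \<tau> (e y) * (1 / k)" if "y \<in> U" for y
        using polar_function_value(1)[OF local_frame_triv[OF \<tau>(1)] q(1) \<tau>(1) that that] \<tau>e[OF \<tau>(1) that]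
          triv_frame_props(2)[OF \<tau>(1) that] k by simp
    qed
    ultimately show ?P using germ_dvd_trans[OF dv] \<tau>(2) f by blast
  qed
  then show ?thesis unfolding vanishing_order_at_def by simp
qed

text \<open>The pairing in \<open>polar_set\<close> has its arguments in the opposite order to
  \<open>polar_functions\<close>. It is the conjugate of the coefficient of the coherent vector, so
  the zeros are the same, and they do not depend on \<open>q\<close> by
  \<open>coh_rescale\<close>.\<close>

lemma polar_set_eq:
  assumes q: "q \<in> nonzero_vectors L" "proj L q = x" and k: "k \<noteq> 0"
  shows "polar_set A \<omega> L h x = {y. fscale L k (coh q y) \<notin> nonzero_vectors L}"
proof -
  have "(\<forall>q1 q'. q1 \<in> nonzero_vectors L \<longrightarrow> proj L q1 = x \<longrightarrow> q' \<in> nonzero_vectors L \<longrightarrow> proj L q' = y \<longrightarrow>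
      section_inner A \<omega> h (coh q1) (coh q') = 0) \<longleftrightarrow> fscale L k (coh q y) \<notin> nonzero_vectors L" (is "?P \<longleftrightarrow> ?Q") for y
  proof -
    obtain V \<tau> where \<tau>: "(V, \<tau>) \<in> trivs L" "y \<in> V" by (rule triv_at)
    have pr: "proj L (coh q1 y) = y" if "q1 \<in> nonzero_vectors L" for q1
      by (rule section_proj[OF coh_props(1)[OF that]])
    have Q: "?Q \<longleftrightarrow> \<tau> (coh q y) = 0"
      using nonzero_iff[OF \<tau>(1), of "fscale L k (coh q y)"] triv_props(4)[OF \<tau>(1), of "coh q y" k] \<tau>(2) k pr[OF q(1)]
      by (simp add: proj_fscale)
    have val: "section_inner A \<omega> h (coh q1) (coh q') = cnj (\<tau> (coh q1 y) / \<tau> q')"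
      if "q1 \<in> nonzero_vectors L" "q' \<in> nonzero_vectors L" "proj L q' = y" for q1 q'
    proof -
      have "section_inner A \<omega> h (coh q1) (coh q') = cnj (section_inner A \<omega> h (coh q') (coh q1))"
        by (rule inner_cnj[OF coh_props(1)[OF that(2)] coh_props(1)[OF that(1)]])
      also have "section_inner A \<omega> h (coh q') (coh q1) = \<tau> (coh q1 y) / \<tau> q'"
        using coh_props(2)[OF that(2) coh_props(1)[OF that(1)]] qhat_eq[OF that(2) coh_props(1)[OF that(1)] \<tau>(1)] that(3) \<tau>(2)
        by simp
      finally show ?thesis .
    qed
    show ?thesis
    proof
      assume P: ?P
      obtain q' where q': "proj L q' = y" "\<tau> q' = 1" by (rule triv_surj[OF \<tau>])
      have "q' \<in> nonzero_vectors L" using nonzero_iff[OF \<tau>(1), of q'] q' \<tau>(2) by simp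
      then have "section_inner A \<omega> h (coh q) (coh q') = 0" using P q q'(1) by blast
      then show ?Q unfolding Q val[OF q(1) \<open>q' \<in> nonzero_vectors L\<close> q'(1)] using q'(2) by simp
    next
      assume ?Q
      then have z: "\<tau> (coh q y) = 0" using Q by simp
      show ?P
      proof (intro allI impI)
        fix q1 q' assume q1: "q1 \<in> nonzero_vectors L" "proj L q1 = x" and q': "q' \<in> nonzero_vectors L" "proj L q' = y"
        obtain c where c: "coh q1 = (\<lambda>y. fscale L c (coh q y))"
          by (rule coh_rescale[OF q(1) q1(1)]) (use q q1 in simp, rule that)
        have "\<tau> (coh q1 y) = 0" using triv_props(4)[OF \<tau>(1), of "coh q y" c] pr[OF q(1)] \<tau>(2) z by (simp add: c)
        then show "section_inner A \<omega> h (coh q1) (coh q') = 0" unfolding val[OF q1(1) q'] by simp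
      qed
    qed
  qed
  then show ?thesis unfolding polar_set_def by (intro Collect_cong)
qed

text \<open>The supremum of the empty set of naturals is 0, as is that of \<open>{0}\<close>. A
  nonzero infimum therefore yields at every point of \<open>Y\<close> a positive exponent, together
  with a defining function.\<close>

lemma positive_vanishing_order:
  assumes "(INF p\<in>Y. Sup (section_orders e Y p)) \<noteq> 0" "p \<in> Y"
  shows "\<exists>a\<in>section_orders e Y p. a \<ge> 1"
proof (rule ccontr)
  assume "\<not> ?thesis"
  then have "a = 0" if "a \<in> section_orders e Y p" for a using that by (meson less_one not_le)
  then have "section_orders e Y p \<subseteq> {0}" by blast
  then have "section_orders e Y p = {} \<or> section_orders e Y p = {0}" by (rule subset_singletonD)
  then have "Sup (section_orders e Y p) = 0"
  proof
    assume "section_orders e Y p = {}"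
    then show ?thesis by (simp only: Sup_nat_empty)
  next
    assume "section_orders e Y p = {0}"
    then show ?thesis by (simp only: cSup_singleton)
  qed
  moreover have "(INF p\<in>Y. Sup (section_orders e Y p)) \<le> Sup (section_orders e Y p)"
    by (rule cINF_lower[OF _ assms(2)]) simp
  ultimately show False using assms(1) by simp
qed

theorem section_divisor_coherent_state:
  assumes "e \<in> coherent_state A \<omega> L h x" shows "section_divisor A L e = polar_divisor A \<omega> L h x"
proof
  fix Y
  obtain k q where k: "k \<noteq> 0" and q: "q \<in> nonzero_vectors L" "proj L q = x" and e_eq: "e = (\<lambda>y. fscale L k (coh q y))"
    using assms unfolding coherent_state_def by blast
  have e: "e \<in> sections" unfolding e_eq by (rule section_scale[OF coh_props(1)[OF q(1)]])
  define N where "N = (INF p\<in>Y. Sup (section_orders e Y p))"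
  have N: "vanishing_order A {(U, \<lambda>x. \<tau> (e x)) | U \<tau>. (U, \<tau>) \<in> trivs L} Y = N"
    "vanishing_order A (polar_functions A \<omega> L h x) Y = N"
    unfolding vanishing_order_def vanishing_order_at_section
      vanishing_order_at_polar[OF q k, folded e_eq] N_def by (rule refl)+
  have V: "polar_set A \<omega> L h x = {y. e y \<notin> nonzero_vectors L}"
    unfolding e_eq by (rule polar_set_eq[OF q k])
  obtain y0 where y0: "coh q y0 \<in> nonzero_vectors L" using coh_not_zero[OF q(1)] by blast
  obtain U \<tau> where \<tau>: "(U, \<tau>) \<in> trivs L" "y0 \<in> U" by (rule triv_at)
  have ey0: "e y0 \<in> nonzero_vectors L"
    using y0 k zero_set_iff[OF e \<tau>] zero_set_iff[OF coh_props(1)[OF q(1)] \<tau>]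
      triv_props(4)[OF \<tau>(1), of "coh q y0" k] \<tau>(2) section_proj[OF coh_props(1)[OF q(1)], of y0]
    by (simp add: e_eq)
  \<comment> \<open>The side conditions of the two definitions have to agree only for nonzero order.
    For \<open>N = 0\<close> both coefficients are 0 whichever branch applies.\<close>
  have "irreducible_hypersurface A Y \<longleftrightarrow> irreducible_component A (polar_set A \<omega> L h x) Y" if "N \<noteq> 0"
  proof -
    have ord: "\<exists>a\<in>section_orders e Y p. a \<ge> 1" if "p \<in> Y" for p
      by (rule positive_vanishing_order[OF \<open>N \<noteq> 0\<close>[unfolded N_def] that])
    show ?thesis
    proof
      assume "irreducible_hypersurface A Y"
      then have "irreducible_subvariety A Y" unfolding irreducible_hypersurface_def by (rule conjunct1)
      from positive_order_component(2)[OF e ey0 this ord]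
      show "irreducible_component A (polar_set A \<omega> L h x) Y" unfolding V .
    next
      assume "irreducible_component A (polar_set A \<omega> L h x) Y"
      then have "irreducible_subvariety A Y" unfolding irreducible_component_def by (rule conjunct1)
      from positive_order_component(1)[OF e ey0 this ord] show "irreducible_hypersurface A Y" .
    qed
  qed
  then show "section_divisor A L e Y = polar_divisor A \<omega> L h x Y"
    unfolding section_divisor_def polar_divisor_def N by (cases "N = 0") simp_all
qed

end

theorem corollary3p3:
  fixes A :: "('m::t2_space, 'n::finite) chart set"
    and \<omega> :: "('m, 'n) two_form"
    and L :: "('m, 'l) line_bundle"
    and h :: "'l \<Rightarrow> 'l \<Rightarrow> complex"
    and x :: 'm
  assumes "kaehler_manifold A \<omega>"
    and "compact (UNIV :: 'm set)"
    and "connected (UNIV :: 'm set)"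
    and "quantum_line_bundle A \<omega> L h"
    and "very_ample A L"
  shows "\<forall>e\<in>coherent_state A \<omega> L h x. section_divisor A L e = polar_divisor A \<omega> L h x"
proof -
  interpret quantized A \<omega> L h
    by unfold_locales (use assms in \<open>auto simp: kaehler_manifold_def\<close>)
  show ?thesis using section_divisor_coherent_state by blast
qed

end
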